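(* Let $T>1$, let $p<1$, $p\ne0$, and $\varphi(u)=\operatorname{sgn}(p)\,[(1+u)^p-1]$ for $u\ge0$. Let $u$ be the (unique) constructed entropy solution of problem $(P)$ with $u_0=\delta_0$, and let $t_0$ be its waiting time. Then $t_0>0$ if and only if the map $u\mapsto\varphi(u)-C_\varphi u$ is bounded in $[0,\infty)$.
   Context: Problem $(P)$ is the Cauchy problem $u_t+[\varphi(u)]_x=0$ in $S:=\mathbb{R}\times(0,T)$, $u=u_0$ in $\mathbb{R}\times\{0\}$, with $u_0\in\mathcal{M}^+(\mathbb{R})$; $\delta_0$ is the Dirac mass at $0$; $C_\varphi:=\lim_{u\to\infty}\varphi(u)/u$. Measures. $\mathcal{M}(\mathbb{R})$ is the space of finite Radon measures on $\mathbb{R}$ with norm $\|\mu\|_{\mathcal{M}(\mathbb{R})}=|\mu|(\mathbb{R})$, $\mathcal{M}^+(\mathbb{R})$ the cone of nonnegative ones, and $\langle\mu,\rho\rangle_{\mathbb{R}}=\int\rho\,d\mu$. Each $\mu$ decomposes as $\mu=\mu_{ac}+\mu_s$ with respect to Lebesgue measure; $\mu_r\in L^1(\mathbb{R})$ is the density of $\mu_{ac}$. $\mu_n\stackrel{*}{\rightharpoonup}\mu$ means convergence tested against $C_c$ functions. $L^\infty(0,T;\mathcal{M}^+(\mathbb{R}))$ is the set of finite nonnegative Radon measures $u$ on $S$ such that for a.e. $t\in(0,T)$ there is $u(\cdot,t)\in\mathcal{M}^+(\mathbb{R})$ with: for $\zeta\in C([0,T];C_c(\mathbb{R}))$, $t\mapsto\langle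 u(\cdot,t),\zeta(\cdot,t)\rangle_{\mathbb{R}}$ is in $L^1(0,T)$ and $\int_S\zeta\,du=\int_0^T\langle u(\cdot,t),\zeta(\cdot,t)\rangle_{\mathbb{R}}dt$; and $t\mapsto\|u(\cdot,t)\|_{\mathcal{M}(\mathbb{R})}$ is in $L^\infty(0,T)$. For such $u$, $u_s(\cdot,t)=[u(\cdot,t)]_s$ and $u_r(\cdot,t)=[u(\cdot,t)]_r$ for a.e. $t$. Waiting time: $t_0:=\inf\{\tau\in(0,T]: u_s(\cdot,t)=0,\ u_r(\cdot,t)\in L^\infty(\mathbb{R})\text{ for a.e. }t\in(\tau,T)\}$. Solution: $u\in L^\infty(0,T;\mathcal{M}^+(\mathbb{R}))$ is a solution of $(P)$ if for all $\zeta\in C^1([0,T];C^1_c(\mathbb{R}))$ with $\zeta(\cdot,T)=0$, $$\iint_S[u_r\zeta_t+\varphi(u_r)\zeta_x]dxdt+\int_0^T\langle u_s(\cdot,t),\zeta_t(\cdot,t)+C_\varphi\zeta_x(\cdot,t)\rangle_{\mathbb{R}}dt=-\langle u_0,\zeta(\cdot,0)\rangle_{\mathbb{R}}.$$ It is an entropy solution if moreover, for all such $\zeta\ge0$ and all $E,F:[0,\infty)\to\mathbb{R}$ with $E$ convex, $E',F'\in L^\infty(0,\infty)$, $F'=E'\varphi'$ and existing limits $C_E=\lim_{u\to\infty}E(u)/u$, $C_F=\lim_{u\to\infty}F(u)/u$, $$\iint_S[E(u_r)\zeta_t+F(u_r)\zeta_x]dxdt+\int_0^T\langle u_s(\cdot,t),C_E\zeta_t(\cdot,t)+C_F\zeta_x(\cdot,t)\rangle_{\mathbb{R}}dt\ge-\int_{\mathbb{R}}E(u_{0r})\zeta(x,0)dx-C_E\langle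 u_{0s},\zeta(\cdot,0)\rangle_{\mathbb{R}}.$$ Constructed entropy solution: an entropy solution $u$ for which there are $u_{0n}\in L^1(\mathbb{R})\cap L^\infty(\mathbb{R})$, $u_{0n}\ge0$, $\|u_{0n}\|_{L^1}\le\|u_0\|_{\mathcal{M}(\mathbb{R})}$, $u_{0n}\stackrel{*}{\rightharpoonup}u_0$, $u_{0n}\to u_{0r}$ a.e. in $\mathbb{R}$ and in $L^1_{loc}(\mathbb{R}\setminus\operatorname{supp}u_{0s})$, such that a subsequence of the (Kruzkov) entropy solutions $u_n\in L^\infty(0,T;L^1(\mathbb{R}))\cap L^\infty(S)$ of $u_{nt}+[\varphi(u_n)]_x=0$ in $S$, $u_n(\cdot,0)=u_{0n}$, converges weakly* to $u$ as measures on $S$. (Entropy solution of this approximating problem: $\iint_S[E(u_n)\zeta_t+F(u_n)\zeta_x]dxdt\ge-\int_{\mathbb{R}}E(u_{0n})\zeta(x,0)dx$ for all $\zeta\in C^1([0,T];C^1_c(\mathbb{R}))$ with $\zeta\ge0$ and $\zeta(\cdot,T)=0$, and all $E$ convex, $F'=E'\varphi'$.) *)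

theory Defs
  imports "HOL-Probability.Probability"
begin

section \<open>Measures on the line and on the strip\<close>

definition mutually_singular :: "'a measure \<Rightarrow> 'a measure \<Rightarrow> bool" where
  "mutually_singular N M \<longleftrightarrow>
     (\<exists>A\<in>sets N. emeasure N A = 0 \<and> emeasure M (space N - A) = 0)"

definition lebesgue_decomposition ::
    "'a measure \<Rightarrow> 'a measure \<Rightarrow> 'a measure \<Rightarrow> 'a measure \<Rightarrow> bool" where
  "lebesgue_decomposition N M Ma Ms \<longleftrightarrow>
     sets M = sets N \<and> sets Ma = sets N \<and> sets Ms = sets N \<and>
     absolutely_continuous N Ma \<and> mutually_singular N Ms \<and>
     (\<forall>A\<in>sets N. emeasure M A = emeasure Ma A + emeasure Ms A)"

definition ac_part :: "'a measure \<Rightarrow> 'a measure \<Rightarrow> 'a measure" where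
  "ac_part N M = (THE Ma. \<exists>Ms. lebesgue_decomposition N M Ma Ms)"

definition sing_part :: "'a measure \<Rightarrow> 'a measure \<Rightarrow> 'a measure" where
  "sing_part N M = (THE Ms. \<exists>Ma. lebesgue_decomposition N M Ma Ms)"

definition ac_density :: "'a measure \<Rightarrow> 'a measure \<Rightarrow> 'a \<Rightarrow> real" where
  "ac_density N M x = enn2real (RN_deriv N (ac_part N M) x)"

definition measure_support :: "'a::topological_space measure \<Rightarrow> 'a set" where
  "measure_support M = {x. \<forall>U. open U \<longrightarrow> x \<in> U \<longrightarrow> emeasure M U > 0}"

definition Linf :: "'a measure \<Rightarrow> ('a \<Rightarrow> real) \<Rightarrow> bool" where
  "Linf M f \<longleftrightarrow> f \<in> borel_measurable M \<and> (\<exists>B. AE x in M. \<bar>f x\<bar> \<le> B)"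

text \<open>For open \<open>S\<close>: the elements of \<open>C\<^sub>c(S)\<close>, extended by zero.\<close>

definition Cc :: "'a::topological_space set \<Rightarrow> ('a \<Rightarrow> real) set" where
  "Cc S = {\<rho>. continuous_on UNIV \<rho> \<and> (\<exists>K. compact K \<and> K \<subseteq> S \<and> (\<forall>z. z \<notin> K \<longrightarrow> \<rho> z = 0))}"

definition weak_star_conv ::
    "'a::euclidean_space set \<Rightarrow> (nat \<Rightarrow> 'a \<Rightarrow> real) \<Rightarrow> 'a measure \<Rightarrow> bool" where
  "weak_star_conv S f M \<longleftrightarrow>
     (\<forall>\<rho>\<in>Cc S. (\<lambda>n. LINT z|lebesgue_on S. f n z * \<rho> z) \<longlonglongrightarrow> (LINT z|M. \<rho> z))"

definition strip :: "real \<Rightarrow> (real \<times> real) set" where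
  "strip T = UNIV \<times> {0<..<T}"

abbreviation lborel_strip :: "real \<Rightarrow> (real \<times> real) measure" where
  "lborel_strip T \<equiv> restrict_space lborel (strip T)"


section \<open>Functions of space and time: points are pairs \<open>(x, t)\<close>\<close>

text \<open>\<open>C([0,T]; C\<^sub>c(\<real>))\<close>; the supports of \<open>\<zeta>(\<cdot>,t)\<close> lie in one common
  compact set, as forced by compactness of \<open>[0,T]\<close> and the inductive limit topology.\<close>

definition C0_Cc :: "real \<Rightarrow> (real \<times> real \<Rightarrow> real) \<Rightarrow> bool" where
  "C0_Cc T \<zeta> \<longleftrightarrow> continuous_on (UNIV \<times> {0..T}) \<zeta> \<and>
     (\<exists>R. \<forall>x. \<forall>t\<in>{0..T}. R < \<bar>x\<bar> \<longrightarrow> \<zeta> (x, t) = 0)"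

text \<open>\<open>\<zeta> \<in> C\<^sup>1([0,T]; C\<^sup>1\<^sub>c(\<real>))\<close>, with \<open>\<zeta>t\<close>, \<open>\<zeta>x\<close> its partial derivatives. Both
  \<open>\<zeta>\<close> and \<open>\<zeta>t\<close> belong to \<open>C([0,T]; C\<^sup>1\<^sub>c(\<real>))\<close>, and differentiability in time for the
  norm of \<open>C\<^sup>1\<close> means that \<open>\<zeta>x\<close> has the continuous time derivative \<open>(\<zeta>t)\<^sub>x\<close>.\<close>

definition C1_C1c ::
    "real \<Rightarrow> (real \<times> real \<Rightarrow> real) \<Rightarrow> (real \<times> real \<Rightarrow> real) \<Rightarrow> (real \<times> real \<Rightarrow> real) \<Rightarrow> bool" where
  "C1_C1c T \<zeta> \<zeta>t \<zeta>x \<longleftrightarrow>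
     C0_Cc T \<zeta> \<and> C0_Cc T \<zeta>t \<and> C0_Cc T \<zeta>x \<and>
     (\<exists>\<zeta>tx. C0_Cc T \<zeta>tx \<and>
       (\<forall>x. \<forall>t\<in>{0..T}.
          ((\<lambda>y. \<zeta> (y, t)) has_real_derivative \<zeta>x (x, t)) (at x) \<and>
          ((\<lambda>s. \<zeta> (x, s)) has_real_derivative \<zeta>t (x, t)) (at t within {0..T}) \<and>
          ((\<lambda>y. \<zeta>t (y, t)) has_real_derivative \<zeta>tx (x, t)) (at x) \<and>
          ((\<lambda>s. \<zeta>x (x, s)) has_real_derivative \<zeta>tx (x, t)) (at t within {0..T})))"

definition test_function ::
    "real \<Rightarrow> (real \<times> real \<Rightarrow> real) \<Rightarrow> (real \<times> real \<Rightarrow> real) \<Rightarrow> (real \<times> real \<Rightarrow> real) \<Rightarrow> bool" where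
  "test_function T \<zeta> \<zeta>t \<zeta>x \<longleftrightarrow> C1_C1c T \<zeta> \<zeta>t \<zeta>x \<and> (\<forall>x. \<zeta> (x, T) = 0)"

definition nonneg_test_function ::
    "real \<Rightarrow> (real \<times> real \<Rightarrow> real) \<Rightarrow> (real \<times> real \<Rightarrow> real) \<Rightarrow> (real \<times> real \<Rightarrow> real) \<Rightarrow> bool" where
  "nonneg_test_function T \<zeta> \<zeta>t \<zeta>x \<longleftrightarrow>
     test_function T \<zeta> \<zeta>t \<zeta>x \<and> (\<forall>x. \<forall>t\<in>{0..T}. 0 \<le> \<zeta> (x, t))"


section \<open>The space \<open>L\<^sup>\<infinity>(0,T; M\<^sup>+(\<real>))\<close>\<close>

definition is_time_slicing ::
    "real \<Rightarrow> (real \<times> real) measure \<Rightarrow> (real \<Rightarrow> real measure) \<Rightarrow> bool" where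
  "is_time_slicing T u v \<longleftrightarrow>
     (AE t in lebesgue_on {0<..<T}. finite_borel_measure (v t)) \<and>
     (\<forall>\<zeta>. C0_Cc T \<zeta> \<longrightarrow>
        integrable (lebesgue_on {0<..<T}) (\<lambda>t. LINT x|v t. \<zeta> (x, t)) \<and>
        (LINT z|u. \<zeta> z) = (LINT t|lebesgue_on {0<..<T}. LINT x|v t. \<zeta> (x, t))) \<and>
     Linf (lebesgue_on {0<..<T}) (\<lambda>t. measure (v t) (space (v t)))"

definition Linf_measures :: "real \<Rightarrow> (real \<times> real) measure \<Rightarrow> bool" where
  "Linf_measures T u \<longleftrightarrow>
     finite_measure u \<and> sets u = sets (lborel_strip T) \<and> (\<exists>v. is_time_slicing T u v)"

text \<open>\<open>slice T u t\<close> is \<open>u(\<cdot>,t)\<close>. A time slicing of \<open>u\<close> is unique up to a null set of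
  times, and everything below is insensitive to such a null set.\<close>

definition slice :: "real \<Rightarrow> (real \<times> real) measure \<Rightarrow> real \<Rightarrow> real measure" where
  "slice T u = (SOME v. is_time_slicing T u v)"

definition slice_s :: "real \<Rightarrow> (real \<times> real) measure \<Rightarrow> real \<Rightarrow> real measure" where
  "slice_s T u t = sing_part lborel (slice T u t)"

text \<open>The density \<open>u\<^sub>r\<close> is taken on the strip, which makes it jointly measurable; for almost
  every \<open>t\<close> its section at \<open>t\<close> is the density of the absolutely continuous part
  of \<open>u(\<cdot>,t)\<close>.\<close>

definition strip_density :: "real \<Rightarrow> (real \<times> real) measure \<Rightarrow> real \<times> real \<Rightarrow> real" where
  "strip_density T u = ac_density (lborel_strip T) u"

definition waiting_time :: "real \<Rightarrow> (real \<times> real) measure \<Rightarrow> real" where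
  "waiting_time T u =
     Inf {\<tau>\<in>{0<..T}. AE t in lebesgue_on {\<tau><..<T}.
            emeasure (slice_s T u t) UNIV = 0 \<and> Linf lebesgue (\<lambda>x. strip_density T u (x, t))}"


section \<open>Solutions\<close>

definition slope_at_infinity :: "(real \<Rightarrow> real) \<Rightarrow> real" where
  "slope_at_infinity f = Lim at_top (\<lambda>u. f u / u)"

definition solution ::
    "real \<Rightarrow> (real \<Rightarrow> real) \<Rightarrow> real measure \<Rightarrow> (real \<times> real) measure \<Rightarrow> bool" where
  "solution T \<phi> u0 u \<longleftrightarrow>
     Linf_measures T u \<and>
     (\<forall>\<zeta> \<zeta>t \<zeta>x. test_function T \<zeta> \<zeta>t \<zeta>x \<longrightarrow>
        (LINT z|lebesgue_on (strip T).
            strip_density T u z * \<zeta>t z + \<phi> (strip_density T u z) * \<zeta>x z)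
        + (LINT t|lebesgue_on {0<..<T}. LINT x|slice_s T u t.
            \<zeta>t (x, t) + slope_at_infinity \<phi> * \<zeta>x (x, t))
        = - (LINT x|u0. \<zeta> (x, 0)))"

text \<open>\<open>E\<close> is convex and \<open>F' = E' \<phi>'\<close>. A convex function is differentiable off a countable set,
  so \<open>E'\<close> exists almost everywhere and the last relation is read in integrated form.
  The value of \<open>deriv\<close> at the exceptional points is irrelevant.
  Continuity of \<open>E\<close> only excludes a jump at the end point \<open>0\<close>.\<close>

definition entropy_pair :: "(real \<Rightarrow> real) \<Rightarrow> (real \<Rightarrow> real) \<Rightarrow> (real \<Rightarrow> real) \<Rightarrow> bool" where
  "entropy_pair \<phi> E F \<longleftrightarrow>
     convex_on {0..} E \<and> continuous_on {0..} E \<and>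
     (\<forall>u\<ge>0. ((\<lambda>s. deriv E s * deriv \<phi> s) has_integral (F u - F 0)) {0..u})"

definition entropy_solution ::
    "real \<Rightarrow> (real \<Rightarrow> real) \<Rightarrow> real measure \<Rightarrow> (real \<times> real) measure \<Rightarrow> bool" where
  "entropy_solution T \<phi> u0 u \<longleftrightarrow>
     solution T \<phi> u0 u \<and>
     (\<forall>\<zeta> \<zeta>t \<zeta>x E F CE CF.
        nonneg_test_function T \<zeta> \<zeta>t \<zeta>x \<longrightarrow>
        entropy_pair \<phi> E F \<longrightarrow>
        Linf (lebesgue_on {0<..}) (deriv E) \<longrightarrow> Linf (lebesgue_on {0<..}) (deriv F) \<longrightarrow>
        ((\<lambda>u. E u / u) \<longlongrightarrow> CE) at_top \<longrightarrow> ((\<lambda>u. F u / u) \<longlongrightarrow> CF) at_top \<longrightarrow>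
        (LINT z|lebesgue_on (strip T).
            E (strip_density T u z) * \<zeta>t z + F (strip_density T u z) * \<zeta>x z)
        + (LINT t|lebesgue_on {0<..<T}. LINT x|slice_s T u t.
            CE * \<zeta>t (x, t) + CF * \<zeta>x (x, t))
        \<ge> - (LINT x|lebesgue. E (ac_density lborel u0 x) * \<zeta> (x, 0))
          - CE * (LINT x|sing_part lborel u0. \<zeta> (x, 0)))"

text \<open>Entropy solutions in \<open>L\<^sup>\<infinity>(0,T; L\<^sup>1(\<real>)) \<inter> L\<^sup>\<infinity>(S)\<close> with initial function \<open>w0\<close>. They take
  values in the domain \<open>[0,\<infinity>)\<close> of the flux.\<close>

definition kruzkov_solution ::
    "real \<Rightarrow> (real \<Rightarrow> real) \<Rightarrow> (real \<Rightarrow> real) \<Rightarrow> (real \<times> real \<Rightarrow> real) \<Rightarrow> bool" where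
  "kruzkov_solution T \<phi> w0 w \<longleftrightarrow>
     Linf (lebesgue_on (strip T)) w \<and>
     (AE z in lebesgue_on (strip T). 0 \<le> w z) \<and>
     (AE t in lebesgue_on {0<..<T}. integrable lebesgue (\<lambda>x. w (x, t))) \<and>
     Linf (lebesgue_on {0<..<T}) (\<lambda>t. LINT x|lebesgue. \<bar>w (x, t)\<bar>) \<and>
     (\<forall>\<zeta> \<zeta>t \<zeta>x E F.
        nonneg_test_function T \<zeta> \<zeta>t \<zeta>x \<longrightarrow>
        entropy_pair \<phi> E F \<longrightarrow>
        (LINT z|lebesgue_on (strip T). E (w z) * \<zeta>t z + F (w z) * \<zeta>x z)
        \<ge> - (LINT x|lebesgue. E (w0 x) * \<zeta> (x, 0)))"

definition approximating_data :: "real measure \<Rightarrow> (nat \<Rightarrow> real \<Rightarrow> real) \<Rightarrow> bool" where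
  "approximating_data u0 w0 \<longleftrightarrow>
     (\<forall>n. integrable lebesgue (w0 n) \<and> Linf lebesgue (w0 n) \<and> (AE x in lebesgue. 0 \<le> w0 n x) \<and>
          (LINT x|lebesgue. \<bar>w0 n x\<bar>) \<le> measure u0 (space u0)) \<and>
     weak_star_conv UNIV w0 u0 \<and>
     (AE x in lebesgue. (\<lambda>n. w0 n x) \<longlonglongrightarrow> ac_density lborel u0 x) \<and>
     (\<forall>K. compact K \<longrightarrow> K \<subseteq> - measure_support (sing_part lborel u0) \<longrightarrow>
          (\<lambda>n. LINT x|lebesgue_on K. \<bar>w0 n x - ac_density lborel u0 x\<bar>) \<longlonglongrightarrow> 0)"

definition constructed_entropy_solution ::
    "real \<Rightarrow> (real \<Rightarrow> real) \<Rightarrow> real measure \<Rightarrow> (real \<times> real) measure \<Rightarrow> bool" where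
  "constructed_entropy_solution T \<phi> u0 u \<longleftrightarrow>
     entropy_solution T \<phi> u0 u \<and>
     (\<exists>w0 w r. approximating_data u0 w0 \<and>
        (\<forall>n. kruzkov_solution T \<phi> (w0 n) (w n)) \<and>
        strict_mono (r :: nat \<Rightarrow> nat) \<and> weak_star_conv (strip T) (\<lambda>k. w (r k)) u)"

definition flux :: "real \<Rightarrow> real \<Rightarrow> real" where
  "flux p u = sgn p * ((1 + u) powr p - 1)"

end

theory Submission
  imports Defs "HOL-Real_Asymp.Real_Asymp"
begin

text \<open>For \<open>p < 1\<close> the slope at infinity is \<open>C_\<phi> = 0\<close>, so the flux never transports the singular part of a
solution: an atom can only be eroded by the flux next to it. The map in question is \<open>\<phi>\<close> itself, which is
bounded exactly when \<open>p < 0\<close> (\<open>flux_bounded_iff\<close>). The two directions are of very different nature.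

If \<open>p < 0\<close>, then \<open>0 \<le> \<phi> \<le> 1\<close>, and the flux can carry away at most mass \<open>1\<close> per unit of time. Testing the equation
with a spike of height one at the origin shows that the atom cannot vanish for almost all times in \<open>(\<tau>, T)\<close> when
\<open>\<tau> < 1/2\<close> (\<open>atom_survives\<close>). So the waiting time is at least \<open>1/2\<close>.

If \<open>0 < p < 1\<close>, the claim is that for every \<open>\<tau> > 0\<close> the solution is bounded by a constant on \<open>\<real> \<times> (\<tau>, T)\<close>. The
atom at rest is an entropy solution too, so the bound has to come from the approximating Kruzkov solutions \<open>w\<close>, and
it may depend on their mass \<open>m \<le> 1\<close> only, not on their size. It is obtained from one entropy inequality.
Let \<open>W(x,t)\<close> be the mass of \<open>w(\<cdot>,t)\<close> to the left of \<open>x\<close>. Then \<open>0 \<le> W \<le> m\<close>, \<open>W_x = w\<close> and \<open>W_t = -\<phi>(w)\<close>. For a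
constant \<open>k\<close> the affine function \<open>L\<close> with \<open>L_x = k\<close>, \<open>L_t = -\<phi>(k)\<close> solves the same equation, and for the entropy
\<open>E(w) = (w-k)_+\<close> with flux \<open>F(w) = (\<phi>(w)-\<phi>(k))_+\<close> one has the cancellation
\<open>E(w) (W-L)_t + F(w) (W-L)_x = -(w-k)_+(\<phi>(w)-\<phi>(k)) + (\<phi>(w)-\<phi>(k))_+(w-k) = 0 .\<close>
Take the test function \<open>b(W-L) \<chi>(t) g(\<xi>)\<close> with \<open>b, g\<close> nondecreasing and zero on the negative axis, \<open>\<chi>\<close> decreasing and
zero for \<open>t \<ge> t1\<close>, and \<open>\<xi> = x - x1 + \<phi>'(k)(t1-t)\<close>. The factor \<open>b\<close> contributes nothing, and the factor \<open>g\<close> contributes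
a term of negative sign, because \<open>F \<le> \<phi>'(k) E\<close> by concavity. Hence the term with \<open>\<chi>'\<close>, negative as well,
must vanish: \<open>w \<le> k\<close> where \<open>W > L\<close>, \<open>\<xi> > 0\<close> and \<open>t < t1\<close>. If \<open>t1(\<phi>(k) - k\<phi>'(k)) \<ge> m + 1\<close>, then \<open>L\<close> can be chosen with
\<open>L \<ge> m \<ge> W\<close> for \<open>t = 0\<close>, \<open>\<xi> > 0\<close>, so that the initial function does not enter, and yet \<open>L < 0 \<le> W\<close> just to the right
of \<open>(x1,t1)\<close>. So \<open>w \<le> k\<close> there, and these regions cover \<open>\<real> \<times> (\<tau>,T)\<close>. Such \<open>k\<close> exist for every \<open>t1 > 0\<close> because
\<open>\<phi>(k) - k\<phi>'(k)\<close> is unbounded, which is where the unboundedness of the flux enters (\<open>flux_gap_unbounded\<close>).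

The rigorous version replaces \<open>W\<close> by the potential of a mollification of \<open>w\<close>; the cancellation then holds up to an
error that tends to zero because translations are continuous in the mean (\<open>barrier_integral_le\<close>). The bound passes to
the weak limit, to its density and, through countably many test functions, to almost all of its time slices
(\<open>regular_after_positive_time\<close>), whose singular parts therefore vanish.\<close>


section \<open>Translations are continuous in the mean\<close>

lemma integrable_shift:
  fixes f :: "'a::euclidean_space \<Rightarrow> real"
  assumes "integrable lborel f"
  shows "integrable lborel (\<lambda>z. f (z + v))" "(LINT z|lborel. f (z + v)) = (LINT z|lborel. f z)"
proof -
  have m[measurable]: "f \<in> borel_measurable borel"
    using assms by auto
  have i: "integrable (distr lborel borel ((+) v)) f"
    using assms by (simp add: lborel_distr_plus)
  show "integrable lborel (\<lambda>z. f (z + v))"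
    using i by (subst (asm) integrable_distr_eq) (auto simp: add.commute)
  have "(LINT z|lborel. f z) = (LINT z|distr lborel borel ((+) v). f z)"
    by (simp add: lborel_distr_plus)
  also have "\<dots> = (LINT z|lborel. f (z + v))"
    by (subst integral_distr) (auto simp: add.commute)
  finally show "(LINT z|lborel. f (z + v)) = (LINT z|lborel. f z)" ..
qed

definition shift_continuous :: "('a::euclidean_space \<Rightarrow> real) \<Rightarrow> bool" where
  "shift_continuous f \<longleftrightarrow>
     (\<forall>v. v \<longlonglongrightarrow> 0 \<longrightarrow> (\<lambda>n::nat. LINT z|lborel. \<bar>f (z + v n) - f z\<bar>) \<longlonglongrightarrow> 0)"

text \<open>The translates of the error have the same norm as the error, so that the modulus of continuity of the
approximation is inherited up to twice the error.\<close>

lemma shift_continuous_approx: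
  fixes f :: "'a::euclidean_space \<Rightarrow> real"
  assumes f: "integrable lborel f"
    and approx: "\<And>e. e > 0 \<Longrightarrow> \<exists>g. integrable lborel g \<and> shift_continuous g \<and> (LINT z|lborel. \<bar>f z - g z\<bar>) < e"
  shows "shift_continuous f"
  unfolding shift_continuous_def
proof (intro allI impI)
  fix v :: "nat \<Rightarrow> 'a" assume v: "v \<longlonglongrightarrow> 0"
  show "(\<lambda>n. LINT z|lborel. \<bar>f (z + v n) - f z\<bar>) \<longlonglongrightarrow> 0"
  proof (rule tendstoI)
    fix e :: real assume "e > 0"
    then obtain g where g: "integrable lborel g" "shift_continuous g" "(LINT z|lborel. \<bar>f z - g z\<bar>) < e/3"
      using approx[of "e/3"] by auto
    have "\<forall>\<^sub>F n in sequentially. dist (LINT z|lborel. \<bar>g (z + v n) - g z\<bar>) 0 < e/3"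
      using g(2) v \<open>e > 0\<close> unfolding shift_continuous_def by (intro tendstoD) auto
    then show "\<forall>\<^sub>F n in sequentially. dist (LINT z|lborel. \<bar>f (z + v n) - f z\<bar>) 0 < e"
    proof eventually_elim
      case (elim n)
      let ?a = "\<lambda>z. \<bar>f (z + v n) - g (z + v n)\<bar>" and ?b = "\<lambda>z. \<bar>g (z + v n) - g z\<bar>" and ?c = "\<lambda>z. \<bar>f z - g z\<bar>"
      have int: "integrable lborel ?a" "integrable lborel ?b" "integrable lborel ?c"
        using f g(1) by (intro integrable_abs Bochner_Integration.integrable_diff integrable_shift(1); simp)+
      have "(LINT z|lborel. \<bar>f (z + v n) - f z\<bar>) \<le> (LINT z|lborel. ?a z + ?b z + ?c z)"
        using f g int by (intro integral_mono integrable_abs Bochner_Integration.integrable_add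
            Bochner_Integration.integrable_diff integrable_shift(1)) auto
      also have "\<dots> = (LINT z|lborel. ?a z) + (LINT z|lborel. ?b z) + (LINT z|lborel. ?c z)"
        using int by simp
      also have "(LINT z|lborel. ?a z) = (LINT z|lborel. ?c z)"
        by (rule integrable_shift(2)[where f="?c"]) (use int in auto)
      finally show ?case using g(3) elim by (simp add: dist_real_def)
    qed
  qed
qed

lemma shift_continuous_add:
  fixes f g :: "'a::euclidean_space \<Rightarrow> real"
  assumes "integrable lborel f" "integrable lborel g" "shift_continuous f" "shift_continuous g"
  shows "shift_continuous (\<lambda>z. f z + g z)"
  unfolding shift_continuous_def
proof (intro allI impI)
  fix v :: "nat \<Rightarrow> 'a" assume v: "v \<longlonglongrightarrow> 0"
  let ?a = "\<lambda>n z. \<bar>f (z + v n) - f z\<bar>" and ?b = "\<lambda>n z. \<bar>g (z + v n) - g z\<bar>"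
  have int: "integrable lborel (?a n)" "integrable lborel (?b n)" for n
    using assms by (intro integrable_abs Bochner_Integration.integrable_diff integrable_shift(1); simp)+
  have "(\<lambda>n. (LINT z|lborel. ?a n z) + (LINT z|lborel. ?b n z)) \<longlonglongrightarrow> 0"
    using assms(3,4) v unfolding shift_continuous_def by (auto intro!: tendsto_add_zero)
  then show "(\<lambda>n. LINT z|lborel. \<bar>f (z + v n) + g (z + v n) - (f z + g z)\<bar>) \<longlonglongrightarrow> 0"
  proof (rule Lim_null_comparison[rotated], intro always_eventually allI)
    fix n
    have "(LINT z|lborel. \<bar>f (z + v n) + g (z + v n) - (f z + g z)\<bar>) \<le> (LINT z|lborel. ?a n z + ?b n z)"
      using assms int by (intro integral_mono integrable_abs Bochner_Integration.integrable_add
            Bochner_Integration.integrable_diff integrable_shift(1)) auto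
    then show "norm (LINT z|lborel. \<bar>f (z + v n) + g (z + v n) - (f z + g z)\<bar>) \<le> (LINT z|lborel. ?a n z) + (LINT z|lborel. ?b n z)"
      using int by simp
  qed
qed

text \<open>The positive part of the difference of the two indicators tends to zero pointwise, since the set is open, and is
dominated by the indicator of the set. The negative part has the same integral, since translations preserve
Lebesgue measure.\<close>

lemma shift_continuous_open:
  fixes U :: "'a::euclidean_space set"
  assumes "open U" "emeasure lborel U < \<infinity>"
  shows "shift_continuous (\<lambda>z. indicator U z * c)"
  unfolding shift_continuous_def
proof (intro allI impI)
  fix v :: "nat \<Rightarrow> 'a" assume v: "v \<longlonglongrightarrow> 0"
  let ?I = "indicator U :: 'a \<Rightarrow> real"
  have [measurable]: "U \<in> sets borel" using assms by auto
  have I: "integrable lborel ?I" using assms by (simp add: integrable_indicator_iff)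
  have I2: "integrable lborel (\<lambda>z. ?I (z + v n))" for n
    using integrable_shift(1)[OF I] .
  let ?d = "\<lambda>n z. max 0 (?I z - ?I (z + v n))"
  have "(\<lambda>n. LINT z|lborel. ?d n z) \<longlonglongrightarrow> (LINT z|lborel. (\<lambda>_. 0) (z::'a))"
  proof (rule integral_dominated_convergence[where w="?I"])
    show "AE z in lborel. (\<lambda>n. ?d n z) \<longlonglongrightarrow> 0"
    proof (intro AE_I2)
      fix z
      show "(\<lambda>n. ?d n z) \<longlonglongrightarrow> 0"
      proof (cases "z \<in> U")
        case True
        have "(\<lambda>n. z + v n) \<longlonglongrightarrow> z + 0" by (intro tendsto_intros v)
        then have "\<forall>\<^sub>F n in sequentially. z + v n \<in> U"
          using True assms by (intro topological_tendstoD) auto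
        then have "\<forall>\<^sub>F n in sequentially. ?d n z = 0"
          by eventually_elim (auto simp: True)
        then show ?thesis by (simp add: tendsto_eventually)
      next
        case False
        then have "?d n z = 0" for n by (simp add: indicator_def)
        then show ?thesis by simp
      qed
    qed
  qed (use I in \<open>auto simp: indicator_def\<close>)
  then have lim: "(\<lambda>n. 2 * \<bar>c\<bar> * (LINT z|lborel. ?d n z)) \<longlonglongrightarrow> 0"
    by (intro tendsto_mult_right_zero) simp
  have "(LINT z|lborel. \<bar>?I (z + v n) * c - ?I z * c\<bar>) = 2 * \<bar>c\<bar> * (LINT z|lborel. ?d n z)" for n
  proof -
    have d: "integrable lborel (?d n)" using I I2 by auto
    \<comment> \<open>An absolute value is twice the positive part minus the value, and the integral of the difference is zero.\<close>
    have e: "\<bar>?I (z + v n) * c - ?I z * c\<bar> = \<bar>c\<bar> * (2 * ?d n z + ?I (z + v n) - ?I z)" for z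
      by (auto simp: indicator_def)
    show ?thesis unfolding e using d I I2
      by (simp add: integrable_shift(2)[OF I])
  qed
  then show "(\<lambda>n. LINT z|lborel. \<bar>?I (z + v n) * c - ?I z * c\<bar>) \<longlonglongrightarrow> 0"
    using lim by simp
qed

text \<open>Outer regularity reduces indicators of measurable sets to indicators of open sets.\<close>

lemma integrable_imp_shift_continuous:
  fixes f :: "'a::euclidean_space \<Rightarrow> real"
  assumes "integrable lborel f"
  shows "shift_continuous f"
  using assms
proof (induction rule: integrable_induct)
  case (base A c)
  have A[measurable]: "A \<in> sets borel" using base by simp
  show ?case
  proof (rule shift_continuous_approx)
    fix e :: real assume e: "e > 0"
    define e' where "e' = e / (\<bar>c\<bar> + 1)"
    have e': "e' > 0" using e by (auto simp: e'_def)
    obtain U where U: "open U" "A \<subseteq> U" "emeasure lborel (U - A) < ennreal e'"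
      using outer_regular_lborel[OF A e'] by auto
    have [measurable]: "U \<in> sets borel" using U by auto
    have "emeasure lborel U \<le> emeasure lborel A + emeasure lborel (U - A)"
      using emeasure_subadditive[of A lborel "U - A"] U by (auto simp: Un_absorb1)
    also have "\<dots> < \<infinity>" using base U by (auto simp: ennreal_add_less_top order.strict_trans)
    finally have fin: "emeasure lborel U < \<infinity>" .
    have e2: "\<bar>indicator A z *\<^sub>R c - indicator U z * c\<bar> = \<bar>c\<bar> * indicator (U - A) z" for z
      using U by (auto simp: indicator_def)
    have "measure lborel (U - A) < e'"
      using U(3) e' by (metis emeasure_eq_ennreal_measure ennreal_less_iff measure_nonneg order_less_trans ennreal_less_top less_irrefl top.not_eq_extremum)
    then have "\<bar>c\<bar> * measure lborel (U - A) \<le> \<bar>c\<bar> * e'" by (intro mult_left_mono) auto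
    also have "\<dots> < e" using e by (simp add: e'_def field_simps)
    finally have "(LINT z|lborel. \<bar>indicator A z *\<^sub>R c - indicator U z * c\<bar>) < e"
      unfolding e2 by simp
    then show "\<exists>g. integrable lborel g \<and> shift_continuous g \<and> (LINT z|lborel. \<bar>indicator A z *\<^sub>R c - g z\<bar>) < e"
      using shift_continuous_open[OF U(1) fin, of c] fin
      by (intro exI[of _ "\<lambda>z. indicator U z * c"]) (auto simp: integrable_indicator_iff)
  qed (use base in \<open>auto simp: integrable_indicator_iff\<close>)
next
  case (add f g)
  then show ?case by (intro shift_continuous_add)
next
  case (lim f s)
  show ?case
  proof (rule shift_continuous_approx)
    fix e :: real assume e: "e > 0"
    have [measurable]: "f \<in> borel_measurable borel" "\<And>i. s i \<in> borel_measurable borel" using lim by auto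
    have "(\<lambda>i. LINT z|lborel. \<bar>f z - s i z\<bar>) \<longlonglongrightarrow> (LINT z|lborel. (\<lambda>_. 0) (z::'a))"
    proof (rule integral_dominated_convergence[where w="\<lambda>z. 3 * norm (f z)"])
      show "AE z in lborel. (\<lambda>i. \<bar>f z - s i z\<bar>) \<longlonglongrightarrow> 0"
      proof (intro AE_I2)
        fix z :: 'a
        have "(\<lambda>i. \<bar>f z - s i z\<bar>) \<longlonglongrightarrow> \<bar>f z - f z\<bar>" using lim(2)[of z] by (intro tendsto_intros) auto
        then show "(\<lambda>i. \<bar>f z - s i z\<bar>) \<longlonglongrightarrow> 0" by simp
      qed
      show "AE z in lborel. norm \<bar>f z - s i z\<bar> \<le> 3 * norm (f z)" for i
      proof (intro AE_I2)
        fix z :: 'a show "norm \<bar>f z - s i z\<bar> \<le> 3 * norm (f z)" using lim(3)[of z i] by simp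
      qed
    qed (use lim in auto)
    then have "\<forall>\<^sub>F i in sequentially. dist (LINT z|lborel. \<bar>f z - s i z\<bar>) 0 < e"
      using e by (intro tendstoD) auto
    then obtain i where "dist (LINT z|lborel. \<bar>f z - s i z\<bar>) 0 < e"
      by (auto dest: eventually_happens)
    then show "\<exists>g. integrable lborel g \<and> shift_continuous g \<and> (LINT z|lborel. \<bar>f z - g z\<bar>) < e"
      using lim by (intro exI[of _ "s i"]) auto
  qed (use lim in auto)
qed


section \<open>Mollification error and integrals with a parameter\<close>

lemma shift_continuous_modulus:
  fixes f :: "'a::euclidean_space \<Rightarrow> real"
  assumes "integrable lborel f" "e > 0"
  shows "\<exists>d>0. \<forall>v. norm v < d \<longrightarrow> (LINT z|lborel. \<bar>f (z + v) - f z\<bar>) < e"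
proof -
  have "isCont (\<lambda>v. LINT z|lborel. \<bar>f (z + v) - f z\<bar>) 0"
    using integrable_imp_shift_continuous[OF assms(1)]
    unfolding shift_continuous_def continuous_at_sequentially by (simp add: o_def)
  then show ?thesis
    using \<open>e > 0\<close> unfolding continuous_at_eps_delta by fastforce
qed

text \<open>The average of \<open>f(z + v) - f(z)\<close> over \<open>v\<close> with weight \<open>K\<close> is estimated by exchanging the integrals in \<open>z\<close> and \<open>v\<close>: the
error is an average of the moduli of continuity for shifts shorter than \<open>d\<close>.\<close>

lemma mollification_L1_error:
  fixes f K :: "'a::euclidean_space \<Rightarrow> real"
  assumes f: "integrable lborel f" and K: "integrable lborel K" "\<And>v. 0 \<le> K v" "\<And>v. K v \<le> B"
    "(LINT v|lborel. K v) = 1"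
    and supp: "\<And>v. d \<le> norm v \<Longrightarrow> K v = 0"
    and mod: "\<And>v. norm v < d \<Longrightarrow> (LINT z|lborel. \<bar>f (z + v) - f z\<bar>) \<le> e"
  shows "integrable lborel (\<lambda>z. (LINT z'|lborel. f z' * K (z' - z)) - f z)"
    and "(LINT z|lborel. \<bar>(LINT z'|lborel. f z' * K (z' - z)) - f z\<bar>) \<le> e"
proof -
  have [measurable]: "f \<in> borel_measurable borel" "K \<in> borel_measurable borel"
    using f K by auto
  let ?A = "\<lambda>z. LINT z'|lborel. f z' * K (z' - z)"
  have fK: "integrable lborel (\<lambda>v. f (z + v) * K v)" for z
  proof (rule Bochner_Integration.integrable_bound[where f="\<lambda>v. \<bar>B\<bar> * f (v + z)"])
    show "AE v in lborel. norm (f (z + v) * K v) \<le> norm (\<bar>B\<bar> * f (v + z))"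
    proof (intro AE_I2)
      fix v
      have "K v \<le> \<bar>B\<bar>" using K(3)[of v] by simp
      then show "norm (f (z + v) * K v) \<le> norm (\<bar>B\<bar> * f (v + z))"
        using K(2)[of v] by (simp add: abs_mult add.commute mult.commute mult_right_mono)
    qed
  qed (use integrable_shift(1)[OF f] in auto)
  have A: "?A z = (LINT v|lborel. f (z + v) * K v)" for z
  proof -
    have "integrable lborel (\<lambda>v. f (z + (v + - z)) * K (v + - z))"
      using integrable_shift(1)[OF fK[of z], of "-z"] by simp
    then have i: "integrable lborel (\<lambda>v. f v * K (v - z))" by simp
    show ?thesis using integrable_shift(2)[OF i, of z] by (simp add: add.commute)
  qed
  have eq: "?A z - f z = (LINT v|lborel. (f (z + v) - f z) * K v)" for z
    unfolding A using fK[of z] K by (simp add: left_diff_distrib)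
  have int: "integrable lborel (\<lambda>v. \<bar>f (z + v) - f z\<bar> * K v)" for z
  proof -
    have "integrable lborel (\<lambda>v. \<bar>f (z + v) * K v - f z * K v\<bar>)"
      using fK[of z] K(1) by (intro integrable_abs Bochner_Integration.integrable_diff) auto
    then show ?thesis using K(2) by (simp add: left_diff_distrib[symmetric] abs_mult)
  qed
  have le: "ennreal \<bar>?A z - f z\<bar> \<le> (\<integral>\<^sup>+v. ennreal (\<bar>f (z + v) - f z\<bar> * K v) \<partial>lborel)" for z
  proof -
    have "\<bar>?A z - f z\<bar> \<le> (LINT v|lborel. \<bar>(f (z + v) - f z) * K v\<bar>)"
      unfolding eq by (rule integral_abs_bound)
    also have "\<dots> = (LINT v|lborel. \<bar>f (z + v) - f z\<bar> * K v)"
      using K(2) by (simp add: abs_mult)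
    finally show ?thesis using int K(2) by (subst nn_integral_eq_integral) (auto simp: ennreal_leI)
  qed
  have "(\<integral>\<^sup>+z. ennreal \<bar>?A z - f z\<bar> \<partial>lborel) \<le> (\<integral>\<^sup>+z. (\<integral>\<^sup>+v. ennreal (\<bar>f (z + v) - f z\<bar> * K v) \<partial>lborel) \<partial>lborel)"
    by (intro nn_integral_mono le)
  also have "\<dots> = (\<integral>\<^sup>+v. (\<integral>\<^sup>+z. ennreal (\<bar>f (z + v) - f z\<bar> * K v) \<partial>lborel) \<partial>lborel)"
    by (rule lborel_pair.Fubini') measurable
  also have "\<dots> \<le> (\<integral>\<^sup>+v. ennreal e * ennreal (K v) \<partial>lborel)"
  proof (intro nn_integral_mono)
    fix v
    have i: "integrable lborel (\<lambda>z. \<bar>f (z + v) - f z\<bar>)"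
      using f integrable_shift(1)[OF f] by auto
    have "(\<integral>\<^sup>+z. ennreal (\<bar>f (z + v) - f z\<bar> * K v) \<partial>lborel) = ennreal ((LINT z|lborel. \<bar>f (z + v) - f z\<bar>) * K v)"
      using i K(2) by (subst nn_integral_eq_integral) auto
    also have "\<dots> \<le> ennreal (e * K v)"
    proof (cases "norm v < d")
      case True
      then show ?thesis using mod K(2) by (intro ennreal_leI mult_right_mono) auto
    next
      case False then show ?thesis using supp[of v] by simp
    qed
    also have "\<dots> = ennreal e * ennreal (K v)" using K(2) by (simp add: ennreal_mult'')
    finally show "(\<integral>\<^sup>+z. ennreal (\<bar>f (z + v) - f z\<bar> * K v) \<partial>lborel) \<le> ennreal e * ennreal (K v)" .
  qed
  also have "\<dots> = ennreal e"
    using K by (simp add: nn_integral_cmult nn_integral_eq_integral)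
  finally have fin: "(\<integral>\<^sup>+z. ennreal \<bar>?A z - f z\<bar> \<partial>lborel) \<le> ennreal e" .
  have m: "(\<lambda>z. ?A z - f z) \<in> borel_measurable lborel" by measurable
  show i: "integrable lborel (\<lambda>z. ?A z - f z)"
    using fin m by (auto simp: integrable_iff_bounded intro: le_less_trans)
  have e0: "0 \<le> e"
  proof (cases "d > 0")
    case True
    then show ?thesis using mod[of 0] by simp
  next
    case False
    then have "K = (\<lambda>_. 0)" using supp by (auto intro!: ext) (meson norm_ge_zero not_less order_trans)
    then show ?thesis using K(4) by simp
  qed
  show "(LINT z|lborel. \<bar>?A z - f z\<bar>) \<le> e"
    using fin i e0 by (subst (asm) nn_integral_eq_integral) auto
qed

text \<open>The mean value theorem bounds the difference quotients by \<open>B\<close>, so dominated convergence applies.\<close>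

lemma integral_has_derivative_dominated:
  fixes g g' :: "real \<Rightarrow> 'a \<Rightarrow> real"
  assumes int: "\<And>x. integrable M (g x)"
    and deriv: "\<And>x z. z \<in> space M \<Longrightarrow> ((\<lambda>x. g x z) has_real_derivative g' x z) (at x)"
    and bound: "\<And>x z. z \<in> space M \<Longrightarrow> \<bar>g' x z\<bar> \<le> B z" and B: "integrable M B"
    and meas: "\<And>x. g' x \<in> borel_measurable M"
  shows "((\<lambda>x. LINT z|M. g x z) has_real_derivative (LINT z|M. g' x z)) (at x)"
proof -
  have "((\<lambda>y. ((LINT z|M. g y z) - (LINT z|M. g x z)) / (y - x)) \<longlongrightarrow> (LINT z|M. g' x z)) (at x)"
    unfolding tendsto_at_iff_sequentially
  proof (intro allI impI)
    fix X :: "nat \<Rightarrow> real" assume X: "\<forall>i. X i \<in> UNIV - {x}" "X \<longlonglongrightarrow> x"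
    have "(\<lambda>n. LINT z|M. (g (X n) z - g x z) / (X n - x)) \<longlonglongrightarrow> (LINT z|M. g' x z)"
    proof (rule integral_dominated_convergence[where w=B])
      show "AE z in M. (\<lambda>n. (g (X n) z - g x z) / (X n - x)) \<longlonglongrightarrow> g' x z"
      proof (intro AE_I2)
        fix z assume "z \<in> space M"
        then have "((\<lambda>y. (g y z - g x z) / (y - x)) \<longlongrightarrow> g' x z) (at x)"
          using deriv by (simp add: has_field_derivative_iff)
        then show "(\<lambda>n. (g (X n) z - g x z) / (X n - x)) \<longlonglongrightarrow> g' x z"
          using X unfolding tendsto_at_iff_sequentially by (auto simp: o_def)
      qed
      show "AE z in M. norm ((g (X n) z - g x z) / (X n - x)) \<le> B z" for n
      proof (intro AE_I2)
        fix z assume z: "z \<in> space M"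
        have "norm (g (X n) z - g x z) \<le> B z * norm (X n - x)"
          by (rule field_differentiable_bound[of UNIV "\<lambda>x. g x z" "\<lambda>x. g' x z"])
            (use deriv z bound in auto)
        then show "norm ((g (X n) z - g x z) / (X n - x)) \<le> B z"
          using X by (simp add: divide_le_eq)
      qed
      show "(\<lambda>z. (g (X n) z - g x z) / (X n - x)) \<in> borel_measurable M" for n
        using int[THEN borel_measurable_integrable] by measurable
    qed (use B meas in auto)
    then show "((\<lambda>y. ((LINT z|M. g y z) - (LINT z|M. g x z)) / (y - x)) \<circ> X) \<longlonglongrightarrow> (LINT z|M. g' x z)"
      using int by (simp add: o_def)
  qed
  then show ?thesis by (simp add: has_field_derivative_iff)
qed

lemma integral_continuous_dominated:
  fixes g :: "'b::metric_space \<Rightarrow> 'a \<Rightarrow> real"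
  assumes meas: "\<And>x. g x \<in> borel_measurable M"
    and cont: "\<And>z. z \<in> space M \<Longrightarrow> continuous_on UNIV (\<lambda>x. g x z)"
    and bound: "\<And>x z. z \<in> space M \<Longrightarrow> \<bar>g x z\<bar> \<le> B z" and B: "integrable M B"
  shows "continuous_on UNIV (\<lambda>x. LINT z|M. g x z)"
  unfolding continuous_on_sequentially
proof (intro allI ballI impI)
  fix X :: "nat \<Rightarrow> 'b" and x assume X: "(\<forall>n. X n \<in> UNIV) \<and> X \<longlonglongrightarrow> x"
  have "(\<lambda>n. LINT z|M. g (X n) z) \<longlonglongrightarrow> (LINT z|M. g x z)"
  proof (rule integral_dominated_convergence[where w=B])
    show "AE z in M. (\<lambda>n. g (X n) z) \<longlonglongrightarrow> g x z"
      using cont X by (auto simp: continuous_on_sequentially o_def)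
  qed (use assms in auto)
  then show "((\<lambda>x. LINT z|M. g x z) \<circ> X) \<longlonglongrightarrow> (LINT z|M. g x z)" by (simp add: o_def)
qed


section \<open>A smooth step\<close>

definition clamp :: "real \<Rightarrow> real" where "clamp z = max 0 (min 1 z)"
text \<open>The polynomial is the primitive of \<open>30 c^2 (1-c)^2\<close>, so that two derivatives exist and the second one is continuous,
as the mixed derivative of a composition requires.\<close>

definition smoothstep :: "real \<Rightarrow> real" where "smoothstep z = (let c = clamp z in 10 * c^3 - 15 * c^4 + 6 * c^5)"
definition smoothstep' :: "real \<Rightarrow> real" where "smoothstep' z = (let c = clamp z in 30 * (c * (1 - c))\<^sup>2)"
definition smoothstep'' :: "real \<Rightarrow> real" where "smoothstep'' z = (let c = clamp z in 60 * (c * (1 - c)) * (1 - 2 * c))"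

lemma clamp_bounds: "0 \<le> clamp z" "clamp z \<le> 1" by (auto simp: clamp_def)

lemma clamp_continuous[continuous_intros]: "continuous_on A g \<Longrightarrow> continuous_on A (\<lambda>x. clamp (g x))"
  unfolding clamp_def by (intro continuous_intros)

text \<open>A polynomial whose derivative vanishes at both ends of the unit interval stays differentiable when its argument is
clamped; this is how all cut-offs below get their derivatives.\<close>

lemma clamp_comp_deriv:
  assumes Q: "\<And>c. (Q has_real_derivative Q' c) (at c)" and 0: "Q' 0 = 0" "Q' 1 = 0"
  shows "((\<lambda>z. Q (clamp z)) has_real_derivative Q' (clamp z)) (at z)"
proof (cases "0 < z \<and> z < 1")
  case True
  have "((\<lambda>z. Q (clamp z)) has_real_derivative Q' z) (at z)"
    by (rule DERIV_cong_ev[THEN iffD1, OF refl _ refl Q])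
      (use True in \<open>auto simp: clamp_def eventually_nhds intro!: exI[of _ "{0<..<1}"]\<close>)
  then show ?thesis using True by (simp add: clamp_def)
next
  case False
  then have c: "clamp z = 0 \<or> clamp z = 1" by (auto simp: clamp_def)
  then have Q0: "Q' (clamp z) = 0" using 0 by auto
  obtain R where R: "\<And>c. Q c - Q (clamp z) = R c * (c - clamp z)" "isCont R (clamp z)" "R (clamp z) = 0"
    using Q[of "clamp z", unfolded CARAT_DERIV] Q0 by auto
  have ic: "isCont clamp z"
    using clamp_continuous[of UNIV "\<lambda>x. x"] by (simp add: continuous_on_eq_continuous_at)
  have "((\<lambda>y. R (clamp y)) \<longlongrightarrow> 0) (at z)"
    using isCont_o2[OF ic R(2)] R(3) by (simp add: isCont_def)
  then have "((\<lambda>y. (Q (clamp y) - Q (clamp z)) / (y - z)) \<longlongrightarrow> 0) (at z)"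
  proof (rule Lim_null_comparison[rotated, OF tendsto_norm_zero], intro always_eventually allI)
    fix y
    have "\<bar>clamp y - clamp z\<bar> \<le> \<bar>y - z\<bar>" by (auto simp: clamp_def)
    then have "\<bar>R (clamp y)\<bar> * \<bar>clamp y - clamp z\<bar> \<le> \<bar>R (clamp y)\<bar> * \<bar>y - z\<bar>"
      by (intro mult_left_mono) auto
    then show "norm ((Q (clamp y) - Q (clamp z)) / (y - z)) \<le> norm (R (clamp y))"
      by (cases "y = z") (simp_all add: R(1) abs_mult pos_divide_le_eq)
  qed
  then show ?thesis by (simp add: has_field_derivative_iff Q0)
qed

lemma smoothstep_deriv: "(smoothstep has_real_derivative smoothstep' z) (at z)"
  unfolding smoothstep_def[abs_def] smoothstep'_def Let_def
  by (rule clamp_comp_deriv) (auto intro!: derivative_eq_intros simp: algebra_simps power2_eq_square power3_eq_cube eval_nat_numeral)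

lemma smoothstep'_deriv: "(smoothstep' has_real_derivative smoothstep'' z) (at z)"
  unfolding smoothstep'_def[abs_def] smoothstep''_def Let_def
  by (rule clamp_comp_deriv) (auto intro!: derivative_eq_intros simp: algebra_simps power2_eq_square)

lemma smoothstep_continuous[continuous_intros]:
  assumes "continuous_on A g"
  shows "continuous_on A (\<lambda>x. smoothstep (g x))" "continuous_on A (\<lambda>x. smoothstep' (g x))" "continuous_on A (\<lambda>x. smoothstep'' (g x))"
  unfolding smoothstep_def smoothstep'_def smoothstep''_def Let_def by (intro continuous_intros assms)+

lemma smoothstep_measurable[measurable]:
  "smoothstep \<in> borel_measurable borel" "smoothstep' \<in> borel_measurable borel" "smoothstep'' \<in> borel_measurable borel"
  by (intro borel_measurable_continuous_onI continuous_intros)+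

lemma smoothstep'_nonneg: "0 \<le> smoothstep' z" by (simp add: smoothstep'_def Let_def)

lemma smoothstep_le0[simp]: "z \<le> 0 \<Longrightarrow> smoothstep z = 0" by (simp add: smoothstep_def clamp_def)
lemma smoothstep_ge1[simp]: "z \<ge> 1 \<Longrightarrow> smoothstep z = 1" by (simp add: smoothstep_def clamp_def)
lemma smoothstep'_le0[simp]: "z \<le> 0 \<Longrightarrow> smoothstep' z = 0" by (simp add: smoothstep'_def clamp_def)
lemma smoothstep'_ge1[simp]: "z \<ge> 1 \<Longrightarrow> smoothstep' z = 0" by (simp add: smoothstep'_def clamp_def)
lemma smoothstep'_pos: "0 < z \<Longrightarrow> z < 1 \<Longrightarrow> 0 < smoothstep' z"
  by (simp add: smoothstep'_def clamp_def)

lemma smoothstep_mono: "a \<le> b \<Longrightarrow> smoothstep a \<le> smoothstep b"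
  by (rule DERIV_nonneg_imp_nondecreasing) (auto intro: smoothstep_deriv smoothstep'_nonneg)

lemma smoothstep_bounds: "0 \<le> smoothstep z" "smoothstep z \<le> 1"
  using smoothstep_mono[of "min 0 z" z] smoothstep_mono[of z "max 1 z"] by auto

lemma smoothstep_pos: assumes "0 < z" shows "0 < smoothstep z"
proof -
  let ?c = "clamp z"
  have c: "0 < ?c" "?c \<le> 1" using assms by (auto simp: clamp_def)
  have "smoothstep z = ?c^3 * (10 - 15 * ?c + 6 * ?c^2)" by (simp add: smoothstep_def Let_def algebra_simps eval_nat_numeral)
  moreover have "10 - 15 * ?c + 6 * ?c^2 = (1 - ?c) * (9 - 6 * ?c) + 1" by (simp add: algebra_simps power2_eq_square)
  moreover have "(1 - ?c) * (9 - 6 * ?c) \<ge> 0" using c by (intro mult_nonneg_nonneg) auto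
  ultimately show ?thesis using c by (metis add_nonneg_pos mult_pos_pos zero_less_one zero_less_power)
qed

lemma smoothstep'_le: "smoothstep' z \<le> 2"
proof -
  let ?c = "clamp z"
  have "?c * (1 - ?c) = 1/4 - (?c - 1/2)^2" by (simp add: algebra_simps power2_eq_square)
  then have "?c * (1 - ?c) \<le> 1/4" by simp
  moreover have "0 \<le> ?c * (1 - ?c)" using clamp_bounds[of z] by simp
  ultimately have "(?c * (1 - ?c))\<^sup>2 \<le> (1/4)\<^sup>2" by (intro power_mono)
  also have "\<dots> = 1/16" by (simp add: power2_eq_square)
  finally show ?thesis unfolding smoothstep'_def Let_def by linarith
qed

lemma smoothstep''_le: "\<bar>smoothstep'' z\<bar> \<le> 60"
proof -
  let ?c = "clamp z"
  have c: "0 \<le> ?c" "?c \<le> 1" by (rule clamp_bounds)+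
  have "\<bar>?c * (1 - ?c)\<bar> * \<bar>1 - 2 * ?c\<bar> \<le> 1 * 1"
    using c by (intro mult_mono) (auto simp: abs_mult intro!: mult_le_one)
  then show ?thesis by (simp add: smoothstep''_def Let_def abs_mult)
qed

lemma smoothstep'_has_integral: "has_bochner_integral lborel smoothstep' 1"
proof -
  have "has_bochner_integral lborel (\<lambda>x. smoothstep' x * indicator {0..1} x) (smoothstep 1 - smoothstep 0)"
    by (rule has_bochner_integral_FTC_Icc_real)
      (auto intro!: smoothstep_deriv DERIV_isCont[OF smoothstep'_deriv])
  also have "(\<lambda>x. smoothstep' x * indicator {0..1} x) = smoothstep'"
  proof
    fix x show "smoothstep' x * indicator {0..1} x = smoothstep' x"
      using smoothstep'_le0[of x] smoothstep'_ge1[of x] by (cases "0 \<le> x"; cases "x \<le> 1") auto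
  qed
  finally show ?thesis by simp
qed


section \<open>Functions with a continuous mixed derivative\<close>

text \<open>The test functions of the problem are required to have a continuous mixed derivative in addition to the two first
ones. This class is closed under products and composition, which allows test functions to be assembled from
factors.\<close>

definition mixed_C1 :: "(real \<times> real \<Rightarrow> real) \<Rightarrow> (real \<times> real \<Rightarrow> real) \<Rightarrow> (real \<times> real \<Rightarrow> real) \<Rightarrow> (real \<times> real \<Rightarrow> real) \<Rightarrow> bool" where
  "mixed_C1 f ft fx ftx \<longleftrightarrow> continuous_on UNIV f \<and> continuous_on UNIV ft \<and> continuous_on UNIV fx \<and> continuous_on UNIV ftx \<and>
     (\<forall>x t. ((\<lambda>y. f (y, t)) has_real_derivative fx (x, t)) (at x) \<and>
            ((\<lambda>s. f (x, s)) has_real_derivative ft (x, t)) (at t) \<and>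
            ((\<lambda>y. ft (y, t)) has_real_derivative ftx (x, t)) (at x) \<and>
            ((\<lambda>s. fx (x, s)) has_real_derivative ftx (x, t)) (at t))"

lemma mixed_C1_mult:
  assumes "mixed_C1 f ft fx ftx" "mixed_C1 g gt gx gtx"
  shows "mixed_C1 (\<lambda>z. f z * g z) (\<lambda>z. ft z * g z + f z * gt z) (\<lambda>z. fx z * g z + f z * gx z)
     (\<lambda>z. ftx z * g z + ft z * gx z + fx z * gt z + f z * gtx z)"
  using assms unfolding mixed_C1_def
  by (auto intro!: continuous_intros derivative_eq_intros DERIV_cong[OF DERIV_add[OF DERIV_mult DERIV_mult]] DERIV_cong[OF DERIV_mult] simp: algebra_simps)

lemma mixed_C1_comp:
  assumes f: "mixed_C1 f ft fx ftx"
    and g: "\<And>s. (g has_real_derivative g' s) (at s)" "\<And>s. (g' has_real_derivative g'' s) (at s)" "continuous_on UNIV g''"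
  shows "mixed_C1 (\<lambda>z. g (f z)) (\<lambda>z. g' (f z) * ft z) (\<lambda>z. g' (f z) * fx z)
     (\<lambda>z. g'' (f z) * fx z * ft z + g' (f z) * ftx z)"
proof -
  have c: "continuous_on UNIV g" "continuous_on UNIV g'"
    using g(1,2) by (auto intro!: continuous_at_imp_continuous_on DERIV_isCont)
  have cf: "continuous_on UNIV f" "continuous_on UNIV ft" "continuous_on UNIV fx" "continuous_on UNIV ftx"
    using f by (auto simp: mixed_C1_def)
  have cc: "continuous_on UNIV (\<lambda>z. g (f z))" "continuous_on UNIV (\<lambda>z. g' (f z))" "continuous_on UNIV (\<lambda>z. g'' (f z))"
    using c g(3) cf(1) by (auto intro: continuous_on_compose2)
  have ch: "((\<lambda>y. g (f (y, t))) has_real_derivative g' (f (x, t)) * fx (x, t)) (at x)"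
    "((\<lambda>s. g (f (x, s))) has_real_derivative g' (f (x, t)) * ft (x, t)) (at t)"
    "((\<lambda>y. g' (f (y, t))) has_real_derivative g'' (f (x, t)) * fx (x, t)) (at x)"
    "((\<lambda>s. g' (f (x, s))) has_real_derivative g'' (f (x, t)) * ft (x, t)) (at t)" for x t
    using f unfolding mixed_C1_def by (auto intro!: DERIV_chain2[OF g(1)] DERIV_chain2[OF g(2)])
  show ?thesis unfolding mixed_C1_def
  proof (intro conjI allI)
    fix x t
    show "((\<lambda>y. g' (f (y, t)) * ft (y, t)) has_real_derivative
         g'' (f (x, t)) * fx (x, t) * ft (x, t) + g' (f (x, t)) * ftx (x, t)) (at x)"
      using f unfolding mixed_C1_def by (intro DERIV_cong[OF DERIV_mult[OF ch(3)]]) auto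
    show "((\<lambda>s. g' (f (x, s)) * fx (x, s)) has_real_derivative
         g'' (f (x, t)) * fx (x, t) * ft (x, t) + g' (f (x, t)) * ftx (x, t)) (at t)"
      using f unfolding mixed_C1_def by (intro DERIV_cong[OF DERIV_mult[OF ch(4)]]) auto
  qed (auto intro!: continuous_intros cc cf ch)
qed

lemma mixed_C1_affine: "mixed_C1 (\<lambda>z. a + b * fst z + c * snd z) (\<lambda>z. c) (\<lambda>z. b) (\<lambda>z. 0)"
  unfolding mixed_C1_def by (auto intro!: continuous_intros derivative_eq_intros)

lemma mixed_C1_diff:
  assumes "mixed_C1 f ft fx ftx" "mixed_C1 g gt gx gtx"
  shows "mixed_C1 (\<lambda>z. f z - g z) (\<lambda>z. ft z - gt z) (\<lambda>z. fx z - gx z) (\<lambda>z. ftx z - gtx z)"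
  using assms unfolding mixed_C1_def by (auto intro!: continuous_intros DERIV_diff)

lemma mixed_C1_prod:
  assumes "\<And>z. (\<alpha> has_real_derivative \<alpha>' z) (at z)" "\<And>z. (\<beta> has_real_derivative \<beta>' z) (at z)"
    and c: "continuous_on UNIV \<alpha>'" "continuous_on UNIV \<beta>'"
  shows "mixed_C1 (\<lambda>z. \<alpha> (fst z) * \<beta> (snd z)) (\<lambda>z. \<alpha> (fst z) * \<beta>' (snd z)) (\<lambda>z. \<alpha>' (fst z) * \<beta> (snd z)) (\<lambda>z. \<alpha>' (fst z) * \<beta>' (snd z))"
proof -
  have c': "continuous_on UNIV \<alpha>" "continuous_on UNIV \<beta>"
    using assms(1,2) by (auto intro!: continuous_at_imp_continuous_on DERIV_isCont)
  show ?thesis unfolding mixed_C1_def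
    using assms(1,2)
    by (auto intro!: continuous_intros continuous_on_compose2[OF c'(1)] continuous_on_compose2[OF c'(2)]
      continuous_on_compose2[OF c(1)] continuous_on_compose2[OF c(2)] DERIV_cmult DERIV_cmult_right)
qed

text \<open>Derivatives vanish off the support of the function by uniqueness of derivatives, so that only the support of
the function itself has to be known.\<close>

lemma mixed_C1_imp_C1_C1c:
  assumes "mixed_C1 f ft fx ftx" "0 < T" and R: "\<And>x t. 0 \<le> t \<Longrightarrow> t \<le> T \<Longrightarrow> R < \<bar>x\<bar> \<Longrightarrow> f (x, t) = 0"
  shows "C1_C1c T f ft fx"
proof -
  have d: "((\<lambda>y. f (y, t)) has_real_derivative fx (x, t)) (at x)"
            "((\<lambda>s. f (x, s)) has_real_derivative ft (x, t)) (at t)"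
            "((\<lambda>y. ft (y, t)) has_real_derivative ftx (x, t)) (at x)"
            "((\<lambda>s. fx (x, s)) has_real_derivative ftx (x, t)) (at t)" for x t
    using assms(1) by (auto simp: mixed_C1_def)
  have xz: "g' = 0" if "(g has_real_derivative g') (at x)" "\<And>y. R < \<bar>y\<bar> \<Longrightarrow> g y = 0" "R < \<bar>x\<bar>" for g g' and x :: real
  proof -
    have "\<forall>\<^sub>F y in nhds x. R < \<bar>y\<bar>"
      using that(3) by (intro eventually_nhds_in_open[of "{y. R < \<bar>y\<bar>}", simplified] open_Collect_less continuous_intros)
    then have "\<forall>\<^sub>F y in nhds x. g y = 0" by eventually_elim (use that in auto)
    then have "((\<lambda>_. 0) has_real_derivative g') (at x)"
      using that(1) DERIV_cong_ev[OF refl, of g "\<lambda>_. 0" x g' g'] by simp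
    then show ?thesis using DERIV_unique DERIV_const by blast
  qed
  have fx0: "fx (x, t) = 0" if "0 \<le> t" "t \<le> T" "R < \<bar>x\<bar>" for x t
    by (rule xz[OF d(1)]) (use R that in auto)
  have ft0: "ft (x, t) = 0" if "0 \<le> t" "t \<le> T" "R < \<bar>x\<bar>" for x t
  proof -
    have "((\<lambda>s. f (x, s)) has_real_derivative ft (x, t)) (at t within {0..T})"
      using d(2) by (rule has_field_derivative_at_within)
    then have "((\<lambda>s. 0) has_real_derivative ft (x, t)) (at t within {0..T})"
      by (rule has_field_derivative_transform_within[where d=1]) (use R that in auto)
    then have "((\<lambda>s. 0) has_vector_derivative ft (x, t)) (at t within {0..T})"
      by (simp add: has_real_derivative_iff_has_vector_derivative)
    moreover have "at t within {0..T} \<noteq> bot"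
      using that \<open>0 < T\<close> by (simp add: trivial_limit_within islimpt_Icc)
    ultimately show ?thesis
      using vector_derivative_unique_within[of t "{0..T}"] has_vector_derivative_const by metis
  qed
  have ftx0: "ftx (x, t) = 0" if "0 \<le> t" "t \<le> T" "R < \<bar>x\<bar>" for x t
    by (rule xz[OF d(3)]) (use ft0 that in auto)
  have c: "continuous_on (UNIV \<times> {0..T}) f" "continuous_on (UNIV \<times> {0..T}) ft" "continuous_on (UNIV \<times> {0..T}) fx" "continuous_on (UNIV \<times> {0..T}) ftx"
    using assms(1) unfolding mixed_C1_def by (auto intro: continuous_on_subset)
  show ?thesis unfolding C1_C1c_def C0_Cc_def
    using c d R fx0 ft0 ftx0 by (intro conjI exI[of _ ftx] exI[of _ R]) (auto intro: has_field_derivative_at_within)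
qed

section \<open>Mollification forward in time\<close>

text \<open>With \<open>\<alpha>\<close> an approximate Heaviside function this is an approximation of the mass of \<open>f\<close> to the left of \<open>x\<close>; with \<open>\<alpha>\<close>
and \<open>\<beta>\<close> both bumps it is an average of \<open>f\<close>. The time variable is reflected: for \<open>\<beta>\<close> supported in \<open>[0,h]\<close> only times
between \<open>t\<close> and \<open>t+h\<close> contribute, so that for \<open>t \<ge> 0\<close> the kernel, as a function of \<open>w\<close>, vanishes at the
initial time.\<close>

definition mollify :: "(real \<times> real \<Rightarrow> real) \<Rightarrow> (real \<Rightarrow> real) \<Rightarrow> (real \<Rightarrow> real) \<Rightarrow> real \<times> real \<Rightarrow> real" where
  "mollify f \<alpha> \<beta> z = (LINT w|lborel. f w * (\<alpha> (fst z - fst w) * \<beta> (snd w - snd z)))"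

lemma fst_snd_borel[measurable]:
  "(fst :: real \<times> real \<Rightarrow> real) \<in> borel_measurable borel" "(snd :: real \<times> real \<Rightarrow> real) \<in> borel_measurable borel"
  by (intro borel_measurable_continuous_onI continuous_intros)+

lemma bounded_mult_integrable:
  fixes f g :: "'a \<Rightarrow> real"
  assumes "integrable M f" "g \<in> borel_measurable M" "\<And>z. \<bar>g z\<bar> \<le> C"
  shows "integrable M (\<lambda>z. f z * g z)"
proof (rule Bochner_Integration.integrable_bound[where f="\<lambda>z. C * f z"])
  have C: "0 \<le> C" using assms(3)[of undefined] by linarith
  show "AE z in M. norm (f z * g z) \<le> norm (C * f z)"
    using assms(3) C by (intro AE_I2) (simp add: abs_mult mult.commute[of C] mult_left_mono)
qed (use assms in auto)

lemma mollify_integrable: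
  fixes f :: "real \<times> real \<Rightarrow> real" and z :: "real \<times> real"
  assumes "integrable lborel f" "continuous_on UNIV \<alpha>" "continuous_on UNIV \<beta>" "\<And>z. \<bar>\<alpha> z\<bar> \<le> (C::real)" "\<And>z. \<bar>\<beta> z\<bar> \<le> (D::real)"
  shows "integrable lborel (\<lambda>w. f w * (\<alpha> (fst z - fst w) * \<beta> (snd w - snd z)))"
proof (rule bounded_mult_integrable[where C="C*D"])
  have [measurable]: "\<alpha> \<in> borel_measurable borel" "\<beta> \<in> borel_measurable borel"
    using assms by (auto intro: borel_measurable_continuous_onI)
  have "(\<lambda>w. \<alpha> (fst z - fst w) * \<beta> (snd w - snd z)) \<in> borel_measurable borel" by measurable
  then show "(\<lambda>w. \<alpha> (fst z - fst w) * \<beta> (snd w - snd z)) \<in> borel_measurable lborel" by simp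
  show "\<bar>\<alpha> (fst z - fst w) * \<beta> (snd w - snd z)\<bar> \<le> C * D" for w
    using assms(4)[of "fst z - fst w"] assms(5)[of "snd w - snd z"] by (auto simp: abs_mult intro: mult_mono)
qed (use assms in auto)

lemma mollify_continuous:
  assumes "integrable lborel f" "continuous_on UNIV \<alpha>" "continuous_on UNIV \<beta>" "\<And>z. \<bar>\<alpha> z\<bar> \<le> (C::real)" "\<And>z. \<bar>\<beta> z\<bar> \<le> (D::real)"
  shows "continuous_on UNIV (mollify f \<alpha> \<beta>)"
  unfolding mollify_def[abs_def]
proof (rule integral_continuous_dominated[where B="\<lambda>w. \<bar>f w\<bar> * (C * D)"])
  fix z :: "real \<times> real"
  show "(\<lambda>w. f w * (\<alpha> (fst z - fst w) * \<beta> (snd w - snd z))) \<in> borel_measurable lborel"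
    using mollify_integrable[OF assms, of z] by simp
next
  fix w
  show "continuous_on UNIV (\<lambda>z. f w * (\<alpha> (fst z - fst w) * \<beta> (snd w - snd z)))"
    using assms(2,3) by (intro continuous_intros continuous_on_compose2[OF assms(2)] continuous_on_compose2[OF assms(3)]) auto
next
  fix z w
  show "\<bar>f w * (\<alpha> (fst z - fst w) * \<beta> (snd w - snd z))\<bar> \<le> \<bar>f w\<bar> * (C * D)"
    unfolding abs_mult using assms(4)[of "fst z - fst w"] assms(5)[of "snd w - snd z"] by (intro mult_mono) auto
qed (use assms in auto)

lemma mollify_deriv_x:
  assumes f: "integrable lborel f" and d: "\<And>z. (\<alpha> has_real_derivative \<alpha>' z) (at z)"
    and c: "continuous_on UNIV \<alpha>'" "continuous_on UNIV \<beta>" and b: "\<And>z. \<bar>\<alpha> z\<bar> \<le> C" "\<And>z. \<bar>\<alpha>' z\<bar> \<le> C'" "\<And>z. \<bar>\<beta> z\<bar> \<le> D"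
  shows "((\<lambda>y. mollify f \<alpha> \<beta> (y, t)) has_real_derivative mollify f \<alpha>' \<beta> (x, t)) (at x)"
  unfolding mollify_def fst_conv snd_conv
proof (rule integral_has_derivative_dominated[where B="\<lambda>w. \<bar>f w\<bar> * (C' * D)"])
  have c': "continuous_on UNIV \<alpha>" using d by (auto intro!: continuous_at_imp_continuous_on DERIV_isCont)
  show "integrable lborel (\<lambda>w. f w * (\<alpha> (y - fst w) * \<beta> (snd w - t)))" for y
    using mollify_integrable[OF f c' c(2) b(1,3), of "(y,t)"] by simp
  show "(\<lambda>w. f w * (\<alpha>' (y - fst w) * \<beta> (snd w - t))) \<in> borel_measurable lborel" for y
    using mollify_integrable[OF f c b(2,3), of "(y,t)"] by simp
  show "((\<lambda>x. f w * (\<alpha> (x - fst w) * \<beta> (snd w - t))) has_real_derivative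
         f w * (\<alpha>' (y - fst w) * \<beta> (snd w - t))) (at y)" for y w
  proof -
    have "((\<lambda>x. \<alpha> (x - fst w)) has_real_derivative \<alpha>' (y - fst w) * 1) (at y)"
      by (rule DERIV_chain2[OF d]) (auto intro!: derivative_eq_intros)
    then show ?thesis by (auto intro!: derivative_eq_intros)
  qed
  show "\<bar>f w * (\<alpha>' (y - fst w) * \<beta> (snd w - t))\<bar> \<le> \<bar>f w\<bar> * (C' * D)" for y w
    unfolding abs_mult using b(2)[of "y - fst w"] b(3)[of "snd w - t"] by (intro mult_mono) auto
qed (use f in auto)

lemma mollify_deriv_t:
  assumes f: "integrable lborel f" and d: "\<And>z. (\<beta> has_real_derivative \<beta>' z) (at z)"
    and c: "continuous_on UNIV \<alpha>" "continuous_on UNIV \<beta>'" and b: "\<And>z. \<bar>\<alpha> z\<bar> \<le> C" "\<And>z. \<bar>\<beta> z\<bar> \<le> D" "\<And>z. \<bar>\<beta>' z\<bar> \<le> D'"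
  shows "((\<lambda>s. mollify f \<alpha> \<beta> (x, s)) has_real_derivative - mollify f \<alpha> \<beta>' (x, t)) (at t)"
  unfolding mollify_def fst_conv snd_conv integral_minus[symmetric]
proof (rule integral_has_derivative_dominated[where B="\<lambda>w. \<bar>f w\<bar> * (C * D')"])
  have c': "continuous_on UNIV \<beta>" using d by (auto intro!: continuous_at_imp_continuous_on DERIV_isCont)
  show "integrable lborel (\<lambda>w. f w * (\<alpha> (x - fst w) * \<beta> (snd w - s)))" for s
    using mollify_integrable[OF f c(1) c' b(1,2), of "(x,s)"] by simp
  show "(\<lambda>w. - (f w * (\<alpha> (x - fst w) * \<beta>' (snd w - s)))) \<in> borel_measurable lborel" for s
    using mollify_integrable[OF f c b(1,3), of "(x,s)"] by (intro borel_measurable_uminus) simp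
  show "((\<lambda>s. f w * (\<alpha> (x - fst w) * \<beta> (snd w - s))) has_real_derivative
         - (f w * (\<alpha> (x - fst w) * \<beta>' (snd w - s)))) (at s)" for s w
  proof -
    have "((\<lambda>s. \<beta> (snd w - s)) has_real_derivative \<beta>' (snd w - s) * -1) (at s)"
      by (rule DERIV_chain2[OF d]) (auto intro!: derivative_eq_intros)
    then show ?thesis by (auto intro!: derivative_eq_intros)
  qed
  show "\<bar>- (f w * (\<alpha> (x - fst w) * \<beta>' (snd w - s)))\<bar> \<le> \<bar>f w\<bar> * (C * D')" for s w
    unfolding abs_minus_cancel abs_mult using b(1)[of "x - fst w"] b(3)[of "snd w - s"] by (intro mult_mono) auto
qed (use f in auto)

lemma mollify_mixed_C1:
  assumes f: "integrable lborel f"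
    and d: "\<And>z. (\<alpha> has_real_derivative \<alpha>' z) (at z)" "\<And>z. (\<beta> has_real_derivative \<beta>' z) (at z)"
    and c: "continuous_on UNIV \<alpha>'" "continuous_on UNIV \<beta>'"
    and b: "\<And>z. \<bar>\<alpha> z\<bar> \<le> C" "\<And>z. \<bar>\<alpha>' z\<bar> \<le> C'" "\<And>z. \<bar>\<beta> z\<bar> \<le> D" "\<And>z. \<bar>\<beta>' z\<bar> \<le> D'"
  shows "mixed_C1 (mollify f \<alpha> \<beta>) (\<lambda>z. - mollify f \<alpha> \<beta>' z) (mollify f \<alpha>' \<beta>) (\<lambda>z. - mollify f \<alpha>' \<beta>' z)"
proof -
  have c': "continuous_on UNIV \<alpha>" "continuous_on UNIV \<beta>"
    using d by (auto intro!: continuous_at_imp_continuous_on DERIV_isCont)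
  note m = mollify_continuous[OF f c'(1) c'(2) b(1,3)] mollify_continuous[OF f c'(1) c(2) b(1,4)]
     mollify_continuous[OF f c(1) c'(2) b(2,3)] mollify_continuous[OF f c(1) c(2) b(2,4)]
  show ?thesis unfolding mixed_C1_def
    by (intro conjI allI continuous_on_minus m DERIV_minus mollify_deriv_x[OF f d(1) c(1) c'(2) b(1,2,3)]
      mollify_deriv_x[OF f d(1) c(1) c(2) b(1,2,4)] mollify_deriv_t[OF f d(2) c'(1) c(2) b(1,3,4)] mollify_deriv_t[OF f d(2) c(1) c(2) b(2,3,4)])
qed

definition bump :: "real \<Rightarrow> real \<Rightarrow> real" where "bump h z = smoothstep' (z / h) / h"
definition bump' :: "real \<Rightarrow> real \<Rightarrow> real" where "bump' h z = smoothstep'' (z / h) / h / h"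

lemma smoothstep_scaled_deriv: "h \<noteq> 0 \<Longrightarrow> ((\<lambda>z. smoothstep (z / h)) has_real_derivative bump h z) (at z)"
  unfolding bump_def by (rule DERIV_cong[OF DERIV_chain2[OF smoothstep_deriv]]) (auto intro!: derivative_eq_intros)
lemma bump_deriv: "h \<noteq> 0 \<Longrightarrow> (bump h has_real_derivative bump' h z) (at z)"
  unfolding bump_def[abs_def] bump'_def by (rule DERIV_cong[OF DERIV_cdivide[OF DERIV_chain2[OF smoothstep'_deriv]]]) (auto intro!: derivative_eq_intros)

lemma bump_continuous[continuous_intros]:
  assumes "continuous_on A g"
  shows "continuous_on A (\<lambda>x. bump h (g x))" "continuous_on A (\<lambda>x. bump' h (g x))"
  unfolding bump_def bump'_def divide_inverse by (intro continuous_intros assms)+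

lemma bump_measurable[measurable]: "bump h \<in> borel_measurable borel" "bump' h \<in> borel_measurable borel"
  by (intro borel_measurable_continuous_onI continuous_intros)+

lemma bump_bounds: assumes "0 < h" shows "0 \<le> bump h z" "\<bar>bump h z\<bar> \<le> 2 / h" "\<bar>bump' h z\<bar> \<le> 60 / h / h"
proof -
  show "0 \<le> bump h z" using assms by (simp add: bump_def smoothstep'_nonneg)
  then show "\<bar>bump h z\<bar> \<le> 2 / h" using assms smoothstep'_le[of "z/h"] by (simp only: abs_of_nonneg) (simp add: bump_def divide_right_mono)
  show "\<bar>bump' h z\<bar> \<le> 60 / h / h"
    using assms smoothstep''_le[of "z/h"] by (simp add: bump'_def abs_divide divide_right_mono)
qed

lemma bump_eq_0: "0 < h \<Longrightarrow> z \<le> 0 \<or> h \<le> z \<Longrightarrow> bump h z = 0"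
  by (auto simp: bump_def divide_nonpos_pos)

lemma bump_integral: assumes "0 < h" shows "has_bochner_integral lborel (bump h) 1"
proof -
  have "has_bochner_integral lborel (\<lambda>x. smoothstep' (0 + (1/h) * x)) (1 /\<^sub>R \<bar>1/h\<bar>)"
    using assms smoothstep'_has_integral by (intro lborel_has_bochner_integral_real_affine_iff[THEN iffD1]) auto
  then have "has_bochner_integral lborel (\<lambda>x. (1/h) * smoothstep' (0 + (1/h) * x)) ((1/h) * (1 /\<^sub>R \<bar>1/h\<bar>))"
    by (intro has_bochner_integral_mult_right)
  then show ?thesis using assms by (simp add: bump_def[abs_def] field_simps)
qed

lemma bump_minus_integral: assumes "0 < h" shows "has_bochner_integral lborel (\<lambda>z. bump h (- z)) 1"
  using lborel_has_bochner_integral_real_affine_iff[of "-1" "bump h" 1 0] bump_integral[OF assms] by simp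

lemma mollify_bump_L1:
  assumes f: "integrable lborel f" and e: "0 < e"
  shows "\<exists>d>0. \<forall>h. 0 < h \<and> h < d \<longrightarrow> integrable lborel (\<lambda>z. mollify f (bump h) (bump h) z - f z) \<and>
     (LINT z|lborel. \<bar>mollify f (bump h) (bump h) z - f z\<bar>) \<le> e"
proof -
  obtain d where d: "d > 0" "\<And>v. norm v < d \<Longrightarrow> (LINT z|lborel. \<bar>f (z + v) - f z\<bar>) < e"
    using shift_continuous_modulus[OF f e] by auto
  show ?thesis
  proof (intro exI[of _ "d/2"] conjI allI impI)
    fix h assume h: "0 < h \<and> h < d/2"
    define K where "K v = bump h (- fst v) * bump h (snd v)" for v :: "real \<times> real"
    have [measurable]: "K \<in> borel_measurable borel" unfolding K_def[abs_def] by measurable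
    have K0: "0 \<le> K v" for v using h by (auto simp: K_def bump_bounds)
    have KB: "K v \<le> (2/h) * (2/h)" for v
      using h bump_bounds[of h "- fst v"] bump_bounds[of h "snd v"] unfolding K_def by (intro mult_mono) auto
    have "(\<integral>\<^sup>+v. ennreal (K v) \<partial>lborel) = (\<integral>\<^sup>+v. ennreal (K v) \<partial>(lborel \<Otimes>\<^sub>M lborel))" by (simp add: lborel_prod)
    also have "\<dots> = (\<integral>\<^sup>+a. \<integral>\<^sup>+b. ennreal (K (a,b)) \<partial>lborel \<partial>lborel)"
      by (rule lborel.nn_integral_fst[symmetric]) (simp add: lborel_prod)
    also have "\<dots> = (\<integral>\<^sup>+a. ennreal (bump h (- a)) * (\<integral>\<^sup>+b. ennreal (bump h b) \<partial>lborel) \<partial>lborel)"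
      using h by (simp add: K_def ennreal_mult bump_bounds nn_integral_cmult)
    also have "(\<integral>\<^sup>+b. ennreal (bump h b) \<partial>lborel) = 1"
      using bump_integral[of h] h by (subst nn_integral_eq_integral) (auto simp: has_bochner_integral_iff bump_bounds)
    also have "(\<integral>\<^sup>+a. ennreal (bump h (- a)) * 1 \<partial>lborel) = 1"
      using bump_minus_integral[of h] h by (simp, subst nn_integral_eq_integral) (auto simp: has_bochner_integral_iff bump_bounds)
    finally have nn: "(\<integral>\<^sup>+v. ennreal (K v) \<partial>lborel) = 1" .
    have Ki: "integrable lborel K" using nn K0 by (auto simp: integrable_iff_bounded)
    have K1: "(LINT v|lborel. K v) = 1" using nn K0 Ki by (subst (asm) nn_integral_eq_integral) auto
    have supp: "K v = 0" if "d \<le> norm v" for v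
    proof (rule ccontr)
      assume "K v \<noteq> 0"
      then have "\<bar>fst v\<bar> < h" "\<bar>snd v\<bar> < h" using h bump_eq_0[of h "- fst v"] bump_eq_0[of h "snd v"] by (auto simp: K_def not_le abs_less_iff linorder_not_le) (smt (verit))+
      moreover have "norm v \<le> \<bar>fst v\<bar> + \<bar>snd v\<bar>" using norm_Pair_le[of "fst v" "snd v"] by simp
      ultimately show False using that h by linarith
    qed
    have eq: "mollify f (bump h) (bump h) z = (LINT z'|lborel. f z' * K (z' - z))" for z
      by (simp add: mollify_def K_def)
    note m = mollification_L1_error[OF f Ki K0 KB K1 supp less_imp_le[OF d(2)], folded eq]
    show "integrable lborel (\<lambda>z. mollify f (bump h) (bump h) z - f z)" by (rule m(1)) auto
    show "(LINT z|lborel. \<bar>mollify f (bump h) (bump h) z - f z\<bar>) \<le> e" by (rule m(2)) auto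
  qed (use d in auto)
qed


section \<open>Concave fluxes and three entropy pairs\<close>

text \<open>Concavity is expressed by the tangent inequality, the form in which it is used.\<close>

locale concave_flux =
  fixes \<phi> \<phi>' :: "real \<Rightarrow> real"
  assumes flux_deriv: "\<And>s. 0 \<le> s \<Longrightarrow> (\<phi> has_real_derivative \<phi>' s) (at s)"
    and flux_0: "\<phi> 0 = 0"
    and flux_deriv_nonneg: "\<And>s. 0 \<le> s \<Longrightarrow> 0 \<le> \<phi>' s"
    and flux_tangent: "\<And>a b. 0 \<le> a \<Longrightarrow> 0 \<le> b \<Longrightarrow> \<phi> b \<le> \<phi> a + \<phi>' a * (b - a)"
begin

lemma flux_mono: assumes "0 \<le> a" "a \<le> b" shows "\<phi> a \<le> \<phi> b"
proof -
  have "\<phi>' b * (a - b) \<le> 0" using assms flux_deriv_nonneg[of b] by (intro mult_nonneg_nonpos) auto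
  then show ?thesis using flux_tangent[of b a] assms by linarith
qed

lemma flux_nonneg: "0 \<le> s \<Longrightarrow> 0 \<le> \<phi> s" using flux_mono[of 0 s] flux_0 by simp
lemma flux_le_linear: "0 \<le> s \<Longrightarrow> \<phi> s \<le> \<phi>' 0 * s" using flux_tangent[of 0 s] flux_0 by simp

text \<open>An entropy flux is applied to functions that are nonnegative only almost everywhere; the constant extension to
the negative axis makes it measurable on the whole line.\<close>

definition pflux :: "real \<Rightarrow> real" where "pflux s = \<phi> (max 0 s)"

lemma pflux_eq[simp]: "0 \<le> s \<Longrightarrow> pflux s = \<phi> s" by (simp add: pflux_def)

lemma pflux_continuous: "continuous_on UNIV pflux"
proof -
  have "continuous_on {0..} \<phi>"
    by (intro continuous_at_imp_continuous_on ballI DERIV_isCont[OF flux_deriv]) auto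
  then show ?thesis unfolding pflux_def[abs_def]
    by (rule continuous_on_compose2) (auto intro!: continuous_intros)
qed

lemma pflux_measurable[measurable]: "pflux \<in> borel_measurable borel"
  by (intro borel_measurable_continuous_onI pflux_continuous)

lemma flux_has_integral:
  assumes "0 \<le> u" shows "(deriv \<phi> has_integral (\<phi> u - \<phi> 0)) {0..u}"
proof (rule fundamental_theorem_of_calculus[OF assms])
  fix s assume "s \<in> {0..u}"
  then have "(\<phi> has_real_derivative deriv \<phi> s) (at s)"
    using flux_deriv[of s] DERIV_imp_deriv by fastforce
  then show "(\<phi> has_vector_derivative deriv \<phi> s) (at s within {0..u})"
    by (simp add: has_real_derivative_iff_has_vector_derivative has_vector_derivative_at_within)
qed

lemma entropy_pair_id: "entropy_pair \<phi> (\<lambda>s. s) pflux"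
  unfolding entropy_pair_def using flux_has_integral
  by (auto intro!: continuous_intros convex_onI simp: deriv_ident[unfolded id_def] flux_0 pflux_def)

lemma entropy_pair_minus_id: "entropy_pair \<phi> (\<lambda>s. - s) (\<lambda>s. - pflux s)"
proof -
  have d: "deriv (\<lambda>s::real. - s) = (\<lambda>s. -1)" by (rule ext, rule DERIV_imp_deriv) (auto intro!: derivative_eq_intros)
  have "((\<lambda>s. - 1 * deriv \<phi> s) has_integral (- pflux u - - pflux 0)) {0..u}" if "0 \<le> u" for u
    using has_integral_neg[OF flux_has_integral[OF that]] that by (simp add: flux_0)
  then show ?thesis unfolding entropy_pair_def d
    by (auto intro!: continuous_intros convex_onI simp: algebra_simps)
qed

text \<open>The derivative of the entropy is the indicator of \<open>s > k\<close> off the point \<open>k\<close>, and one exceptional point does not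
affect the integral.\<close>

lemma entropy_pair_kink:
  assumes k: "0 \<le> k"
  shows "entropy_pair \<phi> (\<lambda>s. max 0 (s - k)) (\<lambda>s. max 0 (pflux s - \<phi> k))"
  unfolding entropy_pair_def
proof (intro conjI allI impI)
  show "convex_on {0..} (\<lambda>s. max 0 (s - k))"
  proof (rule convex_onI)
    fix t x y :: real assume t: "0 < t" "t < 1"
    have "t * (y - k) \<le> t * max 0 (y - k)" "(1 - t) * (x - k) \<le> (1 - t) * max 0 (x - k)"
      using t by (intro mult_left_mono; simp)+
    then have "((1 - t) *\<^sub>R x + t *\<^sub>R y) - k \<le> (1 - t) * max 0 (x - k) + t * max 0 (y - k)"
      by (simp add: algebra_simps)
    moreover have "0 \<le> (1 - t) * max 0 (x - k) + t * max 0 (y - k)" using t by simp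
    ultimately show "max 0 ((1 - t) *\<^sub>R x + t *\<^sub>R y - k) \<le> (1 - t) * max 0 (x - k) + t * max 0 (y - k)" by simp
  qed simp
  show "continuous_on {0..} (\<lambda>s. max 0 (s - k))" by (intro continuous_intros)
  fix u :: real assume u: "0 \<le> u"
  show "((\<lambda>s. deriv (\<lambda>s. max 0 (s - k)) s * deriv \<phi> s) has_integral
            max 0 (pflux u - \<phi> k) - max 0 (pflux 0 - \<phi> k)) {0..u}"
  proof (rule fundamental_theorem_of_calculus_interior_strong[of "{k}"])
    show "continuous_on {0..u} (\<lambda>s. max 0 (pflux s - \<phi> k))"
      by (intro continuous_intros continuous_on_subset[OF pflux_continuous]) auto
    fix s assume s: "s \<in> {0<..<u} - {k}"
    have d: "(\<phi> has_real_derivative deriv \<phi> s) (at s)"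
      using flux_deriv[of s] DERIV_imp_deriv s by fastforce
    show "((\<lambda>s. max 0 (pflux s - \<phi> k)) has_vector_derivative deriv (\<lambda>s. max 0 (s - k)) s * deriv \<phi> s) (at s)"
    proof (cases "s < k")
      case True
      have ev: "\<forall>\<^sub>F y in nhds s. y \<in> {0<..<k}" using s True by (intro eventually_nhds_in_open) auto
      have "((\<lambda>s. max 0 (s - k)) has_real_derivative 0) (at s)"
        by (rule DERIV_cong_ev[THEN iffD1, OF refl _ refl DERIV_const[of 0]])
          (use ev in eventually_elim, auto)
      moreover have "((\<lambda>s. max 0 (pflux s - \<phi> k)) has_real_derivative 0) (at s)"
      proof (rule DERIV_cong_ev[THEN iffD1, OF refl _ refl DERIV_const[of 0]])
        show "\<forall>\<^sub>F y in nhds s. 0 = max 0 (pflux y - \<phi> k)"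
          using ev by eventually_elim (use flux_mono[of _ k] in auto)
      qed
      ultimately show ?thesis by (simp add: DERIV_imp_deriv has_real_derivative_iff_has_vector_derivative)
    next
      case False
      then have ev: "\<forall>\<^sub>F y in nhds s. y \<in> {k<..}" using s by (intro eventually_nhds_in_open) auto
      have "((\<lambda>s. max 0 (s - k)) has_real_derivative 1) (at s)"
      proof (rule DERIV_cong_ev[THEN iffD1, of s s "\<lambda>s. s - k" _ 1 1])
        show "\<forall>\<^sub>F y in nhds s. y - k = max 0 (y - k)"
          using ev by eventually_elim auto
      qed (auto intro!: derivative_eq_intros)
      moreover have "((\<lambda>s. max 0 (pflux s - \<phi> k)) has_real_derivative deriv \<phi> s) (at s)"
      proof (rule DERIV_cong_ev[THEN iffD1, of s s "\<lambda>s. \<phi> s - \<phi> k" _ "deriv \<phi> s"])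
        show "\<forall>\<^sub>F y in nhds s. \<phi> y - \<phi> k = max 0 (pflux y - \<phi> k)"
          using ev by eventually_elim (use flux_mono[of k] k in auto)
      qed (auto intro!: derivative_eq_intros d)
      ultimately show ?thesis by (simp add: DERIV_imp_deriv has_real_derivative_iff_has_vector_derivative)
    qed
  qed (use u in auto)
qed

end


section \<open>Cutting off test functions in space\<close>

lemma C0_Cc_bounded:
  assumes "C0_Cc T g"
  shows "\<exists>B. \<forall>x. \<forall>t\<in>{0..T}. \<bar>g (x, t)\<bar> \<le> B"
proof -
  obtain R where c: "continuous_on (UNIV \<times> {0..T}) g" and R: "\<And>x t. t \<in> {0..T} \<Longrightarrow> R < \<bar>x\<bar> \<Longrightarrow> g (x, t) = 0"
    using assms unfolding C0_Cc_def by metis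
  have "compact (g ` ({-R..R} \<times> {0..T}))"
    by (intro compact_continuous_image continuous_on_subset[OF c] compact_Times compact_Icc) auto
  then obtain B where B: "\<And>y. y \<in> g ` ({-R..R} \<times> {0..T}) \<Longrightarrow> \<bar>y\<bar> \<le> B"
    using compact_imp_bounded bounded_iff by (metis real_norm_def)
  show ?thesis
  proof (intro exI[of _ "max 0 B"] allI ballI)
    fix x t assume t: "t \<in> {0..T}"
    show "\<bar>g (x, t)\<bar> \<le> max 0 B"
      using R[OF t, of x] B[of "g (x,t)"] t by (cases "R < \<bar>x\<bar>") (force simp: abs_le_iff)+
  qed
qed

definition cutoff :: "nat \<Rightarrow> real \<Rightarrow> real" where
  "cutoff n x = smoothstep (x + real n + 1) * smoothstep (real n + 1 - x)"
definition cutoff' :: "nat \<Rightarrow> real \<Rightarrow> real" where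
  "cutoff' n x = smoothstep' (x + real n + 1) * smoothstep (real n + 1 - x) - smoothstep (x + real n + 1) * smoothstep' (real n + 1 - x)"

lemma cutoff_deriv: "(cutoff n has_real_derivative cutoff' n x) (at x)"
proof -
  have "((\<lambda>x. smoothstep (x + real n + 1)) has_real_derivative smoothstep' (x + real n + 1) * 1) (at x)"
    by (rule DERIV_chain2[OF smoothstep_deriv]) (auto intro!: derivative_eq_intros)
  moreover have "((\<lambda>x. smoothstep (real n + 1 - x)) has_real_derivative smoothstep' (real n + 1 - x) * -1) (at x)"
    by (rule DERIV_chain2[OF smoothstep_deriv]) (auto intro!: derivative_eq_intros)
  ultimately show ?thesis unfolding cutoff_def[abs_def] cutoff'_def
    by (auto intro!: derivative_eq_intros)
qed

lemma cutoff_continuous: "continuous_on UNIV (cutoff n)" "continuous_on UNIV (cutoff' n)"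
  unfolding cutoff_def[abs_def] cutoff'_def[abs_def] by (intro continuous_intros)+

lemma cutoff_bounds: "0 \<le> cutoff n x" "cutoff n x \<le> 1" "\<bar>cutoff' n x\<bar> \<le> 4"
proof -
  show "0 \<le> cutoff n x" "cutoff n x \<le> 1"
    unfolding cutoff_def using smoothstep_bounds by (auto intro: mult_le_one)
  have "\<bar>smoothstep' a * smoothstep b\<bar> \<le> 2 * 1" for a b
    unfolding abs_mult using smoothstep_bounds[of b] smoothstep'_nonneg[of a] smoothstep'_le[of a] by (intro mult_mono) auto
  from this[of "x + real n + 1" "real n + 1 - x"] this[of "real n + 1 - x" "x + real n + 1"]
  show "\<bar>cutoff' n x\<bar> \<le> 4" unfolding cutoff'_def by (simp add: mult.commute)
qed

lemma cutoff_eq_0: "real n + 1 < \<bar>x\<bar> \<Longrightarrow> cutoff n x = 0"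
  by (cases "x \<ge> 0") (auto simp: cutoff_def)

lemma cutoff_lim: "(\<lambda>n. cutoff n x) \<longlonglongrightarrow> 1" "(\<lambda>n. cutoff' n x) \<longlonglongrightarrow> 0"
proof -
  obtain N where N: "\<bar>x\<bar> \<le> real N" using real_arch_simple by blast
  have ev: "\<forall>\<^sub>F n in sequentially. \<bar>x\<bar> \<le> real n"
    unfolding eventually_sequentially using N by (intro exI[of _ N]) (auto intro: order_trans)
  show "(\<lambda>n. cutoff n x) \<longlonglongrightarrow> 1"
    by (rule tendsto_eventually) (use ev in eventually_elim, auto simp: cutoff_def)
  show "(\<lambda>n. cutoff' n x) \<longlonglongrightarrow> 0"
    by (rule tendsto_eventually) (use ev in eventually_elim, auto simp: cutoff'_def)
qed


section \<open>The potential of an entropy solution\<close>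

lemma scaled_continuous: "continuous_on UNIV (\<lambda>z. smoothstep (z / h))" "continuous_on UNIV (bump h)" "continuous_on UNIV (bump' h)"
  unfolding divide_inverse by (intro continuous_intros)+

lemma smoothstep_abs: "\<bar>smoothstep z\<bar> \<le> 1" using smoothstep_bounds[of z] by simp

text \<open>A Kruzkov solution after modification on a null set: Borel measurable, bounded everywhere and zero off the strip.
Entropy pairs that vanish at zero make the integrands vanish off the strip too, so that all integrals run over
the plane.\<close>

locale borel_entropy_solution = concave_flux +
  fixes T m M :: real and w0 :: "real \<Rightarrow> real" and f :: "real \<times> real \<Rightarrow> real"
  assumes T_pos: "0 < T"
    and f_int: "integrable lborel f" and f_nonneg: "\<And>z. 0 \<le> f z" and f_le: "\<And>z. f z \<le> M"
    and f_strip: "\<And>z. z \<notin> strip T \<Longrightarrow> f z = 0"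
    and w0_int: "integrable lebesgue w0" and w0_nonneg: "AE x in lebesgue. 0 \<le> w0 x" and w0_mass: "(LINT x|lebesgue. w0 x) \<le> m"
    and entropy: "\<And>\<zeta> \<zeta>t \<zeta>x E F. nonneg_test_function T \<zeta> \<zeta>t \<zeta>x \<Longrightarrow> continuous_on UNIV \<zeta>t \<Longrightarrow> continuous_on UNIV \<zeta>x \<Longrightarrow>
        entropy_pair \<phi> E F \<Longrightarrow> E \<in> borel_measurable borel \<Longrightarrow> F \<in> borel_measurable borel \<Longrightarrow> E 0 = 0 \<Longrightarrow> F 0 = 0 \<Longrightarrow>
        - (LINT x|lebesgue. E (w0 x) * \<zeta> (x, 0)) \<le> (LINT z|lborel. E (f z) * \<zeta>t z + F (f z) * \<zeta>x z)"
begin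

lemma f_borel[measurable]: "f \<in> borel_measurable borel" using f_int by auto

lemma pflux_f_int: "integrable lborel (\<lambda>z. pflux (f z))"
proof (rule Bochner_Integration.integrable_bound[where f="\<lambda>z. \<phi>' 0 * f z"])
  show "AE z in lborel. norm (pflux (f z)) \<le> norm (\<phi>' 0 * f z)"
    using f_nonneg flux_nonneg flux_le_linear by (intro AE_I2) (auto simp: abs_mult flux_deriv_nonneg)
qed (use f_int in auto)

text \<open>Products of functions of one variable are admissible without compact support, since the solution is integrable
and the error from the cut-off tends to zero by dominated convergence. This admits the Heaviside functions from
which the potential is built.\<close>

lemma entropy_noncompact:
  assumes d: "\<And>z. (\<alpha> has_real_derivative \<alpha>' z) (at z)" "\<And>z. (\<beta> has_real_derivative \<beta>' z) (at z)"
    and c: "continuous_on UNIV \<alpha>'" "continuous_on UNIV \<beta>'"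
    and b: "\<And>z. \<alpha> z \<le> A" "\<And>z. \<bar>\<alpha>' z\<bar> \<le> A'" "\<And>z. \<beta> z \<le> B" "\<And>z. \<bar>\<beta>' z\<bar> \<le> B'"
    and pos: "\<And>z. 0 \<le> \<alpha> z" "\<And>z. 0 \<le> \<beta> z" and end0: "\<beta> T = 0"
    and EF: "entropy_pair \<phi> E F" "E \<in> borel_measurable borel" "F \<in> borel_measurable borel" "E 0 = 0" "F 0 = 0"
    and int: "integrable lborel (\<lambda>z. E (f z))" "integrable lborel (\<lambda>z. F (f z))" "integrable lebesgue (\<lambda>x. E (w0 x))"
  shows "- (\<beta> 0 * (LINT x|lebesgue. E (w0 x) * \<alpha> x))
    \<le> (LINT z|lborel. E (f z) * (\<alpha> (fst z) * \<beta>' (snd z)) + F (f z) * (\<alpha>' (fst z) * \<beta> (snd z)))"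
proof -
  note [measurable] = EF(2,3)
  have c': "continuous_on UNIV \<alpha>" "continuous_on UNIV \<beta>"
    using d by (auto intro!: continuous_at_imp_continuous_on DERIV_isCont)
  have [measurable]: "\<alpha> \<in> borel_measurable borel" "\<alpha>' \<in> borel_measurable borel" "\<beta> \<in> borel_measurable borel" "\<beta>' \<in> borel_measurable borel"
    using c c' by (auto intro: borel_measurable_continuous_onI)
  have [measurable]: "cutoff n \<in> borel_measurable borel" "cutoff' n \<in> borel_measurable borel" for n
    by (auto intro: borel_measurable_continuous_onI cutoff_continuous)
  have AB: "0 \<le> A" "0 \<le> A'" "0 \<le> B" "0 \<le> B'"
    using b(1)[of 0] b(2)[of 0] b(3)[of 0] b(4)[of 0] pos(1)[of 0] pos(2)[of 0] by linarith+
  define \<alpha>n where "\<alpha>n n x = \<alpha> x * cutoff n x" for n x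
  define \<alpha>n' where "\<alpha>n' n x = \<alpha>' x * cutoff n x + \<alpha> x * cutoff' n x" for n x
  have dn: "(\<alpha>n n has_real_derivative \<alpha>n' n x) (at x)" for n x
    unfolding \<alpha>n_def[abs_def] \<alpha>n'_def by (auto intro!: derivative_eq_intros d cutoff_deriv)
  have cn: "continuous_on UNIV (\<alpha>n' n)" for n
    unfolding \<alpha>n'_def[abs_def] by (intro continuous_intros c c' cutoff_continuous)
  have bn: "\<bar>\<alpha>n n x\<bar> \<le> A" for n x
    using mult_mono[OF b(1)[of x] cutoff_bounds(2)[of n x]] pos AB cutoff_bounds(1)[of n x] by (simp add: \<alpha>n_def abs_mult)
  have bn': "\<bar>\<alpha>n' n x\<bar> \<le> A' + A * 4" for n x
  proof -
    have "\<bar>\<alpha>' x\<bar> * \<bar>cutoff n x\<bar> \<le> A' * 1" using b(2)[of x] cutoff_bounds[of n x] AB by (intro mult_mono) auto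
    moreover have "\<bar>\<alpha> x\<bar> * \<bar>cutoff' n x\<bar> \<le> A * 4" using b(1)[of x] pos(1)[of x] cutoff_bounds[of n x] AB by (intro mult_mono) auto
    ultimately show ?thesis unfolding \<alpha>n'_def by (simp add: abs_mult[symmetric])
  qed
  have lim: "(\<lambda>n. \<alpha>n n x) \<longlonglongrightarrow> \<alpha> x" "(\<lambda>n. \<alpha>n' n x) \<longlonglongrightarrow> \<alpha>' x" for x
    unfolding \<alpha>n_def \<alpha>n'_def
    by (auto intro!: tendsto_eq_intros cutoff_lim)
  have mn[measurable]: "\<alpha>n n \<in> borel_measurable borel" "\<alpha>n' n \<in> borel_measurable borel" for n
    unfolding \<alpha>n_def[abs_def] \<alpha>n'_def[abs_def] by measurable
  \<comment> \<open>\<open>?G\<close> is the integrand for the truncated test function, \<open>?H\<close> its limit.\<close>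
  let ?G = "\<lambda>n z. E (f z) * (\<alpha>n n (fst z) * \<beta>' (snd z)) + F (f z) * (\<alpha>n' n (fst z) * \<beta> (snd z))"
  let ?H = "\<lambda>z. E (f z) * (\<alpha> (fst z) * \<beta>' (snd z)) + F (f z) * (\<alpha>' (fst z) * \<beta> (snd z))"
  have ineq: "- (\<beta> 0 * (LINT x|lebesgue. E (w0 x) * \<alpha>n n x))
     \<le> (LINT z|lborel. ?G n z)" for n
  proof -
    note C = mixed_C1_prod[OF dn d(2) cn c(2), of n]
    have C1: "C1_C1c T (\<lambda>z. \<alpha>n n (fst z) * \<beta> (snd z)) (\<lambda>z. \<alpha>n n (fst z) * \<beta>' (snd z)) (\<lambda>z. \<alpha>n' n (fst z) * \<beta> (snd z))"
      by (rule mixed_C1_imp_C1_C1c[OF C T_pos, where R="real n + 1"]) (simp add: \<alpha>n_def cutoff_eq_0)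
    have "- (LINT x|lebesgue. E (w0 x) * (\<alpha>n n x * \<beta> 0))
     \<le> (LINT z|lborel. ?G n z)"
      using entropy[of "\<lambda>z. \<alpha>n n (fst z) * \<beta> (snd z)" "\<lambda>z. \<alpha>n n (fst z) * \<beta>' (snd z)" "\<lambda>z. \<alpha>n' n (fst z) * \<beta> (snd z)" E F] C1 C EF
      by (simp add: nonneg_test_function_def test_function_def mixed_C1_def end0 pos \<alpha>n_def cutoff_bounds)
    also have "(LINT x|lebesgue. E (w0 x) * (\<alpha>n n x * \<beta> 0)) = \<beta> 0 * (LINT x|lebesgue. E (w0 x) * \<alpha>n n x)"
      by (subst integral_mult_right_zero[symmetric]) (simp add: mult_ac)
    finally show ?thesis .
  qed
  have lm: "g \<in> borel_measurable borel \<Longrightarrow> g \<in> borel_measurable lebesgue" for g :: "real \<Rightarrow> real"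
    by (simp add: measurable_completion)
  have "(\<lambda>n. LINT x|lebesgue. E (w0 x) * \<alpha>n n x) \<longlonglongrightarrow> (LINT x|lebesgue. E (w0 x) * \<alpha> x)"
  proof (rule integral_dominated_convergence[where w="\<lambda>x. \<bar>E (w0 x)\<bar> * A"])
    show "AE x in lebesgue. (\<lambda>n. E (w0 x) * \<alpha>n n x) \<longlonglongrightarrow> E (w0 x) * \<alpha> x"
      by (intro AE_I2 tendsto_intros lim)
    show "AE x in lebesgue. norm (E (w0 x) * \<alpha>n n x) \<le> \<bar>E (w0 x)\<bar> * A" for n
      using bn by (intro AE_I2) (simp add: abs_mult mult_left_mono)
    show "(\<lambda>x. E (w0 x) * \<alpha> x) \<in> borel_measurable lebesgue"
      by (rule borel_measurable_times[OF borel_measurable_integrable[OF int(3)] lm]) measurable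
    show "(\<lambda>x. E (w0 x) * \<alpha>n n x) \<in> borel_measurable lebesgue" for n
      by (rule borel_measurable_times[OF borel_measurable_integrable[OF int(3)] lm]) measurable
  qed (use int in auto)
  then have l1: "(\<lambda>n. - (\<beta> 0 * (LINT x|lebesgue. E (w0 x) * \<alpha>n n x))) \<longlonglongrightarrow> - (\<beta> 0 * (LINT x|lebesgue. E (w0 x) * \<alpha> x))"
    by (intro tendsto_intros)
  have l2: "(\<lambda>n. LINT z|lborel. ?G n z)
    \<longlonglongrightarrow> (LINT z|lborel. ?H z)"
  proof (rule integral_dominated_convergence[where w="\<lambda>z. \<bar>E (f z)\<bar> * (A * B') + \<bar>F (f z)\<bar> * ((A' + A * 4) * B)"])
    show "AE z in lborel. (\<lambda>n. ?G n z)
       \<longlonglongrightarrow> ?H z"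
      by (intro AE_I2 tendsto_intros lim)
    show "AE z in lborel. norm (?G n z)
       \<le> \<bar>E (f z)\<bar> * (A * B') + \<bar>F (f z)\<bar> * ((A' + A * 4) * B)" for n
    proof (intro AE_I2)
      fix z :: "real \<times> real"
      have "\<bar>\<alpha>n n (fst z) * \<beta>' (snd z)\<bar> \<le> A * B'" "\<bar>\<alpha>n' n (fst z) * \<beta> (snd z)\<bar> \<le> (A' + A * 4) * B"
        unfolding abs_mult using bn b bn' AB pos(2)[of "snd z"] by (intro mult_mono; auto)+
      then have "\<bar>E (f z) * (\<alpha>n n (fst z) * \<beta>' (snd z))\<bar> \<le> \<bar>E (f z)\<bar> * (A * B')"
        "\<bar>F (f z) * (\<alpha>n' n (fst z) * \<beta> (snd z))\<bar> \<le> \<bar>F (f z)\<bar> * ((A' + A * 4) * B)"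
        unfolding abs_mult[of "E (f z)"] abs_mult[of "F (f z)"] by (intro mult_left_mono; simp)+
      then show "norm (?G n z)
       \<le> \<bar>E (f z)\<bar> * (A * B') + \<bar>F (f z)\<bar> * ((A' + A * 4) * B)"
        unfolding real_norm_def by linarith
    qed
    have "(\<lambda>z. ?G n z) \<in> borel_measurable borel" for n
      by measurable
    then show "(\<lambda>z. ?G n z) \<in> borel_measurable lborel" for n
      by simp
    have "(\<lambda>z. ?H z) \<in> borel_measurable borel"
      by measurable
    then show "(\<lambda>z. ?H z) \<in> borel_measurable lborel"
      by simp
  qed (use int in auto)
  show ?thesis by (rule LIMSEQ_le[OF l1 l2]) (use ineq in auto)
qed

abbreviation "potential h \<equiv> mollify f (\<lambda>z. smoothstep (z / h)) (bump h)"

lemma deriv_of_reflection: "(g has_real_derivative g' (x - z)) (at (x - z)) \<Longrightarrow> ((\<lambda>y. g (x - y)) has_real_derivative - g' (x - z)) (at z)"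
  by (rule DERIV_cong[OF DERIV_chain2[of g "g' (x - z)"]]) (auto intro!: derivative_eq_intros)

lemma potential_nonneg: "0 < h \<Longrightarrow> 0 \<le> potential h z"
  unfolding mollify_def by (intro integral_nonneg_AE AE_I2 mult_nonneg_nonneg f_nonneg smoothstep_bounds bump_bounds)

text \<open>The mass to the left of a point does not increase in time, since the flux is nonnegative. The test function is the
approximate indicator of the half-line left of \<open>x\<close> times a function of time that drops from one to zero just
after \<open>t\<close>.\<close>

lemma potential_le:
  assumes h: "0 < h" and t: "0 \<le> t" "t \<le> T - h"
  shows "potential h (x, t) \<le> m"
proof -
  let ?\<alpha> = "\<lambda>y. smoothstep ((x - y) / h)" and ?\<alpha>' = "\<lambda>y. - bump h (x - y)"
  let ?\<beta> = "\<lambda>s. 1 - smoothstep ((s - t) / h)" and ?\<beta>' = "\<lambda>s. - bump h (s - t)"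
  have "- (?\<beta> 0 * (LINT x|lebesgue. w0 x * ?\<alpha> x))
    \<le> (LINT z|lborel. f z * (?\<alpha> (fst z) * ?\<beta>' (snd z)) + pflux (f z) * (?\<alpha>' (fst z) * ?\<beta> (snd z)))"
  proof (rule entropy_noncompact[where A=1 and A'="2/h" and B=1 and B'="2/h" and E="\<lambda>s. s" and F=pflux and \<alpha>="?\<alpha>" and \<alpha>'="?\<alpha>'" and \<beta>="?\<beta>" and \<beta>'="?\<beta>'", OF _ _ _ _ _ _ _ _ _ _ _ entropy_pair_id])
    show "((\<lambda>y. smoothstep ((x - y) / h)) has_real_derivative - bump h (x - z)) (at z)" for z
      by (rule deriv_of_reflection[of "\<lambda>z. smoothstep (z / h)" "bump h"]) (use h in \<open>auto intro: smoothstep_scaled_deriv\<close>)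
    show "(?\<beta> has_real_derivative - bump h (z - t)) (at z)" for z
      by (rule DERIV_cong[OF DERIV_diff[OF DERIV_const DERIV_chain2[of "\<lambda>z. smoothstep (z / h)" "bump h (z - t)"]]])
        (use h in \<open>auto intro!: derivative_eq_intros smoothstep_scaled_deriv\<close>)
    show "\<bar>- bump h (x - z)\<bar> \<le> 2 / h" "\<bar>- bump h (z - t)\<bar> \<le> 2 / h" for z
      using bump_bounds[OF h] by auto
    show "?\<beta> T = 0" using t h by (simp add: le_divide_eq)
    show "continuous_on UNIV ?\<alpha>'" "continuous_on UNIV ?\<beta>'" by (intro continuous_intros)+
  qed (use f_int pflux_f_int w0_int smoothstep_bounds in \<open>simp_all add: flux_0\<close>)
  also have "\<dots> \<le> (LINT z|lborel. - (f z * (?\<alpha> (fst z) * bump h (snd z - t))))"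
  proof (rule integral_mono)
    have i: "integrable lborel (\<lambda>z. f z * (?\<alpha> (fst z) * bump h (snd z - t)))"
      using mollify_integrable[OF f_int, of "\<lambda>z. smoothstep (z / h)" "bump h" 1 "2/h" "(x,t)", OF scaled_continuous(1,2) smoothstep_abs bump_bounds(2)[OF h]] by simp
    have "integrable lborel (\<lambda>z. pflux (f z) * (?\<alpha>' (fst z) * ?\<beta> (snd z)))"
    proof -
      have "integrable lborel (\<lambda>w. pflux (f w) * (?\<alpha>' (fst w) * ?\<beta> (snd w)))"
        using mollify_integrable[OF pflux_f_int, of "\<lambda>z. - bump h z" "\<lambda>z. 1 - smoothstep (z / h)" "2/h" 1 "(x,t)"]
          continuous_on_minus[OF scaled_continuous(2)] continuous_on_diff[OF continuous_on_const scaled_continuous(1), of 1]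
          bump_bounds(2)[OF h] smoothstep_bounds by simp
      then show ?thesis .
    qed
    then show "integrable lborel (\<lambda>z. f z * (?\<alpha> (fst z) * ?\<beta>' (snd z)) + pflux (f z) * (?\<alpha>' (fst z) * ?\<beta> (snd z)))"
      using i by simp
    show "integrable lborel (\<lambda>z. - (f z * (?\<alpha> (fst z) * bump h (snd z - t))))" using i by simp
    fix z
    have "0 \<le> pflux (f z) * (bump h (x - fst z) * ?\<beta> (snd z))"
      using f_nonneg flux_nonneg h smoothstep_bounds bump_bounds by (intro mult_nonneg_nonneg) auto
    then show "f z * (?\<alpha> (fst z) * ?\<beta>' (snd z)) + pflux (f z) * (?\<alpha>' (fst z) * ?\<beta> (snd z)) \<le> - (f z * (?\<alpha> (fst z) * bump h (snd z - t)))"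
      by simp
  qed
  also have "\<dots> = - potential h (x, t)" by (simp add: mollify_def)
  finally have "potential h (x, t) \<le> ?\<beta> 0 * (LINT x|lebesgue. w0 x * ?\<alpha> x)" by simp
  also have "?\<beta> 0 = 1" using t h by (simp add: divide_nonpos_pos)
  also have "1 * (LINT x|lebesgue. w0 x * ?\<alpha> x) \<le> (LINT x|lebesgue. w0 x)"
  proof -
    have "(\<lambda>y. smoothstep ((x - y) / h)) \<in> borel_measurable borel" by measurable
    then have "integrable lebesgue (\<lambda>y. w0 y * ?\<alpha> y)"
      using smoothstep_bounds by (intro bounded_mult_integrable[OF w0_int, where C=1]) (auto simp: measurable_completion)
    then show ?thesis unfolding mult_1
      using w0_int w0_nonneg smoothstep_bounds by (intro integral_mono_AE) (auto elim!: eventually_mono intro: mult_left_le)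
  qed
  finally show ?thesis using w0_mass by simp
qed

text \<open>The kernel of the potential, read as a function of the integration variable, is a test function that vanishes at
both end times; the entropies \<open>s\<close> and \<open>-s\<close> give an equation for it, and this equation is \<open>W_t = -\<phi>(f)\<close> after
mollification.\<close>

lemma potential_dt:
  assumes h: "0 < h" and t: "0 \<le> t" "t \<le> T - h"
  shows "mollify f (\<lambda>z. smoothstep (z / h)) (bump' h) (x, t) = mollify (\<lambda>z. pflux (f z)) (bump h) (bump h) (x, t)"
proof -
  let ?\<alpha> = "\<lambda>y. smoothstep ((x - y) / h)" and ?\<alpha>' = "\<lambda>y. - bump h (x - y)"
  let ?\<beta> = "\<lambda>s. bump h (s - t)" and ?\<beta>' = "\<lambda>s. bump' h (s - t)"
  let ?I = "\<lambda>z. f z * (?\<alpha> (fst z) * ?\<beta>' (snd z)) + pflux (f z) * (?\<alpha>' (fst z) * ?\<beta> (snd z))"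
  have d: "((\<lambda>y. smoothstep ((x - y) / h)) has_real_derivative - bump h (x - z)) (at z)" for z
      by (rule deriv_of_reflection[of "\<lambda>z. smoothstep (z / h)" "bump h"]) (use h in \<open>auto intro: smoothstep_scaled_deriv\<close>)
  have d2: "(?\<beta> has_real_derivative bump' h (z - t)) (at z)" for z
      by (rule DERIV_cong[OF DERIV_chain2[of "bump h" "bump' h (z - t)"]])
        (use h in \<open>auto intro!: derivative_eq_intros bump_deriv\<close>)
  have b: "\<bar>- bump h (x - z)\<bar> \<le> 2 / h" "bump h (z - t) \<le> 2 / h" "\<bar>bump' h (z - t)\<bar> \<le> 60 / h / h" for z
    using bump_bounds[OF h] by (auto simp: abs_le_iff)
  have e: "?\<beta> T = 0" using t h by (simp add: bump_eq_0)
  have z: "?\<beta> 0 = 0" using t h by (simp add: bump_eq_0)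
  have cc: "continuous_on UNIV ?\<alpha>'" "continuous_on UNIV ?\<beta>'" by (intro continuous_intros)+
  note en = entropy_noncompact[where A=1 and A'="2/h" and B="2/h" and B'="60/h/h" and \<alpha>="?\<alpha>" and \<alpha>'="?\<alpha>'" and \<beta>="?\<beta>" and \<beta>'="?\<beta>'", OF d d2 _ _ _ b(1,2,3) _ _ e]
  have "- (?\<beta> 0 * (LINT x|lebesgue. w0 x * ?\<alpha> x)) \<le> (LINT z|lborel. ?I z)"
    by (rule en[where E="\<lambda>s. s" and F=pflux, OF _ _ _ _ _ entropy_pair_id]) (use f_int pflux_f_int w0_int cc smoothstep_bounds bump_bounds(1)[OF h] in \<open>simp_all add: flux_0\<close>)
  moreover have "- (?\<beta> 0 * (LINT x|lebesgue. - w0 x * ?\<alpha> x))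
    \<le> (LINT z|lborel. - f z * (?\<alpha> (fst z) * ?\<beta>' (snd z)) + - pflux (f z) * (?\<alpha>' (fst z) * ?\<beta> (snd z)))"
    by (rule en[where E="\<lambda>s. - s" and F="\<lambda>s. - pflux s", OF _ _ _ _ _ entropy_pair_minus_id]) (use f_int pflux_f_int w0_int cc smoothstep_bounds bump_bounds(1)[OF h] in \<open>simp_all add: flux_0\<close>)
  moreover have "(LINT z|lborel. - f z * (?\<alpha> (fst z) * ?\<beta>' (snd z)) + - pflux (f z) * (?\<alpha>' (fst z) * ?\<beta> (snd z))) = - (LINT z|lborel. ?I z)"
    unfolding integral_minus[symmetric] by (rule Bochner_Integration.integral_cong) auto
  ultimately have 0: "(LINT z|lborel. ?I z) = 0" using z by simp
  have i1: "integrable lborel (\<lambda>z. f z * (?\<alpha> (fst z) * ?\<beta>' (snd z)))"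
    using mollify_integrable[OF f_int, of "\<lambda>z. smoothstep (z / h)" "bump' h" 1 "60/h/h" "(x,t)", OF scaled_continuous(1,3) smoothstep_abs bump_bounds(3)[OF h]] by simp
  have i2: "integrable lborel (\<lambda>z. pflux (f z) * (bump h (x - fst z) * ?\<beta> (snd z)))"
    using mollify_integrable[OF pflux_f_int, of "bump h" "bump h" "2/h" "2/h" "(x,t)", OF scaled_continuous(2,2) bump_bounds(2)[OF h] bump_bounds(2)[OF h]] by simp
  have "(LINT z|lborel. ?I z) = (LINT z|lborel. f z * (?\<alpha> (fst z) * ?\<beta>' (snd z)) - pflux (f z) * (bump h (x - fst z) * ?\<beta> (snd z)))"
    by (rule Bochner_Integration.integral_cong) auto
  also have "\<dots> = mollify f (\<lambda>z. smoothstep (z / h)) (bump' h) (x, t) - mollify (\<lambda>z. pflux (f z)) (bump h) (bump h) (x, t)"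
    using i1 i2 by (simp add: mollify_def)
  finally show ?thesis using 0 by simp
qed

end


section \<open>The height of an entropy solution at positive times\<close>

context borel_entropy_solution begin

text \<open>The central estimate. The test function is the product of \<open>smoothstep\<close> applied to \<open>W - L\<close>, \<open>\<sigma>\<close> and \<open>\<xi>\<close>, where \<open>W\<close> is the
mollified potential, \<open>\<sigma> = (t1 - t)/T\<close> is positive up to time \<open>t1\<close>, and \<open>\<xi>\<close> is positive to the right of the
characteristic with speed \<open>\<phi>'(k)\<close> that arrives at \<open>(x1,t1)\<close>. The affine function \<open>L\<close> has the value \<open>-1\<close> at this point. It is at
least \<open>m\<close> at time zero where \<open>\<xi> > 0\<close>: along the characteristic, going back to time zero raises \<open>L\<close> by \<open>t1(\<phi>(k) - k\<phi>'(k)) \<ge> m+1\<close>.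
The factor \<open>smoothstep (- L z)\<close> is a lower bound, independent of the mollification, for the factor that contains \<open>W\<close>.\<close>

lemma barrier_integral_le:
  fixes x1 t1 k \<epsilon> :: real
  assumes t1: "0 < t1" "t1 < T" and k: "0 < k" "m + 1 \<le> t1 * (\<phi> k - k * \<phi>' k)" and \<epsilon>: "0 < \<epsilon>"
  defines "E \<equiv> \<lambda>s. max 0 (s - k)"
    and "L \<equiv> \<lambda>z::real\<times>real. (- 1 - k * x1 + \<phi> k * t1) + k * fst z + (- \<phi> k) * snd z"
    and "\<xi> \<equiv> \<lambda>z::real\<times>real. (\<phi>' k * t1 - x1) + 1 * fst z + (- \<phi>' k) * snd z"
    and "\<sigma> \<equiv> \<lambda>z::real\<times>real. t1 / T + 0 * fst z + (- 1 / T) * snd z"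
  shows "(LINT z|lborel. E (f z) * (smoothstep (- L z) * (smoothstep' (\<sigma> z) / T) * smoothstep (\<xi> z))) \<le> (2 * (M + \<phi>' 0 * M)) * (\<epsilon> + \<epsilon>)"
proof -
  define F where "F = (\<lambda>s. max 0 (pflux s - \<phi> k))"
  have \<phi>k: "0 \<le> \<phi> k" "0 \<le> \<phi>' k" using k by (auto intro: flux_nonneg flux_deriv_nonneg)
  have M: "0 \<le> M" using f_nonneg[of 0] f_le[of 0] by linarith
  obtain d1 where d1: "d1 > 0" "\<And>h. 0 < h \<Longrightarrow> h < d1 \<Longrightarrow> integrable lborel (\<lambda>z. mollify f (bump h) (bump h) z - f z) \<and>
     (LINT z|lborel. \<bar>mollify f (bump h) (bump h) z - f z\<bar>) \<le> \<epsilon>"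
    using mollify_bump_L1[OF f_int \<epsilon>] by blast
  obtain d2 where d2: "d2 > 0" "\<And>h. 0 < h \<Longrightarrow> h < d2 \<Longrightarrow> integrable lborel (\<lambda>z. mollify (\<lambda>z. pflux (f z)) (bump h) (bump h) z - pflux (f z)) \<and>
     (LINT z|lborel. \<bar>mollify (\<lambda>z. pflux (f z)) (bump h) (bump h) z - pflux (f z)\<bar>) \<le> \<epsilon>"
    using mollify_bump_L1[OF pflux_f_int \<epsilon>] by blast
  \<comment> \<open>Mollification looks forward in time by \<open>h\<close>, which must not reach beyond \<open>T\<close>.\<close>
  define h where "h = min (min d1 d2) (T - t1) / 2"
  have h: "0 < h" "h < d1" "h < d2" "h < T - t1" using d1 d2 t1 by (auto simp: h_def min_def)
  define A1 where "A1 = mollify f (bump h) (bump h)"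
  define A2 where "A2 = mollify (\<lambda>z. pflux (f z)) (bump h) (bump h)"
  have e1: "integrable lborel (\<lambda>z. A1 z - f z)" "(LINT z|lborel. \<bar>A1 z - f z\<bar>) \<le> \<epsilon>"
    using d1(2)[OF h(1,2)] by (auto simp: A1_def)
  have e2: "integrable lborel (\<lambda>z. A2 z - pflux (f z))" "(LINT z|lborel. \<bar>A2 z - pflux (f z)\<bar>) \<le> \<epsilon>"
    using d2(2)[OF h(1,3)] by (auto simp: A2_def)
  define W where "W = potential h"
  define Wt where "Wt = (\<lambda>z. - mollify f (\<lambda>z. smoothstep (z / h)) (bump' h) z)"
  have C: "mixed_C1 W Wt A1 (\<lambda>z. - mollify f (bump h) (bump' h) z)"
    unfolding W_def Wt_def A1_def
    by (rule mollify_mixed_C1[OF f_int _ _ scaled_continuous(2,3) smoothstep_abs bump_bounds(2)[OF h(1)] bump_bounds(2)[OF h(1)] bump_bounds(3)[OF h(1)]])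
      (use h in \<open>auto intro: smoothstep_scaled_deriv bump_deriv\<close>)
  have W0: "0 \<le> W z" for z using potential_nonneg[OF h(1)] by (simp add: W_def)
  have Wm: "W (x, t) \<le> m" if "0 \<le> t" "t \<le> t1" for x t
    using potential_le[OF h(1), of t x] that h(4) by (simp add: W_def)
  have Wt: "Wt (x, t) = - A2 (x, t)" if "0 \<le> t" "t \<le> t1" for x t
    using potential_dt[OF h(1), of t x] that h(4) by (simp add: Wt_def A2_def)
  define D where "D z = W z - L z" for z
  have CD: "mixed_C1 D (\<lambda>z. Wt z - (- \<phi> k)) (\<lambda>z. A1 z - k) (\<lambda>z. - mollify f (bump h) (bump' h) z - 0)"
    unfolding D_def[abs_def] L_def by (rule mixed_C1_diff[OF C mixed_C1_affine])
  have C\<xi>: "mixed_C1 \<xi> (\<lambda>z. - \<phi>' k) (\<lambda>z. 1) (\<lambda>z. 0)" unfolding \<xi>_def by (rule mixed_C1_affine)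
  have C\<sigma>: "mixed_C1 \<sigma> (\<lambda>z. - 1 / T) (\<lambda>z. 0) (\<lambda>z. 0)" unfolding \<sigma>_def by (rule mixed_C1_affine)
  have c2: "continuous_on UNIV smoothstep''" using smoothstep_continuous(3)[of UNIV "\<lambda>x. x"] by simp
  note CC = mixed_C1_mult[OF mixed_C1_mult[OF mixed_C1_comp[OF CD smoothstep_deriv smoothstep'_deriv c2] mixed_C1_comp[OF C\<sigma> smoothstep_deriv smoothstep'_deriv c2]]
     mixed_C1_comp[OF C\<xi> smoothstep_deriv smoothstep'_deriv c2]]
  define \<zeta> where "\<zeta> = (\<lambda>z. smoothstep (D z) * smoothstep (\<sigma> z) * smoothstep (\<xi> z))"
  define \<zeta>t where "\<zeta>t = (\<lambda>z. (smoothstep' (D z) * (Wt z - - \<phi> k) * smoothstep (\<sigma> z) + smoothstep (D z) * (smoothstep' (\<sigma> z) * (- 1 / T))) * smoothstep (\<xi> z) +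
         smoothstep (D z) * smoothstep (\<sigma> z) * (smoothstep' (\<xi> z) * - \<phi>' k))"
  define \<zeta>x where "\<zeta>x = (\<lambda>z. (smoothstep' (D z) * (A1 z - k) * smoothstep (\<sigma> z) + smoothstep (D z) * (smoothstep' (\<sigma> z) * 0)) * smoothstep (\<xi> z) +
         smoothstep (D z) * smoothstep (\<sigma> z) * (smoothstep' (\<xi> z) * 1))"
  obtain \<zeta>tx where C\<zeta>: "mixed_C1 \<zeta> \<zeta>t \<zeta>x \<zeta>tx"
    using CC unfolding \<zeta>_def \<zeta>t_def \<zeta>x_def by blast
  have \<sigma>0: "\<sigma> (x, t) \<le> 0" if "t1 \<le> t" for x t
    using that T_pos by (simp add: \<sigma>_def divide_right_mono)
  have zero1: "\<zeta> (x, t) = 0" if "t1 \<le> t" for x t using \<sigma>0[OF that] by (simp add: \<zeta>_def)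
  have Lge: "L (x, t) = - 1 + k * (x - x1) + \<phi> k * (t1 - t)" for x t by (simp add: L_def algebra_simps)
  have \<xi>eq: "\<xi> (x, t) = x - x1 + \<phi>' k * (t1 - t)" for x t by (simp add: \<xi>_def algebra_simps)
  \<comment> \<open>The choice of \<open>k\<close> makes the initial term of the entropy inequality disappear.\<close>
  have zero2: "\<zeta> (x, 0) = 0" for x
  proof (cases "\<xi> (x, 0) \<le> 0")
    case False
    then have "k * (- (\<phi>' k * t1)) \<le> k * (x - x1)" using k by (intro mult_left_mono) (auto simp: \<xi>eq)
    then have "m \<le> L (x, 0)" using k(2) by (simp add: Lge algebra_simps)
    then have "D (x, 0) \<le> 0" using Wm[of 0 x] t1 by (simp add: D_def)
    then show ?thesis by (simp add: \<zeta>_def)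
  qed (simp add: \<zeta>_def)
  define R where "R = \<bar>x1\<bar> + \<phi>' k * t1 + \<bar>m + 1\<bar> / k"
  have supp: "\<zeta> (x, t) = 0" if "0 \<le> t" "t \<le> T" "R < \<bar>x\<bar>" for x t
  proof (cases "t1 \<le> t")
    case False
    have pk: "\<phi>' k * (t1 - t) \<le> \<phi>' k * t1" "0 \<le> \<phi>' k * t1" "0 \<le> \<bar>m + 1\<bar> / k"
      using that False \<phi>k k t1 by (auto intro: mult_left_mono)
    show ?thesis
    proof (cases "x \<ge> 0")
      case True
      then have "\<bar>m + 1\<bar> / k \<le> x - x1" using that pk(2) by (simp add: R_def)
      then have "m + 1 \<le> k * (x - x1)" using k by (simp add: divide_le_eq mult.commute)
      moreover have "0 \<le> \<phi> k * (t1 - t)" using \<phi>k False by simp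
      ultimately have "m \<le> L (x, t)" by (simp add: Lge)
      then have "D (x, t) \<le> 0" using Wm[of t x] that False by (simp add: D_def)
      then show ?thesis by (simp add: \<zeta>_def)
    next
      case False
      then have "\<xi> (x, t) \<le> 0" using that pk unfolding \<xi>eq R_def by linarith
      then show ?thesis by (simp add: \<zeta>_def)
    qed
  qed (simp add: zero1)
  have C1: "C1_C1c T \<zeta> \<zeta>t \<zeta>x" by (rule mixed_C1_imp_C1_C1c[OF C\<zeta> T_pos supp])
  have test: "nonneg_test_function T \<zeta> \<zeta>t \<zeta>x"
    unfolding nonneg_test_function_def test_function_def
    using C1 zero1 t1 smoothstep_bounds by (auto simp: \<zeta>_def)
  have cont: "continuous_on UNIV \<zeta>t" "continuous_on UNIV \<zeta>x" using C\<zeta> by (auto simp: mixed_C1_def)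
  have [measurable]: "\<zeta>t \<in> borel_measurable borel" "\<zeta>x \<in> borel_measurable borel"
    using cont by (auto intro: borel_measurable_continuous_onI)
  have [measurable]: "E \<in> borel_measurable borel" "F \<in> borel_measurable borel" unfolding E_def F_def by measurable
  have ineq: "0 \<le> (LINT z|lborel. E (f z) * \<zeta>t z + F (f z) * \<zeta>x z)"
  proof -
    have "E 0 = 0" "F 0 = 0" using k \<phi>k by (auto simp: E_def F_def flux_0)
    moreover have "entropy_pair \<phi> E F" unfolding E_def F_def using k by (intro entropy_pair_kink) simp
    ultimately show ?thesis using entropy[OF test cont, of E F] by (simp add: zero2)
  qed
  have Eb: "0 \<le> E (f z)" "E (f z) \<le> f z" "E (f z) \<le> M" for z
    using f_nonneg[of z] f_le[of z] k M by (auto simp: E_def)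
  have Fb: "0 \<le> F (f z)" "F (f z) \<le> pflux (f z)" "F (f z) \<le> \<phi>' 0 * M" for z
  proof -
    have "\<phi>' 0 * f z \<le> \<phi>' 0 * M" using f_le[of z] flux_deriv_nonneg[of 0] by (intro mult_left_mono) auto
    then have "pflux (f z) \<le> \<phi>' 0 * M" using flux_le_linear[OF f_nonneg[of z]] f_nonneg[of z] by simp
    moreover have "0 \<le> pflux (f z)" using f_nonneg[of z] by (simp add: flux_nonneg)
    ultimately show "0 \<le> F (f z)" "F (f z) \<le> pflux (f z)" "F (f z) \<le> \<phi>' 0 * M"
      using \<phi>k by (auto simp: F_def)
  qed
  have EF0: "E (f z) = 0" "F (f z) = 0" if "z \<notin> strip T" for z
    using f_strip[OF that] k \<phi>k by (auto simp: E_def F_def flux_0)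
  have intEF: "integrable lborel (\<lambda>z. E (f z))" "integrable lborel (\<lambda>z. F (f z))"
  proof -
    have "(\<lambda>z. E (f z)) \<in> borel_measurable borel" "(\<lambda>z. F (f z)) \<in> borel_measurable borel" by measurable
    moreover have "norm (E (f z)) \<le> norm (f z)" "norm (F (f z)) \<le> norm (pflux (f z))" for z
      using Eb(1,2)[of z] Fb(1,2)[of z] unfolding real_norm_def by linarith+
    ultimately show "integrable lborel (\<lambda>z. E (f z))" "integrable lborel (\<lambda>z. F (f z))"
      by (intro Bochner_Integration.integrable_bound[OF f_int] Bochner_Integration.integrable_bound[OF pflux_f_int]; simp)+
  qed
  obtain Bt Bx where Bt: "\<And>x t. t \<in> {0..T} \<Longrightarrow> \<bar>\<zeta>t (x, t)\<bar> \<le> Bt" and Bx: "\<And>x t. t \<in> {0..T} \<Longrightarrow> \<bar>\<zeta>x (x, t)\<bar> \<le> Bx"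
    using C1 C0_Cc_bounded[of T \<zeta>t] C0_Cc_bounded[of T \<zeta>x] unfolding C1_C1c_def by metis
  have bnd: "integrable lborel (\<lambda>z. g z * q z)" if g: "integrable lborel g" "\<And>z. z \<notin> strip T \<Longrightarrow> g z = 0"
     and q: "q \<in> borel_measurable borel" "\<And>x t. t \<in> {0..T} \<Longrightarrow> \<bar>q (x, t)\<bar> \<le> B" for g q :: "real \<times> real \<Rightarrow> real" and B
  proof (rule Bochner_Integration.integrable_bound[where f="\<lambda>z. B * g z"])
    show "AE z in lborel. norm (g z * q z) \<le> norm (B * g z)"
    proof (intro AE_I2)
      fix z :: "real \<times> real"
      show "norm (g z * q z) \<le> norm (B * g z)"
      proof (cases "z \<in> strip T")
        case True
        then have "\<bar>q z\<bar> \<le> \<bar>B\<bar>" using q(2)[of "snd z" "fst z"] by (auto simp: strip_def)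
        then show ?thesis by (simp add: abs_mult mult.commute[of "\<bar>B\<bar>"] mult_left_mono)
      qed (simp add: g)
    qed
  qed (use g q in auto)
  have intI: "integrable lborel (\<lambda>z. E (f z) * \<zeta>t z + F (f z) * \<zeta>x z)"
    using bnd[where g="\<lambda>z. E (f z)" and q="\<zeta>t", OF intEF(1) EF0(1) _ Bt] bnd[where g="\<lambda>z. F (f z)" and q="\<zeta>x", OF intEF(2) EF0(2) _ Bx] by simp
  define G where "G z = E (f z) * (smoothstep (- L z) * (smoothstep' (\<sigma> z) / T) * smoothstep (\<xi> z))" for z
  have [measurable]: "L \<in> borel_measurable borel" "\<sigma> \<in> borel_measurable borel" "\<xi> \<in> borel_measurable borel"
    unfolding L_def \<sigma>_def \<xi>_def by measurable
  have intG: "integrable lborel G"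
    unfolding G_def[abs_def]
  proof (rule bounded_mult_integrable[OF intEF(1), where C="2 / T"])
    have "(\<lambda>z. smoothstep (- L z) * (smoothstep' (\<sigma> z) / T) * smoothstep (\<xi> z)) \<in> borel_measurable borel" by measurable
    then show "(\<lambda>z. smoothstep (- L z) * (smoothstep' (\<sigma> z) / T) * smoothstep (\<xi> z)) \<in> borel_measurable lborel" by simp
    fix z
    have "\<bar>smoothstep (- L z)\<bar> * \<bar>smoothstep' (\<sigma> z) / T\<bar> * \<bar>smoothstep (\<xi> z)\<bar> \<le> 1 * (2 / T) * 1"
      using T_pos smoothstep'_nonneg[of "\<sigma> z"] smoothstep'_le[of "\<sigma> z"] smoothstep_abs by (intro mult_mono) (auto intro: divide_right_mono)
    then show "\<bar>smoothstep (- L z) * (smoothstep' (\<sigma> z) / T) * smoothstep (\<xi> z)\<bar> \<le> 2 / T" by (simp add: abs_mult)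
  qed
  let ?K = "2 * (M + \<phi>' 0 * M)"
  have K: "0 \<le> M + \<phi>' 0 * M" using M flux_deriv_nonneg[of 0] by simp
  let ?err = "\<lambda>z. \<bar>A1 z - f z\<bar> + \<bar>A2 z - pflux (f z)\<bar>"
  let ?C = "M + \<phi>' 0 * M"
  have point: "E (f z) * \<zeta>t z + F (f z) * \<zeta>x z \<le> ?K * ?err z - G z" for z
  proof (cases "z \<in> strip T \<and> snd z < t1")
    case False
    show ?thesis
    proof (cases "z \<in> strip T")
      case True
      then have "\<sigma> z \<le> 0" using False \<sigma>0[of "snd z" "fst z"] by simp
      then have "\<zeta>t z = 0" "\<zeta>x z = 0" "G z = 0" by (auto simp: \<zeta>t_def \<zeta>x_def G_def)
      then show ?thesis using K by simp
    next
      case False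
      then show ?thesis using K EF0[OF False] by (simp add: G_def)
    qed
  next
    case True
    then have z: "0 \<le> snd z" "snd z \<le> t1" by (auto simp: strip_def)
    let ?E = "E (f z)" and ?F = "F (f z)" and ?f = "f z"
    let ?b = "smoothstep (D z)" and ?b' = "smoothstep' (D z)" and ?c = "smoothstep (\<sigma> z)" and ?c' = "smoothstep' (\<sigma> z)" and ?g = "smoothstep (\<xi> z)" and ?g' = "smoothstep' (\<xi> z)"
    have wt: "Wt z = - A2 z" using Wt[OF z, of "fst z"] by simp
    have s1: "?E * \<zeta>t z + ?F * \<zeta>x z = ?b' * ?c * ?g * (?E * (\<phi> k - A2 z) + ?F * (A1 z - k))
        - ?E * (?b * (?c' / T) * ?g) + ?b * ?c * ?g' * (?F - \<phi>' k * ?E)"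
      by (simp add: \<zeta>t_def \<zeta>x_def wt algebra_simps)
    \<comment> \<open>The cancellation on which the choice of the test function rests.\<close>
    have key: "?E * (\<phi> k - pflux ?f) + ?F * (?f - k) = 0"
      using f_nonneg[of z] k flux_mono[of k ?f] flux_mono[of ?f k]
      by (cases "?f \<le> k") (auto simp: E_def F_def max_def algebra_simps)
    have s2: "?E * (\<phi> k - A2 z) + ?F * (A1 z - k) \<le> ?C * ?err z"
    proof -
      have "?E * (\<phi> k - A2 z) + ?F * (A1 z - k) = ?E * (pflux ?f - A2 z) + ?F * (A1 z - ?f)"
        using key by (simp add: algebra_simps)
      also have "\<dots> \<le> ?C * \<bar>A2 z - pflux ?f\<bar> + ?C * \<bar>A1 z - ?f\<bar>"
      proof (rule add_mono)
        have "?E * (pflux ?f - A2 z) \<le> ?E * \<bar>A2 z - pflux ?f\<bar>" using Eb(1)[of z] by (intro mult_left_mono) auto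
        also have "\<dots> \<le> ?C * \<bar>A2 z - pflux ?f\<bar>"
          using Eb(3)[of z] M flux_deriv_nonneg[of 0] by (intro mult_right_mono) (auto simp: add_increasing2)
        finally show "?E * (pflux ?f - A2 z) \<le> ?C * \<bar>A2 z - pflux ?f\<bar>" .
        have "?F * (A1 z - ?f) \<le> ?F * \<bar>A1 z - ?f\<bar>" using Fb(1)[of z] by (intro mult_left_mono) auto
        also have "\<dots> \<le> ?C * \<bar>A1 z - ?f\<bar>"
          using Fb(3)[of z] M by (intro mult_right_mono) auto
        finally show "?F * (A1 z - ?f) \<le> ?C * \<bar>A1 z - ?f\<bar>" .
      qed
      finally show ?thesis by (simp add: algebra_simps)
    qed
    have bcg: "0 \<le> ?b' * ?c * ?g" "?b' * ?c * ?g \<le> 2"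
    proof -
      show "0 \<le> ?b' * ?c * ?g" using smoothstep_bounds smoothstep'_nonneg by simp
      have "?b' * ?c * ?g \<le> 2 * 1 * 1"
        using smoothstep_bounds smoothstep'_nonneg smoothstep'_le by (intro mult_mono) auto
      then show "?b' * ?c * ?g \<le> 2" by simp
    qed
    have "?b' * ?c * ?g * (?E * (\<phi> k - A2 z) + ?F * (A1 z - k))
      \<le> ?b' * ?c * ?g * (?C * ?err z)"
      by (rule mult_left_mono[OF s2 bcg(1)])
    also have "\<dots> \<le> 2 * (?C * ?err z)"
      using K by (intro mult_right_mono[OF bcg(2)]) simp
    finally have r1: "?b' * ?c * ?g * (?E * (\<phi> k - A2 z) + ?F * (A1 z - k)) \<le> ?K * ?err z"
      by (simp only: mult.assoc)
    \<comment> \<open>Above the level \<open>k\<close> no signal is faster than the characteristic speed at \<open>k\<close>.\<close>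
    have FE: "?F \<le> \<phi>' k * ?E"
    proof (cases "?f \<le> k")
      case True
      then show ?thesis using flux_mono[of ?f k] f_nonneg[of z] by (simp add: E_def F_def)
    next
      case False
      then show ?thesis using flux_tangent[of k ?f] flux_mono[of k ?f] f_nonneg[of z] k by (simp add: E_def F_def)
    qed
    have r2: "?b * ?c * ?g' * (?F - \<phi>' k * ?E) \<le> 0"
      using FE smoothstep_bounds smoothstep'_nonneg by (intro mult_nonneg_nonpos) auto
    have "smoothstep (- L z) \<le> ?b" by (rule smoothstep_mono) (simp add: D_def W0)
    then have "smoothstep (- L z) * (?c' / T) * ?g \<le> ?b * (?c' / T) * ?g"
      using smoothstep_bounds smoothstep'_nonneg T_pos by (intro mult_right_mono) auto
    then have r3: "G z \<le> ?E * (?b * (?c' / T) * ?g)" unfolding G_def using Eb(1)[of z] by (intro mult_left_mono)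
    show ?thesis unfolding s1 using r1 r2 r3 by linarith
  qed
  have "0 \<le> (LINT z|lborel. ?K * ?err z - G z)"
    by (rule order_trans[OF ineq integral_mono[OF intI]]) (use e1 e2 intG point in auto)
  also have "\<dots> = ?K * ((LINT z|lborel. \<bar>A1 z - f z\<bar>) + (LINT z|lborel. \<bar>A2 z - pflux (f z)\<bar>)) - (LINT z|lborel. G z)"
    using e1 e2 intG by simp
  also have "\<dots> \<le> ?K * (\<epsilon> + \<epsilon>) - (LINT z|lborel. G z)"
    using e1 e2 K by (intro diff_right_mono mult_left_mono add_mono) auto
  finally show ?thesis by (simp add: G_def)
qed

text \<open>In the preceding lemma \<open>\<epsilon>\<close> is arbitrary, so that the integral of a nonnegative function vanishes; its factors are
positive on the indicated region.\<close>

lemma local_height_bound: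
  assumes t1: "0 < t1" "t1 < T" and k: "0 < k" "m + 1 \<le> t1 * (\<phi> k - k * \<phi>' k)"
  shows "AE z in lborel. 0 < snd z \<and> snd z < t1 \<and> 0 < fst z - x1 + \<phi>' k * (t1 - snd z) \<and>
     k * (fst z - x1) + \<phi> k * (t1 - snd z) < 1 \<longrightarrow> f z \<le> k"
proof -
  define L where "L = (\<lambda>z::real\<times>real. (- 1 - k * x1 + \<phi> k * t1) + k * fst z + (- \<phi> k) * snd z)"
  define \<xi> where "\<xi> = (\<lambda>z::real\<times>real. (\<phi>' k * t1 - x1) + 1 * fst z + (- \<phi>' k) * snd z)"
  define \<sigma> where "\<sigma> = (\<lambda>z::real\<times>real. t1 / T + 0 * fst z + (- 1 / T) * snd z)"
  define G where "G = (\<lambda>z. max 0 (f z - k) * (smoothstep (- L z) * (smoothstep' (\<sigma> z) / T) * smoothstep (\<xi> z)))"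
  have [measurable]: "L \<in> borel_measurable borel" "\<sigma> \<in> borel_measurable borel" "\<xi> \<in> borel_measurable borel"
    unfolding L_def \<sigma>_def \<xi>_def by measurable
  have G0: "0 \<le> G z" for z
    using T_pos smoothstep_bounds smoothstep'_nonneg by (auto simp: G_def)
  have le: "(LINT z|lborel. G z) \<le> (2 * (M + \<phi>' 0 * M)) * (\<epsilon> + \<epsilon>)" if "0 < \<epsilon>" for \<epsilon>
    using barrier_integral_le[OF t1 k that, of x1] by (simp add: G_def L_def \<xi>_def \<sigma>_def)
  have lim: "((\<lambda>\<epsilon>. (2 * (M + \<phi>' 0 * M)) * (\<epsilon> + \<epsilon>)) \<longlongrightarrow> (2 * (M + \<phi>' 0 * M)) * (0 + 0)) (at_right 0)"
    by (intro tendsto_intros)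
  have "(LINT z|lborel. G z) \<le> (2 * (M + \<phi>' 0 * M)) * (0 + 0)"
    by (rule tendsto_lowerbound[OF lim]) (use le in \<open>auto simp: eventually_at_right_less eventually_at_filter\<close>)
  moreover have "0 \<le> (LINT z|lborel. G z)" using G0 by simp
  ultimately have G1: "(LINT z|lborel. G z) = 0" by simp
  have intG: "integrable lborel G"
  proof (rule Bochner_Integration.integrable_bound[where f="\<lambda>z. (2 / T) * f z"])
    have "G \<in> borel_measurable borel" unfolding G_def by measurable
    then show "G \<in> borel_measurable lborel" by simp
    show "AE z in lborel. norm (G z) \<le> norm (2 / T * f z)"
    proof (intro AE_I2)
      fix z :: "real \<times> real"
      have "smoothstep (- L z) * (smoothstep' (\<sigma> z) / T) * smoothstep (\<xi> z) \<le> 1 * (2 / T) * 1"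
        using T_pos smoothstep_bounds smoothstep'_nonneg smoothstep'_le by (intro mult_mono) (auto intro: divide_right_mono)
      moreover have "max 0 (f z - k) \<le> f z" using f_nonneg[of z] k by simp
      ultimately have "G z \<le> f z * (2 / T)"
        unfolding G_def using f_nonneg[of z] T_pos smoothstep_bounds smoothstep'_nonneg by (intro mult_mono) auto
      then show "norm (G z) \<le> norm (2 / T * f z)" using G0[of z] f_nonneg[of z] T_pos by (simp add: mult.commute)
    qed
  qed (use f_int in auto)
  have "AE z in lborel. G z = 0"
    using integral_nonneg_eq_0_iff_AE[OF intG] G0 G1 by simp
  then show ?thesis
  proof eventually_elim
    case (elim z)
    show ?case
    proof
      assume a: "0 < snd z \<and> snd z < t1 \<and> 0 < fst z - x1 + \<phi>' k * (t1 - snd z) \<and> k * (fst z - x1) + \<phi> k * (t1 - snd z) < 1"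
      then have "0 < - L z" "0 < \<xi> z" by (auto simp: L_def \<xi>_def algebra_simps)
      moreover have "\<sigma> z = (t1 - snd z) / T" by (simp add: \<sigma>_def diff_divide_distrib)
      then have "0 < \<sigma> z" "\<sigma> z < 1" using a t1 T_pos by auto
      ultimately have "0 < smoothstep (- L z) * (smoothstep' (\<sigma> z) / T) * smoothstep (\<xi> z)"
        using T_pos by (simp add: smoothstep_pos smoothstep'_pos)
      then show "f z \<le> k" using elim unfolding G_def by (metis less_irrefl max.cobounded2 mult_eq_0_iff diff_le_0_iff_le)
    qed
  qed
qed

text \<open>The regions of the local bound contain small rectangles that have \<open>(x1,t1)\<close> as a corner and lie to the right of it
and below it; rational corners are dense.\<close>

theorem regularizing_bound:
  assumes \<tau>: "0 < \<tau>" and m: "0 \<le> m" and k: "0 < k" "m + 1 \<le> \<tau> * (\<phi> k - k * \<phi>' k)"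
  shows "AE z in lborel. \<tau> < snd z \<longrightarrow> f z \<le> k"
proof -
  have \<phi>k: "0 \<le> \<phi> k" "0 \<le> \<phi>' k" using k by (auto intro: flux_nonneg flux_deriv_nonneg)
  have k2: "m + 1 \<le> t1 * (\<phi> k - k * \<phi>' k)" if "\<tau> \<le> t1" for t1
  proof -
    have "0 \<le> \<phi> k - k * \<phi>' k" using k(2) \<tau> m by (smt (verit) mult_pos_neg)
    then show ?thesis using k(2) mult_right_mono[OF that] by (smt (verit))
  qed
  have "AE z in lborel. \<forall>x1\<in>\<rat>. \<forall>t1\<in>\<rat>. \<tau> \<le> t1 \<longrightarrow> t1 < T \<longrightarrow> 0 < snd z \<and> snd z < t1 \<and> 0 < fst z - x1 + \<phi>' k * (t1 - snd z) \<and>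
     k * (fst z - x1) + \<phi> k * (t1 - snd z) < 1 \<longrightarrow> f z \<le> k"
  proof (intro AE_ball_countable'[OF _ countable_rat])
    fix x1 t1 :: real
    show "AE z in lborel. \<tau> \<le> t1 \<longrightarrow> t1 < T \<longrightarrow> 0 < snd z \<and> snd z < t1 \<and> 0 < fst z - x1 + \<phi>' k * (t1 - snd z) \<and>
     k * (fst z - x1) + \<phi> k * (t1 - snd z) < 1 \<longrightarrow> f z \<le> k"
    proof (cases "\<tau> \<le> t1 \<and> t1 < T")
      case True
      then show ?thesis using local_height_bound[OF _ _ k(1) k2, of t1 x1] \<tau> by (auto elim!: eventually_mono)
    qed auto
  qed
  then show ?thesis
  proof eventually_elim
    case (elim z)
    show ?case
    proof
      assume z: "\<tau> < snd z"
      show "f z \<le> k"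
      proof (cases "snd z < T")
        case False
        then have "f z = 0" by (intro f_strip) (auto simp: strip_def)
        then show ?thesis using k by simp
      next
        case True
        \<comment> \<open>With this height and with width \<open>1/(2k)\<close> the affine function stays negative on the rectangle.\<close>
        define \<delta> where "\<delta> = 1 / (2 * (\<phi> k + 1))"
        obtain t1 where t1: "t1 \<in> \<rat>" "snd z < t1" "t1 < min T (snd z + \<delta>)"
          using Rats_dense_in_real[of "snd z" "min T (snd z + \<delta>)"] True \<phi>k by (auto simp: \<delta>_def)
        obtain x1 where x1: "x1 \<in> \<rat>" "fst z - 1 / (2 * k) < x1" "x1 < fst z"
          using Rats_dense_in_real[of "fst z - 1 / (2 * k)" "fst z"] k by auto
        have "k * (fst z - x1) < 1 / 2" using x1 k by (simp add: field_simps)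
        moreover have "\<phi> k * (t1 - snd z) \<le> 1 / 2"
        proof -
          have "\<phi> k * (t1 - snd z) \<le> (\<phi> k + 1) * \<delta>" using t1 \<phi>k by (intro mult_mono) auto
          also have "\<dots> = 1 / 2" using \<phi>k by (simp add: \<delta>_def)
          finally show ?thesis .
        qed
        moreover have "0 \<le> \<phi>' k * (t1 - snd z)" using t1 \<phi>k by simp
        ultimately show ?thesis using elim x1 t1 z \<tau> by auto
      qed
    qed
  qed
qed

end


section \<open>Kruzkov solutions\<close>

lemma AE_lborel_sections:
  fixes P :: "real \<times> real \<Rightarrow> bool"
  assumes "AE z in lborel. P z"
  shows "AE t in lborel. AE x in lborel. P (x, t)"
proof -
  obtain N where N: "{z. \<not> P z} \<subseteq> N" "emeasure lborel N = 0" "N \<in> sets borel"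
    using assms by (auto elim!: AE_E)
  have [measurable]: "N \<in> sets (lborel \<Otimes>\<^sub>M lborel)" using N(3) by (subst lborel_prod) simp
  have "(\<integral>\<^sup>+t. (\<integral>\<^sup>+x. indicator N (x, t) \<partial>lborel) \<partial>lborel) = (\<integral>\<^sup>+z. indicator N z \<partial>(lborel \<Otimes>\<^sub>M lborel))"
    by (rule lborel_pair.nn_integral_snd) measurable
  also have "\<dots> = 0" using N by (simp add: lborel_prod)
  finally have "AE t in lborel. (\<integral>\<^sup>+x. indicator N (x, t) \<partial>lborel) = (0::ennreal)"
    by (subst (asm) nn_integral_0_iff_AE) measurable
  then show ?thesis
  proof eventually_elim
    case (elim t)
    have "(\<lambda>x. indicator N (x, t)::ennreal) \<in> borel_measurable lborel" by measurable
    then have "AE x in lborel. indicator N (x, t) = (0::ennreal)"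
      using elim by (simp add: nn_integral_0_iff_AE)
    then show ?case by eventually_elim (use N in \<open>auto simp: indicator_def split: if_splits\<close>)
  qed
qed

lemma open_strip: "open (strip T)" unfolding strip_def by (intro open_Times) auto

lemma strip_borel[measurable]: "strip T \<in> sets borel" using open_strip by auto

lemma AE_lebesgue_on_iff:
  "S \<in> sets borel \<Longrightarrow> (AE z in lebesgue_on S. P z) \<longleftrightarrow> (AE z in lborel. z \<in> S \<longrightarrow> P z)"
  by (subst AE_restrict_space_iff) (auto simp: AE_completion_iff)

context concave_flux begin

text \<open>Integrability over the strip follows by integrating the uniform bound for the norms of the time sections.\<close>

lemma kruzkov_borel_representative:
  assumes kr: "kruzkov_solution T \<phi> w0 w" and T: "0 < T"
    and w0: "integrable lebesgue w0" "AE x in lebesgue. 0 \<le> w0 x" "(LINT x|lebesgue. w0 x) \<le> m"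
  obtains f M where "borel_entropy_solution \<phi> \<phi>' T m M w0 f" "AE z in lborel. z \<in> strip T \<longrightarrow> w z = f z"
proof -
  obtain B where wm: "w \<in> borel_measurable (lebesgue_on (strip T))" and B: "AE z in lebesgue_on (strip T). \<bar>w z\<bar> \<le> B"
    and w_nonneg: "AE z in lebesgue_on (strip T). 0 \<le> w z"
    and w_int: "AE t in lebesgue_on {0<..<T}. integrable lebesgue (\<lambda>x. w (x, t))"
    and w_L1: "Linf (lebesgue_on {0<..<T}) (\<lambda>t. LINT x|lebesgue. \<bar>w (x, t)\<bar>)"
    using kr unfolding kruzkov_solution_def Linf_def by blast
  have ent: "- (LINT x|lebesgue. E (w0 x) * \<zeta> (x, 0)) \<le> (LINT z|lebesgue_on (strip T). E (w z) * \<zeta>t z + F (w z) * \<zeta>x z)"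
    if "nonneg_test_function T \<zeta> \<zeta>t \<zeta>x" "entropy_pair \<phi> E F" for \<zeta> \<zeta>t \<zeta>x E F
    using kr that unfolding kruzkov_solution_def by blast
  have slm: "strip T \<inter> space lebesgue \<in> sets lebesgue" by simp
  \<comment> \<open>Off the strip \<open>w\<close> is arbitrary, not even measurable.\<close>
  define w' where "w' z = indicator (strip T) z *\<^sub>R w z" for z
  have w'm: "w' \<in> borel_measurable lebesgue"
    using wm unfolding w'_def[abs_def] by (subst (asm) borel_measurable_restrict_space_iff) auto
  obtain g where g[measurable]: "g \<in> borel_measurable borel" and g_eq: "AE z in lborel. w' z = g z"
    using completion_ex_borel_measurable_real[OF w'm] by auto
  \<comment> \<open>The bounds hold for \<open>w\<close> almost everywhere only; truncation makes them hold everywhere.\<close>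
  define f where "f z = indicator (strip T) z * max 0 (min \<bar>B\<bar> (g z))" for z
  have fm[measurable]: "f \<in> borel_measurable borel" unfolding f_def[abs_def] by measurable
  have wf: "AE z in lborel. w' z = f z"
    using g_eq B[unfolded AE_lebesgue_on_iff[OF strip_borel]] w_nonneg[unfolded AE_lebesgue_on_iff[OF strip_borel]]
    by eventually_elim (auto simp: f_def w'_def indicator_def)
  then have wf': "AE z in lborel. z \<in> strip T \<longrightarrow> w z = f z"
    by eventually_elim (auto simp: w'_def)
  have f0: "0 \<le> f z" "f z \<le> \<bar>B\<bar>" for z by (auto simp: f_def indicator_def)
  have fs: "f z = 0" if "z \<notin> strip T" for z using that by (simp add: f_def)
  obtain C where C: "AE t in lborel. t \<in> {0<..<T} \<longrightarrow> \<bar>LINT x|lebesgue. \<bar>w (x, t)\<bar>\<bar> \<le> C"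
    using w_L1 AE_lebesgue_on_iff[of "{0<..<T}"] by (auto simp: Linf_def)
  have f_int: "integrable lborel f"
  proof -
    have "(\<integral>\<^sup>+z. ennreal (f z) \<partial>lborel) = (\<integral>\<^sup>+t. (\<integral>\<^sup>+x. ennreal (f (x, t)) \<partial>lborel) \<partial>lborel)"
      by (subst lborel_prod[symmetric], rule lborel_pair.nn_integral_snd[symmetric]) (simp add: lborel_prod)
    also have "\<dots> \<le> (\<integral>\<^sup>+t. ennreal \<bar>C\<bar> * indicator {0<..<T} t \<partial>lborel)"
    proof (rule nn_integral_mono_AE)
      have w_int': "AE t in lborel. t \<in> {0<..<T} \<longrightarrow> integrable lebesgue (\<lambda>x. w (x, t))"
        using w_int by (subst (asm) AE_lebesgue_on_iff) auto
      show "AE t in lborel. (\<integral>\<^sup>+x. ennreal (f (x, t)) \<partial>lborel) \<le> ennreal \<bar>C\<bar> * indicator {0<..<T} t"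
        using w_int' C AE_lborel_sections[OF wf']
      proof eventually_elim
        case (elim t)
        show ?case
        proof (cases "t \<in> {0<..<T}")
          case False
          then have "f (x, t) = 0" for x by (intro fs) (auto simp: strip_def)
          then show ?thesis by simp
        next
          case True
          have "(\<integral>\<^sup>+x. ennreal (f (x, t)) \<partial>lborel) = (\<integral>\<^sup>+x. ennreal \<bar>w (x, t)\<bar> \<partial>lebesgue)"
            unfolding nn_integral_completion
          proof (rule nn_integral_cong_AE)
            show "AE x in lborel. ennreal (f (x, t)) = ennreal \<bar>w (x, t)\<bar>"
              using elim(3) by eventually_elim (use True f0(1)[of "(_, t)"] in \<open>auto simp: strip_def\<close>)
          qed
          also have "\<dots> = ennreal (LINT x|lebesgue. \<bar>w (x, t)\<bar>)"
            using elim(1) True by (subst nn_integral_eq_integral) auto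
          also have "\<dots> \<le> ennreal \<bar>C\<bar>" using elim(2) True by (intro ennreal_leI) auto
          finally show ?thesis using True by simp
        qed
      qed
    qed
    also have "\<dots> = ennreal \<bar>C\<bar> * ennreal T" using T by (simp add: nn_integral_cmult_indicator)
    also have "\<dots> < \<infinity>" by (simp add: ennreal_mult_less_top)
    finally show ?thesis using f0 by (auto simp: integrable_iff_bounded)
  qed
  have "borel_entropy_solution \<phi> \<phi>' T m \<bar>B\<bar> w0 f"
  proof (unfold_locales)
    fix \<zeta> \<zeta>t \<zeta>x E F
    assume \<zeta>: "nonneg_test_function T \<zeta> \<zeta>t \<zeta>x" and c: "continuous_on UNIV \<zeta>t" "continuous_on UNIV \<zeta>x"
      and EF: "entropy_pair \<phi> E F" and m: "E \<in> borel_measurable borel" "F \<in> borel_measurable borel" and 0: "E 0 = 0" "F 0 = 0"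
    note [measurable] = m
    have [measurable]: "\<zeta>t \<in> borel_measurable borel" "\<zeta>x \<in> borel_measurable borel"
      using c by (auto intro: borel_measurable_continuous_onI)
    have fI: "(\<lambda>z. E (f z) * \<zeta>t z + F (f z) * \<zeta>x z) \<in> borel_measurable borel" by measurable
    have lm: "q \<in> borel_measurable borel \<Longrightarrow> q \<in> borel_measurable lebesgue" for q :: "real \<times> real \<Rightarrow> real"
      by (simp add: measurable_completion)
    have wI: "(\<lambda>z. E (w' z) * \<zeta>t z + F (w' z) * \<zeta>x z) \<in> borel_measurable lebesgue"
      by (intro borel_measurable_add borel_measurable_times measurable_compose[OF w'm m(1)] measurable_compose[OF w'm m(2)]
        lm[OF \<open>\<zeta>t \<in> borel_measurable borel\<close>] lm[OF \<open>\<zeta>x \<in> borel_measurable borel\<close>])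
    have "(LINT z|lebesgue_on (strip T). E (w z) * \<zeta>t z + F (w z) * \<zeta>x z)
        = (LINT z|lebesgue. indicator (strip T) z *\<^sub>R (E (w z) * \<zeta>t z + F (w z) * \<zeta>x z))"
      by (rule integral_restrict_space) simp
    also have "\<dots> = (LINT z|lebesgue. E (w' z) * \<zeta>t z + F (w' z) * \<zeta>x z)"
      by (intro Bochner_Integration.integral_cong) (auto simp: w'_def indicator_def 0)
    also have "\<dots> = (LINT z|lebesgue. E (f z) * \<zeta>t z + F (f z) * \<zeta>x z)"
      by (rule integral_cong_AE[OF wI lm[OF fI]]) (use wf[THEN AE_completion] in eventually_elim, simp)
    also have "\<dots> = (LINT z|lborel. E (f z) * \<zeta>t z + F (f z) * \<zeta>x z)"
      using fI by (intro integral_completion) simp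
    finally show "- (LINT x|lebesgue. E (w0 x) * \<zeta> (x, 0)) \<le> (LINT z|lborel. E (f z) * \<zeta>t z + F (f z) * \<zeta>x z)"
      using ent[OF \<zeta> EF] by simp
  qed (use T w0 f_int f0 fs in auto)
  then show ?thesis using wf' that by blast
qed

theorem kruzkov_regularizing_bound:
  assumes "kruzkov_solution T \<phi> w0 w" "0 < T"
    and w0: "integrable lebesgue w0" "AE x in lebesgue. 0 \<le> w0 x" "(LINT x|lebesgue. w0 x) \<le> m"
    and "0 < \<tau>" "0 \<le> m" "0 < k" "m + 1 \<le> \<tau> * (\<phi> k - k * \<phi>' k)"
  shows "AE z in lebesgue_on (strip T). \<tau> < snd z \<longrightarrow> w z \<le> k"
proof -
  obtain f M where f: "borel_entropy_solution \<phi> \<phi>' T m M w0 f" and eq: "AE z in lborel. z \<in> strip T \<longrightarrow> w z = f z"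
    using kruzkov_borel_representative[OF assms(1-5)] .
  have "AE z in lborel. \<tau> < snd z \<longrightarrow> f z \<le> k"
    using borel_entropy_solution.regularizing_bound[OF f assms(6-9)] .
  with eq have "AE z in lborel. z \<in> strip T \<longrightarrow> \<tau> < snd z \<longrightarrow> w z \<le> k" by eventually_elim auto
  then show ?thesis by (simp add: AE_lebesgue_on_iff)
qed

end


section \<open>Upper bounds for weak limits\<close>

text \<open>These functions are compactly supported in \<open>V\<close> and converge to its indicator. The whole space is treated apart
because the distance to the empty set is zero by convention.\<close>

definition exhaust :: "'a::euclidean_space set \<Rightarrow> nat \<Rightarrow> 'a \<Rightarrow> real" where
  "exhaust V n z = clamp (real n * (if V = UNIV then 1 else infdist z (- V)) - 1) * clamp (real n + 1 - norm z)"

lemma exhaust_bounds: "0 \<le> exhaust V n z" "exhaust V n z \<le> 1"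
  using clamp_bounds unfolding exhaust_def by (auto intro: mult_le_one)

lemma exhaust_continuous: "continuous_on A (exhaust V n)"
  unfolding exhaust_def[abs_def] by (cases "V = UNIV") (auto intro!: continuous_intros)

lemma exhaust_off: assumes "z \<notin> V" shows "exhaust V n z = 0"
  using assms by (auto simp: exhaust_def clamp_def)

lemma exhaust_Cc: assumes "open V" shows "exhaust V n \<in> Cc V"
proof -
  let ?d = "\<lambda>z. if V = UNIV then 1 else infdist z (- V)"
  let ?K = "{z. 1 \<le> real n * ?d z} \<inter> cball 0 (real n + 1)"
  have "closed {z. 1 \<le> real n * ?d z}"
    by (cases "V = UNIV") (auto intro!: closed_Collect_le continuous_intros)
  then have "compact ?K" by (intro closed_Int_compact) auto
  moreover have "?K \<subseteq> V"
  proof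
    fix z assume z: "z \<in> ?K"
    show "z \<in> V"
    proof (rule ccontr)
      assume "z \<notin> V"
      then have "V \<noteq> UNIV" "infdist z (- V) = 0" by (auto intro: infdist_zero)
      then show False using z by simp
    qed
  qed
  moreover have "exhaust V n z = 0" if "z \<notin> ?K" for z
    using that by (auto simp: exhaust_def clamp_def split: if_splits)
  ultimately show ?thesis unfolding Cc_def using exhaust_continuous by blast
qed

lemma exhaust_lim: assumes "open V" shows "(\<lambda>n. exhaust V n z) \<longlonglongrightarrow> indicator V z"
proof (cases "z \<in> V")
  case True
  let ?d = "if V = UNIV then 1 else infdist z (- V)"
  have d: "0 < ?d"
    using True assms in_closed_iff_infdist_zero[of "- V" z] infdist_nonneg[of z "- V"] by (auto simp: less_le)
  obtain N where N: "max (2 / ?d) (norm z) \<le> real N" using real_arch_simple by blast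
  have "\<forall>\<^sub>F n in sequentially. exhaust V n z = 1"
    unfolding eventually_sequentially
  proof (intro exI[of _ N] allI impI)
    fix n assume "N \<le> n"
    then have n: "2 / ?d \<le> real n" "norm z \<le> real n" using N by (auto intro: order_trans)
    then have "2 \<le> real n * ?d" using d by (simp only: divide_le_eq split: if_split)
    then show "exhaust V n z = 1" using n unfolding exhaust_def clamp_def by auto
  qed
  then show ?thesis using True by (simp add: tendsto_eventually)
qed (simp add: exhaust_off)

lemma Cc_integrable:
  fixes \<rho> :: "'a::euclidean_space \<Rightarrow> real"
  assumes "\<rho> \<in> Cc S" shows "integrable lborel \<rho>"
proof -
  obtain K where K: "compact K" "\<And>z. z \<notin> K \<Longrightarrow> \<rho> z = 0" and c: "continuous_on UNIV \<rho>"
    using assms by (auto simp: Cc_def)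
  have "integrable lborel (\<lambda>x. indicator K x *\<^sub>R \<rho> x)"
    by (rule borel_integrable_compact[OF K(1)]) (use c in \<open>auto intro: continuous_on_subset\<close>)
  also have "(\<lambda>x. indicator K x *\<^sub>R \<rho> x) = \<rho>" using K(2) by (auto simp: indicator_def fun_eq_iff)
  finally show ?thesis .
qed

lemma weak_limit_integral_le:
  assumes w: "weak_star_conv S w u" and S: "S \<in> sets borel"
    and bound: "\<And>n. AE z in lebesgue_on S. z \<in> U \<longrightarrow> w n z \<le> k" and k: "0 \<le> k"
    and \<rho>: "\<rho> \<in> Cc S" "\<And>z. 0 \<le> \<rho> z" "\<And>z. z \<notin> U \<Longrightarrow> \<rho> z = 0"
  shows "(LINT z|u. \<rho> z) \<le> k * (LINT z|lborel. \<rho> z)"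
proof (rule LIMSEQ_le_const2)
  show "(\<lambda>n. LINT z|lebesgue_on S. w n z * \<rho> z) \<longlonglongrightarrow> (LINT z|u. \<rho> z)"
    using w \<rho>(1) by (simp add: weak_star_conv_def)
  have i: "integrable lborel \<rho>" using Cc_integrable[OF \<rho>(1)] .
  have m: "\<rho> \<in> borel_measurable lborel" using i by auto
  have \<rho>S: "\<rho> z = 0" if "z \<notin> S" for z using \<rho>(1) that unfolding Cc_def by blast
  have e: "indicator S z *\<^sub>R (k * \<rho> z) = k * \<rho> z" for z using \<rho>S[of z] by (auto simp: indicator_def)
  have S': "S \<inter> space lebesgue \<in> sets lebesgue" using S by simp
  have int: "integrable (lebesgue_on S) (\<lambda>z. k * \<rho> z)"
    unfolding integrable_restrict_space[OF S'] e using i m by (simp add: integrable_completion)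
  have eq: "(LINT z|lebesgue_on S. k * \<rho> z) = k * (LINT z|lborel. \<rho> z)"
    unfolding integral_restrict_space[OF S'] e using m by (simp add: integral_completion)
  show "\<exists>N. \<forall>n\<ge>N. (LINT z|lebesgue_on S. w n z * \<rho> z) \<le> k * (LINT z|lborel. \<rho> z)"
  proof (intro exI allI impI)
    fix n
    have "(LINT z|lebesgue_on S. w n z * \<rho> z) \<le> (LINT z|lebesgue_on S. k * \<rho> z)"
    proof (rule integral_mono_AE'[OF int])
      show "AE z in lebesgue_on S. w n z * \<rho> z \<le> k * \<rho> z"
        using bound[of n]
      proof eventually_elim
        case (elim z)
        then show ?case using \<rho>(2)[of z] \<rho>(3)[of z] by (cases "z \<in> U") (auto intro: mult_right_mono)
      qed
    qed (use k \<rho>(2) in auto)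
    then show "(LINT z|lebesgue_on S. w n z * \<rho> z) \<le> k * (LINT z|lborel. \<rho> z)" unfolding eq .
  qed
qed

lemma emeasure_open_le_from_exhaust:
  fixes V :: "'a::euclidean_space set"
  assumes \<mu>: "finite_measure \<mu>" and m: "\<And>n. exhaust V n \<in> borel_measurable \<mu>" and V: "open V" "V \<inter> space \<mu> \<in> sets \<mu>"
    and le: "\<And>n. (LINT z|\<mu>. exhaust V n z) \<le> k * (LINT z|lborel. exhaust V n z)" and k: "0 < k"
  shows "emeasure \<mu> (V \<inter> space \<mu>) \<le> ennreal k * emeasure lborel V"
proof (cases "emeasure lborel V = \<infinity>")
  case True
  then show ?thesis using k by (simp add: ennreal_mult_top)
next
  case False
  interpret finite_measure \<mu> by fact
  have Vm[measurable]: "V \<in> sets borel" using V by auto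
  have iV: "integrable lborel (indicator V :: 'a \<Rightarrow> real)" using False by (simp add: integrable_indicator_iff top.not_eq_extremum)
  have eb: "\<bar>exhaust V n z\<bar> \<le> 1" for n z using exhaust_bounds[of V n z] by simp
  have "{z \<in> space \<mu>. z \<in> V} = V \<inter> space \<mu>" by auto
  then have iVm: "(indicator V :: 'a \<Rightarrow> real) \<in> borel_measurable \<mu>"
    using V(2) by (intro borel_measurable_indicator') simp
  have "(\<lambda>n. LINT z|\<mu>. exhaust V n z) \<longlonglongrightarrow> (LINT z|\<mu>. indicator V z)"
    by (rule integral_dominated_convergence[where w="\<lambda>_. 1"])
      (use m V iVm eb in \<open>auto intro!: exhaust_lim AE_I2\<close>)
  moreover have "(LINT z|\<mu>. exhaust V n z) \<le> k * measure lborel V" for n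
  proof -
    have "(LINT z|lborel. exhaust V n z) \<le> (LINT z|lborel. indicator V z)"
    proof (rule integral_mono[OF Cc_integrable[OF exhaust_Cc[OF V(1)]] iV])
      fix z show "exhaust V n z \<le> indicator V z"
        using exhaust_bounds[of V n z] exhaust_off[of z V n] by (cases "z \<in> V") auto
    qed
    then show ?thesis using le[of n] k by (simp add: order_trans[OF _ mult_left_mono])
  qed
  ultimately have "(LINT z|\<mu>. indicator V z) \<le> k * measure lborel V"
    by (intro LIMSEQ_le_const2) auto
  then have "measure \<mu> (V \<inter> space \<mu>) \<le> k * measure lborel V" by simp
  then show ?thesis
    using False k by (simp add: emeasure_eq_measure emeasure_eq_ennreal_measure ennreal_mult[symmetric] ennreal_leI)
qed

text \<open>Outer regularity of Lebesgue measure carries the bound from open sets to Borel sets.\<close>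

lemma emeasure_le_of_open:
  fixes A :: "'a::euclidean_space set"
  assumes open_le: "\<And>V. open V \<Longrightarrow> V \<subseteq> U \<Longrightarrow> emeasure \<mu> V \<le> ennreal k * emeasure lborel V"
    and U: "open U" and sets: "\<And>V. V \<in> sets borel \<Longrightarrow> V \<subseteq> U \<Longrightarrow> V \<in> sets \<mu>"
    and A: "A \<in> sets borel" "A \<subseteq> U"
  shows "emeasure \<mu> A \<le> ennreal k * emeasure lborel A"
proof -
  have le: "emeasure \<mu> A \<le> ennreal k * (emeasure lborel A + ennreal e)" if e: "0 < e" for e
  proof -
    obtain V where V: "open V" "A \<subseteq> V" "emeasure lborel (V - A) < ennreal e"
      using outer_regular_lborel[OF A(1) e] by auto
    have [measurable]: "V \<in> sets borel" "U \<in> sets borel" "A \<in> sets borel" using V U A by auto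
    have "emeasure \<mu> A \<le> emeasure \<mu> (V \<inter> U)"
      using V A U by (intro emeasure_mono sets) auto
    also have "\<dots> \<le> ennreal k * emeasure lborel (V \<inter> U)" using V U by (intro open_le) auto
    also have "emeasure lborel (V \<inter> U) \<le> emeasure lborel V" by (intro emeasure_mono) auto
    also have "emeasure lborel V \<le> emeasure lborel A + emeasure lborel (V - A)"
      using emeasure_subadditive[of A lborel "V - A"] V by (auto simp: Un_absorb1)
    also have "\<dots> \<le> emeasure lborel A + ennreal e" using V by (intro add_left_mono) auto
    finally show ?thesis by (simp add: mult_left_mono)
  qed
  have "((\<lambda>e. ennreal k * (emeasure lborel A + ennreal e)) \<longlongrightarrow> ennreal k * (emeasure lborel A + ennreal 0)) (at_right 0)"
    by (intro ennreal_tendsto_cmult tendsto_add tendsto_ennrealI tendsto_intros) auto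
  then show ?thesis
    by (intro tendsto_lowerbound[of "\<lambda>e. ennreal k * (emeasure lborel A + ennreal e)" _ "at_right 0"])
      (use le in \<open>auto simp: eventually_at_filter\<close>)
qed

text \<open>The indicator of the set where \<open>g\<close> is positive is an almost everywhere limit of continuous functions; clamped and
multiplied by an exhaustion of \<open>V\<close> they become test functions.\<close>

lemma AE_nonpos_of_tests:
  fixes g :: "'a::euclidean_space \<Rightarrow> real"
  assumes g: "integrable (lebesgue_on S) g" and S: "S \<in> sets borel" and V: "open V" "V \<subseteq> S"
    and test: "\<And>\<theta>. \<theta> \<in> Cc V \<Longrightarrow> (\<And>t. 0 \<le> \<theta> t) \<Longrightarrow> (LINT t|lebesgue_on S. \<theta> t * g t) \<le> 0"
  shows "AE t in lebesgue_on S. t \<in> V \<longrightarrow> g t \<le> 0"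
proof -
  have S': "S \<inter> space lebesgue \<in> sets lebesgue" using S by simp
  define G where "G t = indicator S t *\<^sub>R g t" for t
  have Gi: "integrable lebesgue G" using g unfolding G_def[abs_def] integrable_restrict_space[OF S'] .
  have Gm[measurable]: "G \<in> borel_measurable lebesgue" using Gi by auto
  have Vm[measurable]: "V \<in> sets lebesgue" using V by auto
  define A where "A = {t \<in> space lebesgue. t \<in> V \<and> 0 < G t}"
  have Am: "A \<in> sets lebesgue" unfolding A_def by measurable
  obtain N h where N: "negligible N" and h: "\<And>n. continuous_on UNIV (h n)" "\<And>x. x \<notin> N \<Longrightarrow> (\<lambda>n. h n x) \<longlonglongrightarrow> indicat_real A x"
    using indicator_measurable_on[OF Am] unfolding measurable_on_def by auto
  define \<theta> where "\<theta> n t = clamp (h n t) * exhaust V n t" for n :: nat and t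
  have \<theta>c: "continuous_on UNIV (\<theta> n)" for n
    unfolding \<theta>_def[abs_def] by (intro continuous_intros h exhaust_continuous)
  have \<theta>Cc: "\<theta> n \<in> Cc V" for n
    using exhaust_Cc[OF V(1), of n] \<theta>c[of n] by (auto simp: Cc_def \<theta>_def)
  have \<theta>b: "0 \<le> \<theta> n t" "\<theta> n t \<le> 1" for n t
    using clamp_bounds[of "h n t"] exhaust_bounds[of V n t] by (auto simp: \<theta>_def intro: mult_le_one)
  have "(\<lambda>n. LINT t|lebesgue. \<theta> n t * G t) \<longlonglongrightarrow> (LINT t|lebesgue. indicator A t * G t)"
  proof (rule integral_dominated_convergence[where w="\<lambda>t. \<bar>G t\<bar>"])
    have "AE t in lebesgue. t \<notin> N" using N by (intro AE_not_in) (simp add: negligible_iff_null_sets)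
    then show "AE t in lebesgue. (\<lambda>n. \<theta> n t * G t) \<longlonglongrightarrow> indicator A t * G t"
    proof eventually_elim
      case (elim t)
      have "(\<lambda>n. clamp (h n t)) \<longlonglongrightarrow> clamp (indicat_real A t)"
        unfolding clamp_def by (intro tendsto_intros h elim)
      then have "(\<lambda>n. \<theta> n t) \<longlonglongrightarrow> clamp (indicat_real A t) * indicator V t"
        unfolding \<theta>_def by (intro tendsto_mult exhaust_lim V)
      also have "clamp (indicat_real A t) * indicator V t = indicator A t"
        by (auto simp: indicator_def A_def clamp_def)
      finally show ?case by (intro tendsto_mult tendsto_const)
    qed
    show "AE t in lebesgue. norm (\<theta> n t * G t) \<le> \<bar>G t\<bar>" for n
      using \<theta>b by (intro AE_I2) (simp add: abs_mult mult_left_le_one_le)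
    have "\<theta> n \<in> borel_measurable lebesgue" for n
      using \<theta>c[of n] by (intro measurable_completion) (simp add: borel_measurable_continuous_onI)
    then show "(\<lambda>t. \<theta> n t * G t) \<in> borel_measurable lebesgue" for n by (intro borel_measurable_times Gm)
    show "(\<lambda>t. indicator A t * G t) \<in> borel_measurable lebesgue"
      using Am by (intro borel_measurable_times Gm) auto
  qed (use Gi in auto)
  moreover have "(LINT t|lebesgue. \<theta> n t * G t) \<le> 0" for n
  proof -
    have "(LINT t|lebesgue_on S. \<theta> n t * g t) = (LINT t|lebesgue. \<theta> n t * G t)"
      unfolding integral_restrict_space[OF S'] by (simp add: G_def mult_ac)
    then show ?thesis using test[OF \<theta>Cc \<theta>b(1), of n] by simp
  qed
  ultimately have le: "(LINT t|lebesgue. indicator A t * G t) \<le> 0" by (intro LIMSEQ_le_const2) auto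
  have i: "integrable lebesgue (\<lambda>t. indicator A t * G t)"
    using integrable_mult_indicator[OF Am Gi] by simp
  have nn: "0 \<le> indicator A t * G t" for t by (auto simp: indicator_def A_def)
  have "(LINT t|lebesgue. indicator A t * G t) = 0"
    by (intro antisym le integral_nonneg_AE) (use nn in auto)
  then have "AE t in lebesgue. indicator A t * G t = 0"
    using integral_nonneg_eq_0_iff_AE[OF i] nn by simp
  then have "AE t in lebesgue. t \<in> S \<longrightarrow> t \<in> V \<longrightarrow> g t \<le> 0"
    by eventually_elim (auto simp: A_def G_def indicator_def not_less split: if_splits)
  then show ?thesis by (subst AE_restrict_space_iff[OF S'])
qed


section \<open>Lebesgue decomposition\<close>

text \<open>On the union \<open>Z\<close> of the two null sets that carry the singular parts the absolutely continuous parts vanish, and off \<open>Z\<close>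
the singular parts vanish, so both decompositions are \<open>M\<close> restricted to \<open>Z\<close> and to its complement.\<close>

lemma lebesgue_decomposition_unique:
  assumes "lebesgue_decomposition N M Ma Ms" "lebesgue_decomposition N M Ma' Ms'"
  shows "Ma = Ma'" "Ms = Ms'"
proof -
  have s: "sets Ma = sets N" "sets Ms = sets N" "sets Ma' = sets N" "sets Ms' = sets N"
    and ac: "null_sets N \<subseteq> null_sets Ma" "null_sets N \<subseteq> null_sets Ma'"
    and M: "\<And>A. A \<in> sets N \<Longrightarrow> emeasure M A = emeasure Ma A + emeasure Ms A"
      "\<And>A. A \<in> sets N \<Longrightarrow> emeasure M A = emeasure Ma' A + emeasure Ms' A"
    using assms by (auto simp: lebesgue_decomposition_def absolutely_continuous_def)
  obtain A A' where A: "A \<in> sets N" "emeasure N A = 0" "emeasure Ms (space N - A) = 0"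
    and A': "A' \<in> sets N" "emeasure N A' = 0" "emeasure Ms' (space N - A') = 0"
    using assms by (auto simp: lebesgue_decomposition_def mutually_singular_def)
  define Z where "Z = A \<union> A'"
  have Z: "Z \<in> null_sets N" using A A' by (auto simp: Z_def)
  have Zs[simp]: "Z \<in> sets N" using Z by auto
  have on: "emeasure Ma (B \<inter> Z) = 0" "emeasure Ma' (B \<inter> Z) = 0" if "B \<in> sets N" for B
    using null_set_Int1[OF Z that] null_setsD1 ac by (metis Int_commute subsetD)+
  have off: "emeasure Ms (B - Z) = 0" "emeasure Ms' (B - Z) = 0" if B: "B \<in> sets N" for B
  proof -
    have "emeasure Ms (B - Z) \<le> emeasure Ms (space N - A)" "emeasure Ms' (B - Z) \<le> emeasure Ms' (space N - A')"
      by (intro emeasure_mono; use B A(1) A'(1) s sets.sets_into_space[OF B] in \<open>auto simp: Z_def\<close>)+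
    then show "emeasure Ms (B - Z) = 0" "emeasure Ms' (B - Z) = 0" unfolding A(3) A'(3) by (simp_all only: le_zero_eq)
  qed
  have split: "emeasure \<mu> B = emeasure \<mu> (B \<inter> Z) + emeasure \<mu> (B - Z)" if "B \<in> sets N" "sets \<mu> = sets N" for B \<mu>
  proof -
    have "B \<inter> Z \<in> sets \<mu>" "B - Z \<in> sets \<mu>" using that Zs by (simp_all only: sets.Int sets.Diff)
    then have "emeasure \<mu> (B \<inter> Z) + emeasure \<mu> (B - Z) = emeasure \<mu> ((B \<inter> Z) \<union> (B - Z))"
      by (rule plus_emeasure) auto
    then show ?thesis by (simp only: Int_Diff_Un)
  qed
  show "Ma = Ma'"
  proof (rule measure_eqI)
    fix B assume "B \<in> sets Ma"
    then have B: "B \<in> sets N" using s by simp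
    have "emeasure Ma (B - Z) = emeasure M (B - Z)" "emeasure Ma' (B - Z) = emeasure M (B - Z)"
      using M[OF sets.Diff[OF B Zs]] off[OF B] by simp_all
    then show "emeasure Ma B = emeasure Ma' B" by (simp only: split[OF B s(1)] split[OF B s(3)] on[OF B])
  qed (simp add: s)
  show "Ms = Ms'"
  proof (rule measure_eqI)
    fix B assume "B \<in> sets Ms"
    then have B: "B \<in> sets N" using s by simp
    have "emeasure Ms (B \<inter> Z) = emeasure M (B \<inter> Z)" "emeasure Ms' (B \<inter> Z) = emeasure M (B \<inter> Z)"
      using M[OF sets.Int[OF B Zs]] on[OF B] by simp_all
    then show "emeasure Ms B = emeasure Ms' B" by (simp only: split[OF B s(2)] split[OF B s(4)] off[OF B])
  qed (simp add: s)
qed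

text \<open>A null set of \<open>N\<close> with the greatest \<open>M\<close>-measure exists, since null sets are closed under countable unions. What is left of
\<open>M\<close> off this set gives no mass to null sets.\<close>

lemma lebesgue_decomposition_exists:
  assumes M: "finite_measure M" "sets M = sets N"
  shows "\<exists>Ma Ms. lebesgue_decomposition N M Ma Ms"
proof -
  interpret finite_measure M by fact
  let ?S = "emeasure M ` null_sets N"
  have "?S \<noteq> {}" by blast
  then obtain g where g: "range g \<subseteq> ?S" "Sup ?S = (SUP i::nat. g i)"
    using ennreal_Sup_countable_SUP[of ?S] by blast
  have "\<forall>i. \<exists>A. A \<in> null_sets N \<and> g i = emeasure M A" using g(1) by blast
  then obtain A where A: "\<And>i::nat. A i \<in> null_sets N" "\<And>i. g i = emeasure M (A i)" by metis
  define Z where "Z = (\<Union>i. A i)"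
  have Z: "Z \<in> null_sets N" unfolding Z_def using A(1) by (intro null_sets_UN)
  have Zm[measurable]: "Z \<in> sets M" using Z M by auto
  have max: "emeasure M B \<le> emeasure M Z" if "B \<in> null_sets N" for B
  proof -
    have "emeasure M B \<le> Sup ?S" using that by (intro Sup_upper) auto
    also have "\<dots> \<le> emeasure M Z" unfolding g(2) A(2)
      using A(1) M Zm by (intro SUP_least emeasure_mono) (auto simp: Z_def)
    finally show ?thesis .
  qed
  let ?Ma = "density M (indicator (space N - Z))" and ?Ms = "density M (indicator Z)"
  have [simp]: "space M = space N" by (rule sets_eq_imp_space_eq[OF M(2)])
  have cZ: "space N - Z \<in> sets M" using sets.compl_sets[OF Zm] by simp
  have "lebesgue_decomposition N M ?Ma ?Ms"
    unfolding lebesgue_decomposition_def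
  proof (intro conjI ballI)
    show "absolutely_continuous N ?Ma"
      unfolding absolutely_continuous_def
    proof
      fix B assume B: "B \<in> null_sets N"
      then have Bm: "B \<in> sets M" using M by auto
      have "emeasure M Z + emeasure M (B - Z) = emeasure M (B \<union> Z)"
        using plus_emeasure[of Z M "B - Z"] Bm by (simp add: Un_commute)
      also have "\<dots> \<le> emeasure M Z" using B Z by (intro max) auto
      finally have "emeasure M (B - Z) = 0"
        unfolding emeasure_eq_measure ennreal_plus[symmetric, OF measure_nonneg measure_nonneg]
        by (simp add: ennreal_le_iff measure_le_0_iff)
      moreover have "(space N - Z) \<inter> B = B - Z" using sets.sets_into_space[OF Bm] by auto
      ultimately have "emeasure ?Ma B = 0" using emeasure_restricted[OF cZ Bm] by simp
      then show "B \<in> null_sets ?Ma" using Bm by (auto simp: null_sets_def)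
    qed
    show "mutually_singular N ?Ms" unfolding mutually_singular_def
    proof (intro bexI[of _ Z] conjI)
      show "emeasure N Z = 0" "Z \<in> sets N" using Z by auto
      show "emeasure ?Ms (space N - Z) = 0" using emeasure_restricted[OF Zm cZ] by simp
    qed
    fix B assume "B \<in> sets N"
    then have Bm: "B \<in> sets M" using M by simp
    have "(space N - Z) \<inter> B = B - Z" using sets.sets_into_space[OF Bm] by auto
    then have "emeasure ?Ma B = emeasure M (B - Z)" "emeasure ?Ms B = emeasure M (B \<inter> Z)"
      using emeasure_restricted[OF cZ Bm] emeasure_restricted[OF Zm Bm] by (simp_all add: Int_commute)
    then show "emeasure M B = emeasure ?Ma B + emeasure ?Ms B"
      using plus_emeasure[of "B \<inter> Z" M "B - Z"] Bm Zm by (simp add: Int_Diff_Un add.commute Int_Diff inf.absorb_iff1 disjoint_iff)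
  qed (use M in auto)
  then show ?thesis by blast
qed

lemma lebesgue_decomposition_parts:
  assumes "lebesgue_decomposition N M Ma Ms"
  shows "ac_part N M = Ma" "sing_part N M = Ms"
proof -
  show "ac_part N M = Ma" unfolding ac_part_def
  proof (rule the_equality)
    show "\<exists>Ms. lebesgue_decomposition N M Ma Ms" using assms by blast
    fix Ma' assume "\<exists>Ms. lebesgue_decomposition N M Ma' Ms"
    then show "Ma' = Ma" by (elim exE) (rule lebesgue_decomposition_unique(1)[OF _ assms])
  qed
  show "sing_part N M = Ms" unfolding sing_part_def
  proof (rule the_equality)
    show "\<exists>Ma. lebesgue_decomposition N M Ma Ms" using assms by blast
    fix Ms' assume "\<exists>Ma. lebesgue_decomposition N M Ma Ms'"
    then show "Ms' = Ms" by (elim exE) (rule lebesgue_decomposition_unique(2)[OF _ assms])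
  qed
qed

lemma sing_part_absolutely_continuous:
  assumes "absolutely_continuous N M" "sets M = sets N"
  shows "sing_part N M = null_measure N"
proof -
  have "lebesgue_decomposition N M M (null_measure N)"
    unfolding lebesgue_decomposition_def mutually_singular_def
    by (intro conjI bexI[of _ "{}"] ballI) (simp_all add: assms)
  then show ?thesis by (rule lebesgue_decomposition_parts)
qed

lemma ac_part_facts:
  assumes "finite_measure M" "sets M = sets N"
  shows "sets (ac_part N M) = sets N" "absolutely_continuous N (ac_part N M)"
    "\<And>A. A \<in> sets N \<Longrightarrow> emeasure (ac_part N M) A \<le> emeasure M A"
proof -
  obtain Ma Ms where d: "lebesgue_decomposition N M Ma Ms" using lebesgue_decomposition_exists[OF assms] by blast
  show "sets (ac_part N M) = sets N" "absolutely_continuous N (ac_part N M)"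
    "\<And>A. A \<in> sets N \<Longrightarrow> emeasure (ac_part N M) A \<le> emeasure M A"
    unfolding lebesgue_decomposition_parts[OF d] using d by (simp_all add: lebesgue_decomposition_def)
qed

lemma sigma_finite_lborel_strip: "sigma_finite_measure (lborel_strip T)"
  by (rule sigma_finite_measure_restrict_space[OF sigma_finite_lborel]) simp

lemma strip_density_measurable[measurable]: "strip_density T u \<in> borel_measurable (lborel_strip T)"
  unfolding strip_density_def ac_density_def[abs_def]
  by (rule measurable_compose[OF borel_measurable_RN_deriv]) simp

lemma strip_density_nonneg: "0 \<le> strip_density T u z"
  by (simp add: strip_density_def ac_density_def)

lemma density_strip:
  assumes "finite_measure u" "sets u = sets (lborel_strip T)"
  shows "density (lborel_strip T) (RN_deriv (lborel_strip T) (ac_part (lborel_strip T) u)) = ac_part (lborel_strip T) u"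
  by (rule sigma_finite_measure.density_RN_deriv[OF sigma_finite_lborel_strip ac_part_facts(2,1)[OF assms]])

lemma borel_Int_strip: "A \<in> sets borel \<Longrightarrow> A \<inter> strip T \<in> sets (lborel_strip T)"
  unfolding sets_restrict_space by (rule image_eqI[of _ _ A]) auto

lemma space_lborel_strip: "space (lborel_strip T) = strip T" by (simp add: space_restrict_space)

lemma strip_density_integrable:
  assumes u: "finite_measure u" "sets u = sets (lborel_strip T)"
  shows "integrable (lborel_strip T) (strip_density T u)"
proof -
  let ?N = "lborel_strip T" and ?a = "ac_part (lborel_strip T) u"
  have "(\<integral>\<^sup>+z. ennreal (strip_density T u z) \<partial>?N) \<le> (\<integral>\<^sup>+z. RN_deriv ?N ?a z \<partial>?N)"
    unfolding strip_density_def ac_density_def by (intro nn_integral_mono) (simp add: ennreal_enn2real_if)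
  also have "\<dots> = emeasure ?a (space ?N)"
  proof -
    have "emeasure ?a (space ?N) = emeasure (density ?N (RN_deriv ?N ?a)) (space ?N)" by (simp only: density_strip[OF u])
    also have "\<dots> = (\<integral>\<^sup>+z. RN_deriv ?N ?a z * indicator (space ?N) z \<partial>?N)"
      by (rule emeasure_density[OF borel_measurable_RN_deriv sets.top])
    also have "\<dots> = (\<integral>\<^sup>+z. RN_deriv ?N ?a z \<partial>?N)" by (intro nn_integral_cong) simp
    finally show ?thesis by simp
  qed
  also have "\<dots> \<le> emeasure u (space ?N)" by (rule ac_part_facts(3)[OF u sets.top])
  also have "\<dots> < \<infinity>" using finite_measure.emeasure_finite[OF u(1)] by (simp only: top.not_eq_extremum infinity_ennreal_def)
  finally show ?thesis using strip_density_nonneg by (auto simp: integrable_iff_bounded)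
qed

text \<open>On the set where the density exceeds \<open>k + 1/(n+1)\<close> the two bounds for the absolutely continuous part are
compatible only if the set is null. The intersection with a ball makes its measure finite.\<close>

lemma strip_density_bound:
  assumes u: "finite_measure u" "sets u = sets (lborel_strip T)"
    and U: "U \<in> sets borel" and k: "0 \<le> k"
    and le: "\<And>A. A \<in> sets borel \<Longrightarrow> A \<subseteq> U \<inter> strip T \<Longrightarrow> emeasure u A \<le> ennreal k * emeasure lborel A"
  shows "AE z in lborel. z \<in> U \<inter> strip T \<longrightarrow> strip_density T u z \<le> k"
proof -
  let ?N = "lborel_strip T" and ?a = "ac_part (lborel_strip T) u"
  let ?r = "RN_deriv ?N ?a"
  have S: "strip T \<inter> space lborel \<in> sets lborel" by simp
  have z: "AE z in lborel. z \<in> U \<inter> strip T \<longrightarrow> \<not> (ennreal (k + 1 / real (Suc n)) \<le> ?r z \<and> z \<in> cball 0 (real n))" for n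
  proof -
    let ?c = "k + 1 / real (Suc n)"
    define B where "B = {z \<in> space ?N. z \<in> U \<and> ennreal ?c \<le> ?r z \<and> z \<in> cball 0 (real n)}"
    have r: "?r -` {ennreal ?c..} \<inter> space ?N \<in> sets ?N"
      by (rule measurable_sets[OF borel_measurable_RN_deriv]) simp
    have "B = (U \<inter> strip T) \<inter> (cball 0 (real n) \<inter> strip T) \<inter> (?r -` {ennreal ?c..} \<inter> space ?N)"
      by (auto simp: B_def space_lborel_strip)
    then have BN: "B \<in> sets ?N"
      using sets.Int[OF sets.Int[OF borel_Int_strip[OF U] borel_Int_strip[of "cball 0 (real n)"]] r] by simp
    have Bb: "B \<in> sets borel" using BN S by (subst (asm) sets_restrict_space_iff) auto
    have BU: "B \<subseteq> U \<inter> strip T" by (auto simp: B_def space_lborel_strip)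
    have Bfin: "emeasure lborel B < \<infinity>"
      by (rule le_less_trans[OF emeasure_mono[of B "cball 0 (real n)"] emeasure_lborel_cball_finite]) (auto simp: B_def)
    have "ennreal ?c * emeasure lborel B = ennreal ?c * emeasure ?N B"
      using BU Bb by (subst emeasure_restrict_space[OF S]) auto
    also have "\<dots> = (\<integral>\<^sup>+z. ennreal ?c * indicator B z \<partial>?N)" using BN by (simp add: nn_integral_cmult_indicator)
    also have "\<dots> \<le> (\<integral>\<^sup>+z. ?r z * indicator B z \<partial>?N)"
      by (intro nn_integral_mono) (auto simp: indicator_def B_def)
    also have "\<dots> = emeasure ?a B"
      using emeasure_density[OF borel_measurable_RN_deriv[of ?N ?a] BN] by (simp only: density_strip[OF u])
    also have "\<dots> \<le> emeasure u B" by (rule ac_part_facts(3)[OF u BN])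
    also have "\<dots> \<le> ennreal k * emeasure lborel B" by (rule le[OF Bb BU])
    finally have le2: "ennreal ?c * emeasure lborel B \<le> ennreal k * emeasure lborel B" .
    have "emeasure lborel B = 0"
    proof (rule ccontr)
      assume "emeasure lborel B \<noteq> 0"
      moreover obtain b where b: "0 \<le> b" "emeasure lborel B = ennreal b"
        using Bfin by (cases "emeasure lborel B") auto
      ultimately have "0 < b" by (auto simp: less_le)
      moreover have c0: "0 \<le> ?c" using k by simp
      have "?c * b \<le> k * b"
        using le2 b(1) k
        unfolding b(2) ennreal_mult[symmetric, OF c0 b(1)] ennreal_mult[symmetric, OF k b(1)] by (simp add: ennreal_le_iff)
      ultimately show False by (simp add: divide_le_eq)
    qed
    then have "AE z in lborel. z \<notin> B" using Bb by (intro AE_not_in) (auto simp: null_sets_def)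
    then show ?thesis by eventually_elim (auto simp: B_def space_lborel_strip)
  qed
  have "AE z in lborel. \<forall>n. z \<in> U \<inter> strip T \<longrightarrow> \<not> (ennreal (k + 1 / real (Suc n)) \<le> ?r z \<and> z \<in> cball 0 (real n))"
    using z by (simp only: AE_all_countable) blast
  then show ?thesis
  proof eventually_elim
    case (elim z)
    show ?case
    proof (intro impI)
      assume zU: "z \<in> U \<inter> strip T"
      show "strip_density T u z \<le> k"
      proof (rule ccontr)
        assume "\<not> strip_density T u z \<le> k"
        then have g: "k < enn2real (?r z)" by (simp add: strip_density_def ac_density_def)
        then obtain n1 where n1: "1 / real (Suc n1) < enn2real (?r z) - k"
          using nat_approx_posE[of "enn2real (?r z) - k"] by auto
        obtain n2 where n2: "norm z \<le> real n2" using real_arch_simple by blast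
        define n where "n = max n1 n2"
        have "1 / real (Suc n) \<le> 1 / real (Suc n1)" by (intro divide_left_mono) (auto simp: n_def)
        then have "k + 1 / real (Suc n) \<le> enn2real (?r z)" using n1 by linarith
        then have "ennreal (k + 1 / real (Suc n)) \<le> ennreal (enn2real (?r z))" by (rule ennreal_leI)
        also have "\<dots> \<le> ?r z" by (simp add: ennreal_enn2real_if)
        finally show False using elim zU n2 by (auto simp: n_def)
      qed
    qed
  qed
qed


section \<open>Time slices\<close>

text \<open>Product test functions turn the bound for \<open>u\<close> into a bound for the integral over time of the slice integrals against
every nonnegative function of time, hence into a bound at almost every time.\<close>

lemma slice_test_bound:
  assumes sl: "is_time_slicing T u v" and \<tau>: "0 \<le> \<tau>"
    and le: "\<And>\<rho>. \<rho> \<in> Cc (strip T) \<Longrightarrow> (\<And>z. 0 \<le> \<rho> z) \<Longrightarrow> (\<And>z. snd z \<le> \<tau> \<Longrightarrow> \<rho> z = 0) \<Longrightarrow>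
      (LINT z|u. \<rho> z) \<le> k * (LINT z|lborel. \<rho> z)"
    and q: "q \<in> Cc UNIV" "\<And>x. 0 \<le> q x"
  shows "AE t in lebesgue_on {0<..<T}. \<tau> < t \<longrightarrow> (LINT x|v t. q x) \<le> k * (LINT x|lborel. q x)"
proof -
  obtain K where K: "compact K" "\<And>x. x \<notin> K \<Longrightarrow> q x = 0" and qc: "continuous_on UNIV q"
    using q(1) by (auto simp: Cc_def)
  obtain R where R: "\<And>x. x \<in> K \<Longrightarrow> \<bar>x\<bar> \<le> R" using compact_imp_bounded[OF K(1)] bounded_iff by (metis real_norm_def)
  have qi: "integrable lborel q" using Cc_integrable[OF q(1)] .
  have S: "{0<..<T} \<in> sets borel" by simp
  have sl1: "integrable (lebesgue_on {0<..<T}) (\<lambda>t. LINT x|v t. \<zeta> (x, t))"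
    "(LINT z|u. \<zeta> z) = (LINT t|lebesgue_on {0<..<T}. LINT x|v t. \<zeta> (x, t))" if "C0_Cc T \<zeta>" for \<zeta>
    using sl that by (auto simp: is_time_slicing_def)
  have qfst: "continuous_on A (\<lambda>z. q (fst z))" for A :: "(real \<times> real) set"
    by (rule continuous_on_compose2[OF qc]) (auto intro!: continuous_intros)
  have R0: "q x = 0" if "R < \<bar>x\<bar>" for x using R[of x] K(2)[of x] that by fastforce
  have mi: "integrable (lebesgue_on {0<..<T}) (\<lambda>t. LINT x|v t. q x)"
    using sl1(1)[of "\<lambda>z. q (fst z)"] qfst R0 by (auto simp: C0_Cc_def)
  have ci: "integrable (lebesgue_on {0<..<T}) (\<lambda>t. c)" for c :: real
  proof -
    have "integrable lborel (indicator {0<..<T} :: real \<Rightarrow> real)"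
      using emeasure_bounded_finite[of "{0<..<T}"] by (simp add: integrable_indicator_iff)
    then have "integrable lborel (\<lambda>t. indicator {0<..<T} t *\<^sub>R c)" by simp
    then show ?thesis by (subst integrable_restrict_space) (auto simp: integrable_completion)
  qed
  let ?g = "\<lambda>t. (LINT x|v t. q x) - k * (LINT x|lborel. q x)"
  have "AE t in lebesgue_on {0<..<T}. t \<in> {\<tau><..<T} \<longrightarrow> ?g t \<le> 0"
  proof (rule AE_nonpos_of_tests[OF _ S])
    show "integrable (lebesgue_on {0<..<T}) ?g" using mi ci by (rule Bochner_Integration.integrable_diff)
    show "{\<tau><..<T} \<subseteq> {0<..<T}" using \<tau> by auto
    fix \<theta> assume \<theta>: "\<theta> \<in> Cc {\<tau><..<T}" "\<And>t. 0 \<le> \<theta> t"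
    obtain K' where K': "compact K'" "K' \<subseteq> {\<tau><..<T}" "\<And>t. t \<notin> K' \<Longrightarrow> \<theta> t = 0" and \<theta>c: "continuous_on UNIV \<theta>"
      using \<theta>(1) by (auto simp: Cc_def)
    have \<theta>i: "integrable lborel \<theta>" using Cc_integrable[OF \<theta>(1)] .
    define \<zeta> where "\<zeta> z = q (fst z) * \<theta> (snd z)" for z :: "real \<times> real"
    have \<theta>snd: "continuous_on A (\<lambda>z. \<theta> (snd z))" for A :: "(real \<times> real) set"
      by (rule continuous_on_compose2[OF \<theta>c]) (auto intro!: continuous_intros)
    have \<zeta>c: "continuous_on A \<zeta>" for A unfolding \<zeta>_def[abs_def] by (intro continuous_intros qfst \<theta>snd)
    have "C0_Cc T \<zeta>" unfolding C0_Cc_def using \<zeta>c R0 by (auto simp: \<zeta>_def intro!: exI[of _ R])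
    note s2 = sl1[OF this]
    have \<zeta>Cc: "\<zeta> \<in> Cc (strip T)"
      unfolding Cc_def
    proof (intro CollectI conjI exI[of _ "K \<times> K'"] allI impI)
      show "compact (K \<times> K')" using K K' by (intro compact_Times)
      show "K \<times> K' \<subseteq> strip T" using K' \<tau> by (auto simp: strip_def)
      show "\<zeta> z = 0" if "z \<notin> K \<times> K'" for z
        using that K(2)[of "fst z"] K'(3)[of "snd z"] by (cases z) (auto simp: \<zeta>_def)
    qed (rule \<zeta>c)
    have b1: "(LINT z|u. \<zeta> z) \<le> k * (LINT z|lborel. \<zeta> z)"
    proof (rule le[OF \<zeta>Cc])
      show "\<zeta> z = 0" if "snd z \<le> \<tau>" for z using K'(2) K'(3)[of "snd z"] that by (force simp: \<zeta>_def)
    qed (use q \<theta> in \<open>auto simp: \<zeta>_def\<close>)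
    have \<zeta>i: "integrable lborel \<zeta>" using Cc_integrable[OF \<zeta>Cc] .
    have "(LINT z|lborel. \<zeta> z) = (LINT z|(lborel \<Otimes>\<^sub>M lborel). \<zeta> z)" by (simp add: lborel_prod)
    also have "\<dots> = (LINT x|lborel. LINT t|lborel. \<zeta> (x, t))"
      using \<zeta>i by (intro lborel_pair.integral_fst'[symmetric]) (simp add: lborel_prod)
    also have "\<dots> = (LINT x|lborel. q x) * (LINT t|lborel. \<theta> t)" by (simp add: \<zeta>_def)
    finally have b2: "(LINT z|lborel. \<zeta> z) = (LINT x|lborel. q x) * (LINT t|lborel. \<theta> t)" .
    have S': "{0<..<T} \<inter> space lebesgue \<in> sets lebesgue" by simp
    have b3: "(LINT t|lborel. \<theta> t) = (LINT t|lebesgue_on {0<..<T}. \<theta> t)"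
    proof -
      have e: "indicator {0<..<T} t *\<^sub>R \<theta> t = \<theta> t" for t
        using K'(2) K'(3)[of t] \<tau> by (force simp: indicator_def)
      show ?thesis unfolding integral_restrict_space[OF S'] e
        using \<theta>i by (simp add: integral_completion)
    qed
    have b4: "integrable (lebesgue_on {0<..<T}) \<theta>"
    proof -
      have e: "indicator {0<..<T} t *\<^sub>R \<theta> t = \<theta> t" for t
        using K'(2) K'(3)[of t] \<tau> by (force simp: indicator_def)
      show ?thesis unfolding integrable_restrict_space[OF S'] e
        using \<theta>i by (simp add: integrable_completion)
    qed
    have e: "(LINT x|v t. \<zeta> (x, t)) = \<theta> t * (LINT x|v t. q x)" for t by (simp add: \<zeta>_def mult.commute)
    have "(LINT t|lebesgue_on {0<..<T}. \<theta> t * ?g t)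
       = (LINT t|lebesgue_on {0<..<T}. \<theta> t * (LINT x|v t. q x) - (k * (LINT x|lborel. q x)) * \<theta> t)"
      by (simp add: right_diff_distrib mult.commute)
    also have "\<dots> = (LINT z|u. \<zeta> z) - (k * (LINT x|lborel. q x)) * (LINT t|lebesgue_on {0<..<T}. \<theta> t)"
      using s2 b4 by (simp add: e)
    also have "\<dots> \<le> 0" using b1 by (simp add: b2 b3 mult_ac)
    finally show "(LINT t|lebesgue_on {0<..<T}. \<theta> t * ?g t) \<le> 0" .
  qed simp
  moreover have "AE t in lebesgue_on {0<..<T}. t \<in> {0<..<T}" by (simp add: AE_lebesgue_on_iff)
  ultimately show ?thesis by eventually_elim auto
qed

text \<open>The exceptional null set of times must not depend on the test function. Countably many test functions suffice:
the exhaustions of finite unions from a countable basis. Every open set is an increasing union of such finite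
unions.\<close>

lemma slices_absolutely_continuous:
  assumes sl: "is_time_slicing T u v" and \<tau>: "0 \<le> \<tau>" and k: "0 < k"
    and le: "\<And>\<rho>. \<rho> \<in> Cc (strip T) \<Longrightarrow> (\<And>z. 0 \<le> \<rho> z) \<Longrightarrow> (\<And>z. snd z \<le> \<tau> \<Longrightarrow> \<rho> z = 0) \<Longrightarrow>
      (LINT z|u. \<rho> z) \<le> k * (LINT z|lborel. \<rho> z)"
  shows "AE t in lebesgue_on {0<..<T}. \<tau> < t \<longrightarrow> sets (v t) = sets borel \<and> absolutely_continuous lborel (v t)"
proof -
  obtain B :: "real set set" where B: "countable B" "topological_basis B" using ex_countable_basis by blast
  let ?F = "Union ` {F. finite F \<and> F \<subseteq> B}"
  have cF: "countable ?F" by (intro countable_image countable_Collect_finite_subset B)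
  have oF: "open V" if "V \<in> ?F" for V using that topological_basis_open[OF B(2)] by auto
  have "AE t in lebesgue_on {0<..<T}. \<forall>V\<in>?F. \<forall>n. \<tau> < t \<longrightarrow> (LINT x|v t. exhaust V n x) \<le> k * (LINT x|lborel. exhaust V n x)"
  proof (intro AE_ball_countable'[OF _ cF])
    fix V assume "V \<in> ?F"
    show "AE t in lebesgue_on {0<..<T}. \<forall>n. \<tau> < t \<longrightarrow> (LINT x|v t. exhaust V n x) \<le> k * (LINT x|lborel. exhaust V n x)"
      unfolding AE_all_countable
    proof
      fix n
      show "AE t in lebesgue_on {0<..<T}. \<tau> < t \<longrightarrow> (LINT x|v t. exhaust V n x) \<le> k * (LINT x|lborel. exhaust V n x)"
      proof (rule slice_test_bound[OF sl \<tau>])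
        fix \<rho> :: "real \<times> real \<Rightarrow> real"
        assume "\<rho> \<in> Cc (strip T)" "\<And>z. 0 \<le> \<rho> z" "\<And>z. snd z \<le> \<tau> \<Longrightarrow> \<rho> z = 0"
        then show "(LINT z|u. \<rho> z) \<le> k * (LINT z|lborel. \<rho> z)" by (rule le)
      next
        show "exhaust V n \<in> Cc UNIV" using exhaust_Cc[OF oF[OF \<open>V \<in> ?F\<close>], of n] unfolding Cc_def by blast
      qed (rule exhaust_bounds)
    qed
  qed
  moreover have "AE t in lebesgue_on {0<..<T}. finite_borel_measure (v t)" using sl by (simp add: is_time_slicing_def)
  ultimately show ?thesis
  proof eventually_elim
    case (elim t)
    show ?case
    proof
      assume t: "\<tau> < t"
      interpret finite_borel_measure "v t" by (rule elim)
      have sv[simp]: "sets (v t) = sets borel" by (rule M_is_borel)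
      have spv[simp]: "space (v t) = UNIV" using sets_eq_imp_space_eq[OF sv] by simp
      have leF: "emeasure (v t) V \<le> ennreal k * emeasure lborel V" if V: "V \<in> ?F" for V
      proof -
        have "emeasure (v t) (V \<inter> space (v t)) \<le> ennreal k * emeasure lborel V"
        proof (rule emeasure_open_le_from_exhaust[OF finite_measure_axioms _ oF[OF V] _ _ k])
          show "exhaust V n \<in> borel_measurable (v t)" for n
            unfolding measurable_cong_sets[OF sv refl] by (rule borel_measurable_continuous_onI[OF exhaust_continuous])
          show "V \<inter> space (v t) \<in> sets (v t)" using oF[OF V] by simp
        qed (use elim V t in blast)
        then show ?thesis by simp
      qed
      have leO: "emeasure (v t) V \<le> ennreal k * emeasure lborel V" if V: "open V" for V
      proof -
        obtain B' where B': "B' \<subseteq> B" "V = \<Union>B'" using B(2) V unfolding topological_basis_def by metis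
        show ?thesis
        proof (cases "B' = {}")
          case False
          have cB': "countable B'" using B' B countable_subset by blast
          define W where "W n = (\<Union>i\<le>n. from_nat_into B' i)" for n
          have VW: "V = (\<Union>n. W n)"
          proof -
            have "V = (\<Union>i. from_nat_into B' i)" using B'(2) range_from_nat_into[OF False cB'] by simp
            also have "\<dots> = (\<Union>n. W n)" by (auto simp: W_def)
            finally show ?thesis .
          qed
          have WF: "W n \<in> ?F" for n
          proof (rule image_eqI)
            show "W n = \<Union> (from_nat_into B' ` {..n})" by (simp add: W_def)
            show "from_nat_into B' ` {..n} \<in> {F. finite F \<and> F \<subseteq> B}"
              using B'(1) from_nat_into[OF False] by blast
          qed
          have Wo: "W n \<in> sets borel" for n using oF[OF WF] by simp
          have inc: "incseq W" unfolding incseq_def W_def by (intro allI impI UN_mono) auto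
          have "emeasure (v t) V = (SUP n. emeasure (v t) (W n))"
            unfolding VW using Wo inc by (intro SUP_emeasure_incseq[symmetric]) auto
          also have "\<dots> \<le> ennreal k * emeasure lborel V"
          proof (rule SUP_least)
            fix n
            have "emeasure (v t) (W n) \<le> ennreal k * emeasure lborel (W n)" by (rule leF[OF WF])
            also have "\<dots> \<le> ennreal k * emeasure lborel V"
              using V VW by (intro mult_left_mono emeasure_mono) auto
            finally show "emeasure (v t) (W n) \<le> ennreal k * emeasure lborel V" .
          qed
          finally show ?thesis .
        qed (simp add: B')
      qed
      have "absolutely_continuous lborel (v t)"
        unfolding absolutely_continuous_def
      proof
        fix N assume N: "N \<in> null_sets (lborel :: real measure)"
        have "emeasure (v t) N \<le> ennreal k * emeasure lborel N"
          by (rule emeasure_le_of_open[where U=UNIV]) (use leO N in auto)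
        then show "N \<in> null_sets (v t)" using N by (auto simp: null_sets_def)
      qed
      then show "sets (v t) = sets borel \<and> absolutely_continuous lborel (v t)" by simp
    qed
  qed
qed


section \<open>The power flux\<close>

lemma flux_slope:
  assumes "p < 1" "p \<noteq> 0"
  shows "slope_at_infinity (flux p) = 0"
proof -
  have "((\<lambda>u. flux p u / u) \<longlongrightarrow> 0) at_top"
  proof (cases "p > 0")
    case True then show ?thesis using assms unfolding flux_def by real_asymp
  next
    case False then have "p < 0" using assms by simp
    then show ?thesis using assms unfolding flux_def by real_asymp
  qed
  then show ?thesis unfolding slope_at_infinity_def by (rule tendsto_Lim[rotated]) simp
qed

lemma flux_bounded_neg:
  assumes "p < 0" "0 \<le> s" shows "0 \<le> flux p s" "flux p s \<le> 1"
proof -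
  have "(1 + s) powr p \<le> 1 powr p" using assms by (intro powr_mono2') auto
  then show "0 \<le> flux p s" "flux p s \<le> 1" using assms by (auto simp: flux_def)
qed

lemma flux_unbounded_pos:
  assumes "0 < p" shows "\<not> bounded (flux p ` {0..})"
proof
  assume "bounded (flux p ` {0..})"
  then obtain C where C: "\<And>s. 0 \<le> s \<Longrightarrow> \<bar>flux p s\<bar> \<le> C" by (auto simp: bounded_iff)
  define y where "y = \<bar>C\<bar> + 2"
  have y: "1 \<le> y powr (1 / p)" using assms by (intro ge_one_powr_ge_zero) (auto simp: y_def)
  then have "flux p (y powr (1 / p) - 1) = y - 1" using assms by (simp add: flux_def powr_powr y_def)
  then show False using C[of "y powr (1 / p) - 1"] y by (simp add: y_def)
qed

lemma flux_bounded_iff: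
  assumes "p < 1" "p \<noteq> 0"
  shows "bounded ((\<lambda>s. flux p s - slope_at_infinity (flux p) * s) ` {0..}) \<longleftrightarrow> p < 0"
proof (cases "p < 0")
  case True
  then have "bounded (flux p ` {0..})" using flux_bounded_neg by (intro boundedI[of _ 1]) auto
  then show ?thesis using True by (simp add: flux_slope[OF assms])
next
  case False
  then show ?thesis using flux_unbounded_pos[of p] assms by (simp add: flux_slope[OF assms])
qed

lemma concave_flux_power:
  assumes p: "0 < p" "p < 1"
  shows "concave_flux (flux p) (\<lambda>s. p * (1 + s) powr (p - 1))"
proof
  have d: "(flux p has_real_derivative p * (1 + s) powr (p - 1)) (at s)" if "0 \<le> s" for s
    unfolding flux_def using that p by (auto intro!: derivative_eq_intros simp: powr_diff)
  then show "\<And>s. 0 \<le> s \<Longrightarrow> (flux p has_real_derivative p * (1 + s) powr (p - 1)) (at s)" .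
  show "flux p 0 = 0" by (simp add: flux_def)
  show "\<And>s. 0 \<le> s \<Longrightarrow> 0 \<le> p * (1 + s) powr (p - 1)" using p by simp
  have anti: "p * (1 + b) powr (p - 1) \<le> p * (1 + a) powr (p - 1)" if "0 \<le> a" "a \<le> b" for a b
    using that p by (intro mult_left_mono powr_mono2') auto
  fix a b :: real assume ab: "0 \<le> a" "0 \<le> b"
  consider "a < b" | "a = b" | "b < a" by linarith
  then show "flux p b \<le> flux p a + p * (1 + a) powr (p - 1) * (b - a)"
  proof cases
    case 1
    then obtain c where c: "a < c" "c < b" "flux p b - flux p a = (b - a) * (p * (1 + c) powr (p - 1))"
      using MVT2[of a b "flux p" "\<lambda>s. p * (1 + s) powr (p - 1)"] d ab by auto
    then have "(b - a) * (p * (1 + c) powr (p - 1)) \<le> (b - a) * (p * (1 + a) powr (p - 1))"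
      using ab 1 by (intro mult_left_mono anti) auto
    then have "flux p b - flux p a \<le> (b - a) * (p * (1 + a) powr (p - 1))" unfolding c(3) .
    then show ?thesis by (simp add: algebra_simps)
  next
    case 3
    then obtain c where c: "b < c" "c < a" "flux p a - flux p b = (a - b) * (p * (1 + c) powr (p - 1))"
      using MVT2[of b a "flux p" "\<lambda>s. p * (1 + s) powr (p - 1)"] d ab by auto
    then have "(a - b) * (p * (1 + a) powr (p - 1)) \<le> (a - b) * (p * (1 + c) powr (p - 1))"
      using ab 3 by (intro mult_left_mono anti) auto
    then have "(a - b) * (p * (1 + a) powr (p - 1)) \<le> flux p a - flux p b" unfolding c(3) .
    then show ?thesis by (simp add: algebra_simps)
  qed simp
qed

text \<open>The quantity \<open>\<phi>(k) - k\<phi>'(k)\<close> is the intercept of the tangent at \<open>k\<close>. It is at least \<open>(1-p)(1+k)^p - 1\<close>, which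
tends to infinity. The witness solves \<open>(1+k)^p = y\<close>.\<close>

lemma flux_gap_unbounded:
  assumes p: "0 < p" "p < 1" and \<tau>: "0 < \<tau>" and C: "0 \<le> C"
  shows "\<exists>k>0. C \<le> \<tau> * (flux p k - k * (p * (1 + k) powr (p - 1)))"
proof -
  define y where "y = (C / \<tau> + 1) / (1 - p) + 1"
  have y: "1 < y" using assms by (simp add: y_def add_nonneg_pos)
  define k where "k = y powr (1 / p) - 1"
  have k: "0 < k" using y p gr_one_powr[of y "1 / p"] by (simp add: k_def)
  have kp: "(1 + k) powr p = y" using y p by (simp add: k_def powr_powr)
  have "k * (p * (1 + k) powr (p - 1)) = p * (k / (1 + k)) * y"
    using k by (simp add: powr_diff kp)
  also have "\<dots> \<le> p * 1 * y" using k p y by (intro mult_right_mono mult_left_mono) auto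
  finally have "(1 - p) * y - 1 \<le> flux p k - k * (p * (1 + k) powr (p - 1))"
    using p by (simp add: flux_def kp algebra_simps)
  moreover have "(1 - p) * ((C / \<tau> + 1) / (1 - p)) = C / \<tau> + 1" using p by simp
  then have "C / \<tau> \<le> (1 - p) * y - 1" unfolding y_def distrib_left using p by simp
  ultimately have "C / \<tau> \<le> flux p k - k * (p * (1 + k) powr (p - 1))" by linarith
  then show ?thesis using k \<tau> by (intro exI[of _ k]) (simp add: divide_le_eq mult.commute)
qed

lemma product_integrable:
  fixes a b :: "real \<Rightarrow> real"
  assumes a: "integrable lborel a" and b: "integrable lborel b"
  shows "integrable lborel (\<lambda>z. a (fst z) * b (snd z))"
    and "(LINT z|lborel. a (fst z) * b (snd z)) = (LINT x|lborel. a x) * (LINT t|lborel. b t)"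
proof -
  have [measurable]: "a \<in> borel_measurable borel" "b \<in> borel_measurable borel" using a b by auto
  have i: "integrable (lborel \<Otimes>\<^sub>M lborel) (\<lambda>z. a (fst z) * b (snd z))"
    by (rule lborel_pair.Fubini_integrable) (use a b in \<open>auto simp: abs_mult\<close>)
  then show "integrable lborel (\<lambda>z. a (fst z) * b (snd z))" by (simp add: lborel_prod)
  show "(LINT z|lborel. a (fst z) * b (snd z)) = (LINT x|lborel. a x) * (LINT t|lborel. b t)"
    using lborel_pair.integral_fst'[OF i] by (simp add: lborel_prod)
qed


section \<open>Unbounded flux: regularity after every positive time\<close>

lemma sing_part_sets:
  assumes "finite_measure M" "sets M = sets N"
  shows "sets (sing_part N M) = sets N"
proof -
  obtain Ma Ms where d: "lebesgue_decomposition N M Ma Ms" using lebesgue_decomposition_exists[OF assms] by blast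
  show ?thesis unfolding lebesgue_decomposition_parts[OF d] using d by (simp add: lebesgue_decomposition_def)
qed

lemma Linf_measures_facts:
  assumes "Linf_measures T u"
  shows "finite_measure u" "sets u = sets (lborel_strip T)" "is_time_slicing T u (slice T u)"
proof -
  show "finite_measure u" "sets u = sets (lborel_strip T)" using assms by (auto simp: Linf_measures_def)
  obtain v where "is_time_slicing T u v" using assms by (auto simp: Linf_measures_def)
  then show "is_time_slicing T u (slice T u)" unfolding slice_def by (rule someI[of "is_time_slicing T u"])
qed

abbreviation "regular_slice T u t \<equiv> emeasure (slice_s T u t) UNIV = 0 \<and> Linf lebesgue (\<lambda>x. strip_density T u (x, t))"

text \<open>The bound \<open>k\<close> is common to all approximating solutions, since their masses are at most \<open>m\<close>.\<close>

lemma regular_after_positive_time: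
  assumes "0 < T" and sol: "constructed_entropy_solution T \<phi> u0 u" and mass: "measure u0 (space u0) \<le> m" "0 \<le> m"
    and fl: "concave_flux \<phi> \<phi>'" and \<tau>: "0 < \<tau>" and k: "0 < k" "m + 1 \<le> \<tau> * (\<phi> k - k * \<phi>' k)"
  shows "AE t in lebesgue_on {\<tau><..<T}. regular_slice T u t"
proof -
  have "Linf_measures T u" using sol by (simp add: constructed_entropy_solution_def entropy_solution_def solution_def)
  note u = Linf_measures_facts[OF this]
  obtain w0 w r where w0: "approximating_data u0 w0" and w: "\<And>n. kruzkov_solution T \<phi> (w0 n) (w n)"
    and lim: "weak_star_conv (strip T) (\<lambda>n. w (r n)) u"
    using sol by (auto simp: constructed_entropy_solution_def)
  have bound: "AE z in lebesgue_on (strip T). \<tau> < snd z \<longrightarrow> w n z \<le> k" for n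
  proof (rule concave_flux.kruzkov_regularizing_bound[OF fl w \<open>0 < T\<close> _ _ _ \<tau> mass(2) k])
    show i: "integrable lebesgue (w0 n)" and nn: "AE x in lebesgue. 0 \<le> w0 n x"
      using w0 by (auto simp: approximating_data_def)
    have "(LINT x|lebesgue. w0 n x) \<le> (LINT x|lebesgue. \<bar>w0 n x\<bar>)"
      using i by (intro integral_mono) auto
    also have "\<dots> \<le> measure u0 (space u0)" using w0 by (auto simp: approximating_data_def)
    finally show "(LINT x|lebesgue. w0 n x) \<le> m" using mass by simp
  qed
  have test: "(LINT z|u. \<rho> z) \<le> k * (LINT z|lborel. \<rho> z)"
    if "\<rho> \<in> Cc (strip T)" "\<And>z. 0 \<le> \<rho> z" "\<And>z. snd z \<le> \<tau> \<Longrightarrow> \<rho> z = 0" for \<rho>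
  proof (rule weak_limit_integral_le[OF lim strip_borel, where U="{z. \<tau> < snd z}"])
    show "AE z in lebesgue_on (strip T). z \<in> {z. \<tau> < snd z} \<longrightarrow> w (r n) z \<le> k" for n
      unfolding mem_Collect_eq by (rule bound)
    show "0 \<le> k" using k by simp
    show "\<rho> z = 0" if "z \<notin> {z. \<tau> < snd z}" for z
      using that \<open>\<And>z. snd z \<le> \<tau> \<Longrightarrow> \<rho> z = 0\<close>[of z] by (simp add: not_less)
  qed (use that in simp_all)
  have slices: "AE t in lborel. t \<in> {0<..<T} \<longrightarrow> \<tau> < t \<longrightarrow> sets (slice T u t) = sets borel \<and> absolutely_continuous lborel (slice T u t)"
  proof -
    have "AE t in lebesgue_on {0<..<T}. \<tau> < t \<longrightarrow> sets (slice T u t) = sets borel \<and> absolutely_continuous lborel (slice T u t)"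
    proof (rule slices_absolutely_continuous[OF u(3) less_imp_le[OF \<tau>] k(1)])
      fix \<rho> :: "real \<times> real \<Rightarrow> real"
      assume "\<rho> \<in> Cc (strip T)" "\<And>z. 0 \<le> \<rho> z" "\<And>z. snd z \<le> \<tau> \<Longrightarrow> \<rho> z = 0"
      then show "(LINT z|u. \<rho> z) \<le> k * (LINT z|lborel. \<rho> z)" by (rule test)
    qed
    then show ?thesis by (subst (asm) AE_lebesgue_on_iff) auto
  qed
  define U where "U = {z::real\<times>real. \<tau> < snd z}"
  have oU: "open U" unfolding U_def by (intro open_Collect_less continuous_intros)
  have Ub: "U \<in> sets borel" using oU by simp
  have sp: "space u = strip T" using sets_eq_imp_space_eq[OF u(2)] by (simp add: space_lborel_strip)
  have us: "V \<in> sets u" if "V \<in> sets borel" "V \<subseteq> strip T" for V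
    using borel_Int_strip[OF that(1), of T] that(2) u(2) by (simp add: inf.absorb1)
  have ule: "emeasure u A \<le> ennreal k * emeasure lborel A" if A: "A \<in> sets borel" "A \<subseteq> U \<inter> strip T" for A
  proof (rule emeasure_le_of_open[OF _ open_Int[OF oU open_strip] _ A])
    show "V \<in> sets u" if "V \<in> sets borel" "V \<subseteq> U \<inter> strip T" for V using us[of V] that by auto
    fix V assume V: "open V" "V \<subseteq> U \<inter> strip T"
    have Vs: "V \<inter> space u = V" using V sp by auto
    have "emeasure u (V \<inter> space u) \<le> ennreal k * emeasure lborel V"
    proof (rule emeasure_open_le_from_exhaust[OF u(1) _ V(1) _ _ k(1)])
      show "exhaust V n \<in> borel_measurable u" for n
        unfolding measurable_cong_sets[OF u(2) refl]
        by (intro measurable_restrict_space1) (simp add: borel_measurable_continuous_onI[OF exhaust_continuous])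
      show "V \<inter> space u \<in> sets u" unfolding Vs using us[of V] V by auto
      show "(LINT z|u. exhaust V n z) \<le> k * (LINT z|lborel. exhaust V n z)" for n
      proof (rule test)
        show "exhaust V n \<in> Cc (strip T)" using exhaust_Cc[OF V(1), of n] V(2) unfolding Cc_def by blast
        show "exhaust V n z = 0" if "snd z \<le> \<tau>" for z using that V(2) by (intro exhaust_off) (auto simp: U_def)
      qed (rule exhaust_bounds)
    qed
    then show "emeasure u V \<le> ennreal k * emeasure lborel V" by (simp add: Vs)
  qed
  have "AE z in lborel. z \<in> U \<inter> strip T \<longrightarrow> strip_density T u z \<le> k"
    using k by (intro strip_density_bound[OF u(1,2) Ub _ ule]) auto
  note dens = AE_lborel_sections[OF this]
  have "strip T \<inter> space lborel \<in> sets lborel" by simp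
  then have "(\<lambda>z. indicator (strip T) z *\<^sub>R strip_density T u z) \<in> borel_measurable lborel"
    using strip_density_measurable[of T u] by (subst (asm) borel_measurable_restrict_space_iff)
  then have sd[measurable]: "(\<lambda>z. indicator (strip T) z *\<^sub>R strip_density T u z) \<in> borel_measurable (borel :: (real \<times> real) measure)" by simp
  have sec: "(\<lambda>x. strip_density T u (x, t)) \<in> borel_measurable lebesgue" if "t \<in> {0<..<T}" for t
  proof -
    have "(\<lambda>x. (x, t)) \<in> borel \<rightarrow>\<^sub>M (borel :: (real \<times> real) measure)"
      by (intro borel_measurable_continuous_onI continuous_intros)
    from measurable_compose[OF this sd]
    have "(\<lambda>x. strip_density T u (x, t)) \<in> borel_measurable borel" using that by (simp add: strip_def)
    then show ?thesis by (intro measurable_completion) simp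
  qed
  have "AE t in lborel. t \<in> {\<tau><..<T} \<longrightarrow> regular_slice T u t"
    using slices dens
  proof eventually_elim
    case (elim t)
    show ?case
    proof
      assume t: "t \<in> {\<tau><..<T}"
      then have t': "t \<in> {0<..<T}" using \<tau> by auto
      have "sing_part lborel (slice T u t) = null_measure lborel"
        using elim(1) t t' by (intro sing_part_absolutely_continuous) auto
      then have "emeasure (slice_s T u t) UNIV = 0" by (simp add: slice_s_def)
      moreover have "AE x in lborel. \<bar>strip_density T u (x, t)\<bar> \<le> k"
        using elim(2)
      proof eventually_elim
        case (elim x)
        then show ?case using t t' strip_density_nonneg[of T u "(x, t)"] by (auto simp: U_def strip_def)
      qed
      then have "AE x in lebesgue. \<bar>strip_density T u (x, t)\<bar> \<le> k" by (rule AE_completion)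
      then have "Linf lebesgue (\<lambda>x. strip_density T u (x, t))" using sec[OF t'] by (auto simp: Linf_def)
      ultimately show "regular_slice T u t" ..
    qed
  qed
  then show ?thesis by (subst AE_lebesgue_on_iff) auto
qed

lemma waiting_time_eq_0:
  assumes "0 < T" and reg: "\<And>\<tau>. 0 < \<tau> \<Longrightarrow> \<tau> < T \<Longrightarrow> AE t in lebesgue_on {\<tau><..<T}.
      regular_slice T u t"
  shows "waiting_time T u \<le> 0"
proof (rule field_le_epsilon)
  fix e :: real assume e: "0 < e"
  define \<tau> where "\<tau> = min e (T / 2)"
  have \<tau>: "0 < \<tau>" "\<tau> < T" using e assms(1) by (auto simp: \<tau>_def)
  have "\<tau> \<in> {\<tau>\<in>{0<..T}. AE t in lebesgue_on {\<tau><..<T}.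
            regular_slice T u t}"
    using reg[OF \<tau>] \<tau> by simp
  then have "waiting_time T u \<le> \<tau>" unfolding waiting_time_def
    by (intro cInf_lower bdd_belowI[of _ 0]) auto
  then show "waiting_time T u \<le> 0 + e" by (simp add: \<tau>_def)
qed


section \<open>Bounded flux: survival of the atom\<close>

text \<open>A test function of height one at the origin that increases on \<open>[-h,0]\<close> and decreases on \<open>[0,h]\<close>, so that only the
right half of its derivative counts against the flux.\<close>

definition spike :: "real \<Rightarrow> real \<Rightarrow> real" where
  "spike h x = smoothstep ((h + x) / h) * smoothstep ((h - x) / h)"
definition spike' :: "real \<Rightarrow> real \<Rightarrow> real" where
  "spike' h x = bump h (h + x) * smoothstep ((h - x) / h) - smoothstep ((h + x) / h) * bump h (h - x)"

lemma spike_deriv: assumes "0 < h" shows "(spike h has_real_derivative spike' h x) (at x)"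
proof -
  have "((\<lambda>x. smoothstep ((h + x) / h)) has_real_derivative bump h (h + x) * 1) (at x)"
    using assms by (intro DERIV_chain2[of "\<lambda>z. smoothstep (z / h)"] smoothstep_scaled_deriv) (auto intro!: derivative_eq_intros)
  moreover have "((\<lambda>x. smoothstep ((h - x) / h)) has_real_derivative bump h (h - x) * -1) (at x)"
    using assms by (intro DERIV_chain2[of "\<lambda>z. smoothstep (z / h)"] smoothstep_scaled_deriv) (auto intro!: derivative_eq_intros)
  ultimately show ?thesis unfolding spike_def[abs_def] spike'_def by (auto intro!: derivative_eq_intros)
qed

lemma spike'_continuous: assumes "0 < h" shows "continuous_on UNIV (spike' h)"
  unfolding spike'_def[abs_def] using assms by (intro continuous_intros) auto

lemma spike_continuous: assumes "0 < h" shows "continuous_on UNIV (spike h)"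
  unfolding spike_def[abs_def] using assms by (intro continuous_intros) auto

lemma spike_bounds: "0 \<le> spike h x" "spike h x \<le> 1"
  using smoothstep_bounds by (auto simp: spike_def intro: mult_le_one)

lemma spike_eq_0: "0 < h \<Longrightarrow> h \<le> \<bar>x\<bar> \<Longrightarrow> spike h x = 0"
  by (cases "0 \<le> x") (auto simp: spike_def divide_nonpos_pos)

lemma spike_at_0: "0 < h \<Longrightarrow> spike h 0 = 1" by (simp add: spike_def)

lemma spike'_bounds: assumes "0 < h"
  shows "- bump h (h - x) \<le> spike' h x" "\<bar>spike' h x\<bar> \<le> bump h (h + x) + bump h (h - x)"
proof -
  have a: "0 \<le> bump h (h + x) * smoothstep ((h - x) / h)" "bump h (h + x) * smoothstep ((h - x) / h) \<le> bump h (h + x)"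
    using smoothstep_bounds bump_bounds(1)[OF assms] by (simp_all add: mult_left_le)
  have b: "0 \<le> smoothstep ((h + x) / h) * bump h (h - x)" "smoothstep ((h + x) / h) * bump h (h - x) \<le> bump h (h - x)"
    using smoothstep_bounds bump_bounds(1)[OF assms] by (simp_all add: mult_left_le_one_le)
  show "- bump h (h - x) \<le> spike' h x" "\<bar>spike' h x\<bar> \<le> bump h (h + x) + bump h (h - x)"
    using a b unfolding spike'_def by linarith+
qed

lemma bump_reflect_integral: assumes "0 < h"
  shows "has_bochner_integral lborel (\<lambda>x. bump h (h - x)) 1" "has_bochner_integral lborel (\<lambda>x. bump h (h + x)) 1"
  using lborel_has_bochner_integral_real_affine_iff[of "-1" "bump h" 1 h]
    lborel_has_bochner_integral_real_affine_iff[of 1 "bump h" 1 h] bump_integral[OF assms] by simp_all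

text \<open>Equal to one up to time \<open>1/2\<close> and to zero from time \<open>3/4\<close> on.\<close>

definition turn_off :: "real \<Rightarrow> real" where "turn_off t = smoothstep (3 - 4 * t)"
definition turn_off' :: "real \<Rightarrow> real" where "turn_off' t = - 4 * smoothstep' (3 - 4 * t)"

lemma turn_off_deriv: "(turn_off has_real_derivative turn_off' t) (at t)"
  unfolding turn_off_def[abs_def] turn_off'_def
  by (rule DERIV_cong[OF DERIV_chain2[OF smoothstep_deriv]]) (auto intro!: derivative_eq_intros)

lemma turn_off_continuous: "continuous_on UNIV turn_off" "continuous_on UNIV turn_off'"
  unfolding turn_off_def[abs_def] turn_off'_def[abs_def] by (intro continuous_intros)+

text \<open>Suppose that the singular part vanishes after some \<open>\<tau> < 1/2\<close>. In the weak formulation with the test function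
\<open>spike h\<close> times \<open>turn_off\<close> the singular term vanishes, because \<open>turn_off\<close> is constant up to \<open>\<tau>\<close>. The right-hand
side is \<open>-1\<close>, the flux term is at least \<open>-3/4\<close>, since \<open>\<phi> \<le> 1\<close>, the spike descends by one only and \<open>turn_off\<close> has an integral of at
most \<open>3/4\<close> over positive times, and the regular term tends to zero with \<open>h\<close>.\<close>

lemma atom_survives:
  assumes T: "1 < T" and sol: "solution T \<phi> (return borel 0) u"
    and m[measurable]: "\<phi> \<in> borel_measurable borel" and \<phi>: "\<phi> 0 = 0" "\<And>s. 0 \<le> s \<Longrightarrow> 0 \<le> \<phi> s" "\<And>s. 0 \<le> s \<Longrightarrow> \<phi> s \<le> 1"
    and slope: "slope_at_infinity \<phi> = 0"
    and null: "AE t in lebesgue_on {\<tau><..<T}. emeasure (slice_s T u t) UNIV = 0"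
  shows "1 / 2 \<le> \<tau>"
proof (rule ccontr)
  assume "\<not> 1 / 2 \<le> \<tau>"
  then have \<tau>: "\<tau> < 1 / 2" by simp
  have "Linf_measures T u" using sol by (simp add: solution_def)
  note u = Linf_measures_facts[OF this]
  define r where "r z = indicator (strip T) z *\<^sub>R strip_density T u z" for z
  have S: "strip T \<inter> space lborel \<in> sets lborel" "strip T \<inter> space lebesgue \<in> sets lebesgue" by simp_all
  have ri: "integrable lborel r"
    using strip_density_integrable[OF u(1,2)] unfolding r_def[abs_def] integrable_restrict_space[OF S(1)] .
  then have [measurable]: "r \<in> borel_measurable borel" by auto
  have r0: "0 \<le> r z" for z using strip_density_nonneg by (simp add: r_def)
  have [measurable]: "spike h \<in> borel_measurable borel" "spike' h \<in> borel_measurable borel" if "0 < h" for h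
    using that by (auto intro: borel_measurable_continuous_onI spike_continuous spike'_continuous)
  have [measurable]: "turn_off \<in> borel_measurable borel" "turn_off' \<in> borel_measurable borel"
    by (auto intro: borel_measurable_continuous_onI turn_off_continuous)
  define \<theta> where "\<theta> t = indicator {0<..<T} t * turn_off t" for t
  have \<theta>b: "0 \<le> \<theta> t" "\<theta> t \<le> indicator {0..3/4} t" for t
    using smoothstep_bounds[of "3 - 4 * t"] by (auto simp: \<theta>_def turn_off_def indicator_def)
  have [measurable]: "\<theta> \<in> borel_measurable borel" unfolding \<theta>_def[abs_def] by measurable
  have \<theta>i: "integrable lborel \<theta>"
    by (rule Bochner_Integration.integrable_bound[where f="indicator {0..3/4}"]) (use \<theta>b in \<open>auto intro!: AE_I2 simp: integrable_indicator_iff\<close>)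
  have \<theta>1: "(LINT t|lborel. \<theta> t) \<le> 3 / 4"
  proof -
    have "(LINT t|lborel. \<theta> t) \<le> (LINT t|lborel. indicator {0..3/4} (t::real))"
      by (intro integral_mono \<theta>i \<theta>b) (simp add: integrable_indicator_iff)
    then show ?thesis by simp
  qed
  \<comment> \<open>The derivative of \<open>turn_off\<close> is bounded by \<open>8\<close>, so that \<open>8\<close> times the integral is at least \<open>1 - 3/4\<close>.\<close>
  have main: "1 / 32 \<le> (LINT z|lborel. r z * spike h (fst z))" if h: "0 < h" for h
  proof -
    note [measurable] = \<open>0 < h\<close>[THEN \<open>\<And>h. 0 < h \<Longrightarrow> spike h \<in> borel_measurable borel\<close>]
      \<open>0 < h\<close>[THEN \<open>\<And>h. 0 < h \<Longrightarrow> spike' h \<in> borel_measurable borel\<close>]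
    note C = mixed_C1_prod[OF spike_deriv[OF h] turn_off_deriv spike'_continuous[OF h] turn_off_continuous(2)]
    define \<zeta>t where "\<zeta>t z = spike h (fst z) * turn_off' (snd z)" for z :: "real \<times> real"
    define \<zeta>x where "\<zeta>x z = spike' h (fst z) * turn_off (snd z)" for z :: "real \<times> real"
    have [measurable]: "\<zeta>t \<in> borel_measurable borel" "\<zeta>x \<in> borel_measurable borel"
      unfolding \<zeta>t_def[abs_def] \<zeta>x_def[abs_def] by measurable
    have C1: "C1_C1c T (\<lambda>z. spike h (fst z) * turn_off (snd z)) \<zeta>t \<zeta>x"
      unfolding \<zeta>t_def[abs_def] \<zeta>x_def[abs_def]
      by (rule mixed_C1_imp_C1_C1c[OF C, where R=h]) (use T h in \<open>auto simp: spike_eq_0\<close>)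
    then have test: "test_function T (\<lambda>z. spike h (fst z) * turn_off (snd z)) \<zeta>t \<zeta>x"
      using T by (simp add: test_function_def turn_off_def)
    have eq: "(LINT z|lebesgue_on (strip T). strip_density T u z * \<zeta>t z + \<phi> (strip_density T u z) * \<zeta>x z)
        + (LINT t|lebesgue_on {0<..<T}. LINT x|slice_s T u t. \<zeta>t (x, t) + slope_at_infinity \<phi> * \<zeta>x (x, t))
        = - (LINT x|return borel 0. spike h x * turn_off 0)"
    proof -
      have "\<forall>\<zeta> \<zeta>t \<zeta>x. test_function T \<zeta> \<zeta>t \<zeta>x \<longrightarrow>
        (LINT z|lebesgue_on (strip T). strip_density T u z * \<zeta>t z + \<phi> (strip_density T u z) * \<zeta>x z)
        + (LINT t|lebesgue_on {0<..<T}. LINT x|slice_s T u t. \<zeta>t (x, t) + slope_at_infinity \<phi> * \<zeta>x (x, t))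
        = - (LINT x|return borel 0. \<zeta> (x, 0))"
        using sol unfolding solution_def by (rule conjunct2)
      from this[rule_format, OF test] show ?thesis by simp
    qed
    have one: "(LINT x|return borel 0. spike h x * turn_off 0) = 1"
      using h by (subst integral_return) (auto simp: spike_at_0 turn_off_def)
    let ?s = "\<lambda>t. LINT x|slice_s T u t. \<zeta>t (x, t) + slope_at_infinity \<phi> * \<zeta>x (x, t)"
    have sing0: "(LINT t|lebesgue_on {0<..<T}. ?s t) = 0"
    proof (rule integral_eq_zero_AE)
      have "AE t in lborel. t \<in> {0<..<T} \<longrightarrow> finite_borel_measure (slice T u t)"
        using u(3) AE_lebesgue_on_iff[of "{0<..<T}"] by (simp add: is_time_slicing_def)
      moreover have "AE t in lborel. t \<in> {\<tau><..<T} \<longrightarrow> emeasure (slice_s T u t) UNIV = 0"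
        using null AE_lebesgue_on_iff[of "{\<tau><..<T}"] by simp
      ultimately have "AE t in lborel. t \<in> {0<..<T} \<longrightarrow> ?s t = 0"
      proof eventually_elim
        case (elim t)
        show ?case
        proof
          assume t: "t \<in> {0<..<T}"
          show "?s t = 0"
          proof (cases "t \<le> \<tau>")
            case True
            then show ?thesis using \<tau> by (simp add: slope \<zeta>t_def turn_off'_def)
          next
            case False
            interpret finite_borel_measure "slice T u t" using elim(1) t by simp
            have s: "sets (slice_s T u t) = sets borel" unfolding slice_s_def
              using sing_part_sets[OF finite_measure_axioms, of lborel] M_is_borel by simp
            have "UNIV \<in> null_sets (slice_s T u t)" using elim(2) False t s by (simp add: null_sets_def)
            then have "AE x in slice_s T u t. x \<notin> UNIV" by (rule AE_not_in)
            then show ?thesis by (intro integral_eq_zero_AE) auto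
          qed
        qed
      qed
      then show "AE t in lebesgue_on {0<..<T}. ?s t = 0"
        by (simp add: AE_lebesgue_on_iff)
    qed
    let ?I = "\<lambda>z. r z * \<zeta>t z + \<phi> (r z) * \<zeta>x z"
    have Im: "?I \<in> borel_measurable borel" by measurable
    have "(LINT z|lebesgue_on (strip T). strip_density T u z * \<zeta>t z + \<phi> (strip_density T u z) * \<zeta>x z) = (LINT z|lebesgue. ?I z)"
      unfolding integral_restrict_space[OF S(2)]
      by (intro Bochner_Integration.integral_cong) (auto simp: r_def indicator_def \<phi>)
    also have "\<dots> = (LINT z|lborel. ?I z)" using Im by (intro integral_completion) simp
    finally have I: "(LINT z|lborel. ?I z) = - 1" using eq one sing0 by simp
    have rs: "integrable lborel (\<lambda>z. r z * spike h (fst z))"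
    proof (rule bounded_mult_integrable[OF ri, where C=1])
      have "(\<lambda>z::real\<times>real. spike h (fst z)) \<in> borel_measurable borel" by measurable
      then show "(\<lambda>z::real\<times>real. spike h (fst z)) \<in> borel_measurable lborel" by simp
    qed (use spike_bounds[of h] in simp)
    have pi: "integrable lborel (\<lambda>z. bump h (h - fst z) * \<theta> (snd z))" "(LINT z|lborel. bump h (h - fst z) * \<theta> (snd z)) = (LINT t|lborel. \<theta> t)"
      "integrable lborel (\<lambda>z. bump h (h + fst z) * \<theta> (snd z))"
      using product_integrable[OF _ \<theta>i, of "\<lambda>x. bump h (h - x)"] product_integrable[OF _ \<theta>i, of "\<lambda>x. bump h (h + x)"] bump_reflect_integral[OF h]
      by (simp_all add: has_bochner_integral_iff)
    have rz: "r z = 0" if "z \<notin> strip T" for z using that by (simp add: r_def)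
    have t1: "- (8 * (r z * spike h (fst z))) \<le> r z * \<zeta>t z" "\<bar>r z * \<zeta>t z\<bar> \<le> 8 * (r z * spike h (fst z))" for z
    proof -
      have q: "0 \<le> - turn_off' (snd z)" "- turn_off' (snd z) \<le> 8"
        using smoothstep'_nonneg smoothstep'_le[of "3 - 4 * snd z"] by (auto simp: turn_off'_def)
      have p: "0 \<le> r z * spike h (fst z)" using r0 spike_bounds by simp
      have e: "r z * \<zeta>t z = - ((r z * spike h (fst z)) * (- turn_off' (snd z)))" by (simp add: \<zeta>t_def)
      have "0 \<le> (r z * spike h (fst z)) * (- turn_off' (snd z))" "(r z * spike h (fst z)) * (- turn_off' (snd z)) \<le> (r z * spike h (fst z)) * 8"
        using mult_nonneg_nonneg[OF p q(1)] mult_left_mono[OF q(2) p] by simp_all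
      then show "- (8 * (r z * spike h (fst z))) \<le> r z * \<zeta>t z" "\<bar>r z * \<zeta>t z\<bar> \<le> 8 * (r z * spike h (fst z))"
        unfolding e by linarith+
    qed
    have t2: "- (bump h (h - fst z) * \<theta> (snd z)) \<le> \<phi> (r z) * \<zeta>x z"
      "\<bar>\<phi> (r z) * \<zeta>x z\<bar> \<le> bump h (h + fst z) * \<theta> (snd z) + bump h (h - fst z) * \<theta> (snd z)" for z
    proof -
      have p: "0 \<le> \<phi> (r z)" "\<phi> (r z) \<le> 1" using \<phi> r0 by auto
      have e: "\<phi> (r z) * \<zeta>x z = \<phi> (r z) * (spike' h (fst z) * \<theta> (snd z))"
        using rz[of z] \<phi>(1) by (cases "z \<in> strip T") (auto simp: \<zeta>x_def \<theta>_def strip_def)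
      have b0: "0 \<le> bump h (h - fst z) * \<theta> (snd z)" using \<theta>b bump_bounds(1)[OF h] by simp
      have "- (bump h (h - fst z) * \<theta> (snd z)) \<le> \<phi> (r z) * (- (bump h (h - fst z) * \<theta> (snd z)))"
        using p b0 mult_left_le_one_le[of "bump h (h - fst z) * \<theta> (snd z)" "\<phi> (r z)"] by simp
      also have "\<dots> \<le> \<phi> (r z) * (spike' h (fst z) * \<theta> (snd z))"
        using p \<theta>b(1)[of "snd z"] mult_right_mono[OF spike'_bounds(1)[OF h, of "fst z"] \<theta>b(1)[of "snd z"]] by (intro mult_left_mono) auto
      finally show "- (bump h (h - fst z) * \<theta> (snd z)) \<le> \<phi> (r z) * \<zeta>x z" unfolding e .
      have "\<bar>\<phi> (r z) * \<zeta>x z\<bar> = \<phi> (r z) * (\<bar>spike' h (fst z)\<bar> * \<theta> (snd z))"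
        unfolding e abs_mult using p \<theta>b(1)[of "snd z"] by simp
      also have "\<dots> \<le> 1 * ((bump h (h + fst z) + bump h (h - fst z)) * \<theta> (snd z))"
        using p \<theta>b(1)[of "snd z"] spike'_bounds(2)[OF h, of "fst z"] by (intro mult_mono mult_right_mono) auto
      finally show "\<bar>\<phi> (r z) * \<zeta>x z\<bar> \<le> bump h (h + fst z) * \<theta> (snd z) + bump h (h - fst z) * \<theta> (snd z)"
        by (simp add: distrib_right)
    qed
    let ?K = "\<lambda>z. 8 * (r z * spike h (fst z)) + (bump h (h + fst z) * \<theta> (snd z) + bump h (h - fst z) * \<theta> (snd z))" and ?lo = "\<lambda>z. - (8 * (r z * spike h (fst z))) - bump h (h - fst z) * \<theta> (snd z)"
    have "integrable lborel ?I"
    proof (rule Bochner_Integration.integrable_bound)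
      show "integrable lborel (\<lambda>z. ?K z)"
        using rs pi by simp
      show "?I \<in> borel_measurable lborel" using Im by simp
      show "AE z in lborel. norm (?I z) \<le> norm (?K z)"
      proof (intro AE_I2)
        fix z
        show "norm (?I z) \<le> norm (?K z)"
          using t1(2)[of z] t2(2)[of z] unfolding real_norm_def by linarith
      qed
    qed
    then have "(LINT z|lborel. ?lo z) \<le> (LINT z|lborel. ?I z)"
    proof (intro integral_mono)
      fix z
      show "?lo z \<le> ?I z"
        using t1(1)[of z] t2(1)[of z] by linarith
    qed (use rs pi in auto)
    also have "(LINT z|lborel. ?lo z)
        = - (8 * (LINT z|lborel. r z * spike h (fst z))) - (LINT t|lborel. \<theta> t)"
      using rs pi by simp
    finally show ?thesis using I \<theta>1 by simp
  qed
  have "(\<lambda>n. LINT z|lborel. r z * spike (1 / real (Suc n)) (fst z)) \<longlonglongrightarrow> (LINT z|lborel. (\<lambda>_. 0) (z::real\<times>real))"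
  proof (rule integral_dominated_convergence[where w=r])
    have "AE z in (lborel :: (real \<times> real) measure). fst z \<noteq> 0"
    proof -
      have n: "AE x in lborel. x \<noteq> (0::real)" by (rule AE_lborel_singleton)
      have "AE z in lborel \<Otimes>\<^sub>M (lborel :: real measure). fst z \<noteq> (0::real)"
      proof (rule lborel_pair.AE_pair_measure)
        show "{z \<in> space (lborel \<Otimes>\<^sub>M lborel). fst z \<noteq> (0::real)} \<in> sets (lborel \<Otimes>\<^sub>M (lborel :: real measure))" by measurable
        show "AE x in lborel. AE t in lborel. fst (x, t :: real) \<noteq> (0::real)" using n by eventually_elim simp
      qed
      then show ?thesis unfolding lborel_prod .
    qed
    then show "AE z in lborel. (\<lambda>n. r z * spike (1 / real (Suc n)) (fst z)) \<longlonglongrightarrow> 0"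
    proof eventually_elim
      case (elim z)
      have "\<forall>\<^sub>F n in sequentially. 1 / real (Suc n) < \<bar>fst z\<bar>"
        using elim LIMSEQ_inverse_real_of_nat by (intro order_tendstoD(2)[of _ 0]) (auto simp: inverse_eq_divide)
      then have "\<forall>\<^sub>F n in sequentially. r z * spike (1 / real (Suc n)) (fst z) = 0"
        by eventually_elim (simp add: spike_eq_0)
      then show ?case by (rule tendsto_eventually)
    qed
    show "AE z in lborel. norm (r z * spike (1 / real (Suc n)) (fst z)) \<le> r z" for n
      using r0 spike_bounds by (intro AE_I2) (simp add: abs_mult mult_left_le)
    have "spike (1 / real (Suc n)) \<in> borel_measurable borel" for n
      by (intro borel_measurable_continuous_onI spike_continuous) simp
    then have "(\<lambda>z. r z * spike (1 / real (Suc n)) (fst z)) \<in> borel_measurable borel" for n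
      by (intro borel_measurable_times measurable_compose[OF fst_snd_borel(1)]) simp_all
    then show "(\<lambda>z. r z * spike (1 / real (Suc n)) (fst z)) \<in> borel_measurable lborel" for n by simp
  qed (use ri in auto)
  then have "(1 / 32 :: real) \<le> 0"
    by (intro LIMSEQ_le_const[of "\<lambda>n. LINT z|lborel. r z * spike (1 / real (Suc n)) (fst z)"]) (use main in auto)
  then show False by simp
qed

theorem proposition1p2:
  fixes T p :: real and u :: "(real \<times> real) measure"
  assumes "T > 1" and "p < 1" and "p \<noteq> 0"
    and "constructed_entropy_solution T (flux p) (return borel 0) u"
  shows "waiting_time T u > 0 \<longleftrightarrow>
    bounded ((\<lambda>s. flux p s - slope_at_infinity (flux p) * s) ` {0..})"
proof -
  have "waiting_time T u > 0 \<longleftrightarrow> p < 0"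
  proof (cases "p < 0")
    case True
    have sol: "solution T (flux p) (return borel 0) u"
      using assms(4) by (simp add: constructed_entropy_solution_def entropy_solution_def)
    have m: "flux p \<in> borel_measurable borel" unfolding flux_def[abs_def] by measurable
    let ?S = "{\<tau>\<in>{0<..T}. AE t in lebesgue_on {\<tau><..<T}.
            regular_slice T u t}"
    have "1 / 2 \<le> waiting_time T u"
      unfolding waiting_time_def
    proof (rule cInf_greatest)
      have "T \<in> ?S" using assms(1) by (auto intro!: AE_I2 simp: space_restrict_space)
      then show "?S \<noteq> {}" by blast
      fix \<tau> assume "\<tau> \<in> ?S"
      then have "AE t in lebesgue_on {\<tau><..<T}. emeasure (slice_s T u t) UNIV = 0" by auto
      then show "1 / 2 \<le> \<tau>"
        using flux_bounded_neg[OF True] flux_slope[OF assms(2,3)]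
        by (intro atom_survives[OF assms(1) sol m]) (auto simp: flux_def)
    qed
    then show ?thesis using True by simp
  next
    case False
    then have p: "0 < p" "p < 1" using assms by auto
    have "waiting_time T u \<le> 0"
    proof (rule waiting_time_eq_0)
      show T: "0 < T" using assms(1) by simp
      fix \<tau> :: real assume \<tau>: "0 < \<tau>" "\<tau> < T"
      obtain k where k: "0 < k" "1 + 1 \<le> \<tau> * (flux p k - k * (p * (1 + k) powr (p - 1)))"
        using flux_gap_unbounded[OF p \<tau>(1), of "1 + 1"] by auto
      show "AE t in lebesgue_on {\<tau><..<T}. regular_slice T u t"
        by (rule regular_after_positive_time[OF T assms(4) _ _ concave_flux_power[OF p] \<tau>(1) k]) (simp_all add: measure_return)
    qed
    then show ?thesis using False by simp
  qed
  then show ?thesis using flux_bounded_iff[OF assms(2,3)] by simp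
qed

end
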